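(* Let $\mathbb{K}$ be an arbitrary field and let $A$ be the quadratic $\mathbb{K}$-algebra given by generators $x,y,z$ and relations $xx+yx=xz=zy=0$. Then $A$ is Koszul, its Koszul dual algebra $A^!$ has Hilbert series $H_{A^!}(t)=1+3t+3t^2+2t^3+t^4$, and $A$ has global homological dimension $4$. In particular, since $\dim A_1=3<4$, it is not true that every Koszul algebra $A$ of finite global homological dimension $d$ satisfies $\dim A_1\geqslant d$.
   Context: For a finite-dimensional vector space $V$ over $\mathbb{K}$, let $F(V)$ be the tensor (free associative) algebra of $V$. For a subspace $R\subseteq V\otimes V$, the quadratic algebra $A(V,R)$ is the quotient of $F(V)$ by the two-sided ideal generated by $R$, with the induced degree grading. The Hilbert series of a graded algebra $A$ is $H_A(t)=\sum_{j=0}^\infty\dim_{\mathbb{K}}(A_j)\,t^j$. Given a basis $x_1,\dots,x_n$ of $V$, define a bilinear form on $\mathbb{K}\langle x_1,\dots,x_n\rangle=F(V)$ by $[u,v]=\delta_{u,v}$ for monomials $u,v$. The Koszul dual of $A=A(V,R)$ is $A^!=A(V,R^\perp)$, where $R^\perp=\{u\in V\otimes V:[r,u]=0\text{ for each }r\in R\}$; up to graded isomorphism it does not depend on the basis. A degree graded algebra $A$ (a quotient of some $F(V)$ by a proper graded ideal) is called Koszul if the graded left $A$-module $\mathbb{K}$ (with structure given by the augmentation map) has a free graded resolution $\dots\to M_m\to\dots\to M_1\to A\to\mathbb{K}\to 0$, where $A\to\mathbb{K}$ is the augmentation map and each $M_k$ is a free graded module generated in degree $k$. *)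

theory Defs
  imports
    "HOL-Computational_Algebra.Formal_Power_Series"
    "HOL-Library.Extended_Nat"
    "HOL-Algebra.Embedded_Algebras"
    "HOL-Algebra.QuotRing"
begin

section \<open>The free algebra and its graded quotients\<close>

text \<open>The tensor algebra of an \<open>n\<close>-dimensional space with basis \<open>x\<^sub>0, \<dots>, x\<^sub>n\<^sub>-\<^sub>1\<close>:
  a monomial is the list of its indices, an element is its finitely supported coefficient function.\<close>

definition free_algebra :: "nat \<Rightarrow> (nat list \<Rightarrow> 'k::field) ring" where
  "free_algebra n =
    \<lparr>carrier = {f. finite {w. f w \<noteq> 0} \<and> (\<forall>w. f w \<noteq> 0 \<longrightarrow> set w \<subseteq> {..<n})},
     mult = (\<lambda>f g w. \<Sum>k\<le>length w. f (take k w) * g (drop k w)),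
     one = (\<lambda>w. if w = [] then 1 else 0),
     zero = (\<lambda>w. 0),
     add = (\<lambda>f g w. f w + g w)\<rparr>"

lemma free_algebra_mult_assoc_aux:
  fixes f g h :: "nat list \<Rightarrow> 'k::field"
  shows "(\<Sum>k\<le>length w. (\<Sum>i\<le>length (take k w). f (take i (take k w)) * g (drop i (take k w))) * h (drop k w))
   = (\<Sum>k\<le>length w. f (take k w) * (\<Sum>i\<le>length (drop k w). g (take i (drop k w)) * h (drop i (drop k w))))"
proof -
  let ?n = "length w"
  have "(\<Sum>k\<le>?n. (\<Sum>i\<le>length (take k w). f (take i (take k w)) * g (drop i (take k w))) * h (drop k w))
    = (\<Sum>k\<le>?n. \<Sum>i\<le>k. f (take i w) * g (take (k-i) (drop i w)) * h (drop k w))"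
    by (auto simp: sum_distrib_right min_def drop_take intro!: sum.cong)
  also have "\<dots> = (\<Sum>(k,i)\<in>Sigma {..?n} (\<lambda>k. {..k}). f (take i w) * g (take (k-i) (drop i w)) * h (drop k w))"
    by (simp add: sum.Sigma)
  also have "\<dots> = (\<Sum>(k,i)\<in>Sigma {..?n} (\<lambda>k. {..?n-k}). f (take k w) * (g (take i (drop k w)) * h (drop i (drop k w))))"
    by (rule sum.reindex_bij_witness[of _ "\<lambda>(k,i). (k+i,k)" "\<lambda>(k,i). (i,k-i)"]) (auto simp: algebra_simps)
  also have "\<dots> = (\<Sum>k\<le>?n. f (take k w) * (\<Sum>i\<le>length (drop k w). g (take i (drop k w)) * h (drop i (drop k w))))"
    by (simp add: sum.Sigma[symmetric] sum_distrib_left)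
  finally show ?thesis .
qed

lemma free_algebra_mult_closed:
  assumes "f \<in> carrier (free_algebra n)" "g \<in> carrier (free_algebra n)"
  shows "f \<otimes>\<^bsub>free_algebra n\<^esub> g \<in> carrier (free_algebra n :: (nat list \<Rightarrow> 'k::field) ring)"
proof -
  let ?m = "f \<otimes>\<^bsub>free_algebra n\<^esub> g"
  have ex: "\<exists>k\<le>length w. f (take k w) \<noteq> 0 \<and> g (drop k w) \<noteq> 0" if "?m w \<noteq> 0" for w
  proof (rule ccontr)
    assume "\<not> ?thesis" then have "?m w = 0" by (auto simp: free_algebra_def intro!: sum.neutral)
    with that show False by simp
  qed
  have "{w. ?m w \<noteq> 0} \<subseteq> (\<lambda>(u,v). u @ v) ` ({w. f w \<noteq> 0} \<times> {w. g w \<noteq> 0})"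
    using ex by (force intro: rev_image_eqI)
  moreover have "finite ({w. f w \<noteq> 0} \<times> {w. g w \<noteq> 0})" using assms by (auto simp: free_algebra_def)
  ultimately have fin: "finite {w. ?m w \<noteq> 0}" by (meson finite_surj)
  have "set w \<subseteq> {..<n}" if w: "?m w \<noteq> 0" for w
  proof -
    obtain k where "f (take k w) \<noteq> 0" "g (drop k w) \<noteq> 0" using ex[OF w] by blast
    with assms have "set (take k w) \<subseteq> {..<n}" "set (drop k w) \<subseteq> {..<n}" by (auto simp: free_algebra_def)
    then have "set (take k w @ drop k w) \<subseteq> {..<n}" by (simp only: set_append) simp
    then show ?thesis by simp
  qed
  with fin show ?thesis by (simp add: free_algebra_def)
qed

lemma ring_free_algebra: "ring (free_algebra n :: (nat list \<Rightarrow> 'k::field) ring)"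
proof (intro ringI abelian_groupI monoidI)
  fix f g :: "nat list \<Rightarrow> 'k" let ?F = "free_algebra n :: (nat list \<Rightarrow> 'k::field) ring"
  assume a: "f \<in> carrier ?F" "g \<in> carrier ?F"
  show "f \<otimes>\<^bsub>?F\<^esub> g \<in> carrier ?F" using a by (rule free_algebra_mult_closed)
  have "{w. f w + g w \<noteq> 0} \<subseteq> {w. f w \<noteq> 0} \<union> {w. g w \<noteq> 0}" by auto
  then show "f \<oplus>\<^bsub>?F\<^esub> g \<in> carrier ?F" using a
    by (auto simp: free_algebra_def dest: finite_subset)
next
  fix f :: "nat list \<Rightarrow> 'k" let ?F = "free_algebra n :: (nat list \<Rightarrow> 'k::field) ring"
  assume a: "f \<in> carrier ?F"
  show "\<one>\<^bsub>?F\<^esub> \<otimes>\<^bsub>?F\<^esub> f = f"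
  proof
    fix w
    have "(\<one>\<^bsub>?F\<^esub> \<otimes>\<^bsub>?F\<^esub> f) w = (\<Sum>k\<le>length w. if k = 0 then f w else 0)"
      unfolding free_algebra_def monoid.simps by (rule sum.cong) auto
    then show "(\<one>\<^bsub>?F\<^esub> \<otimes>\<^bsub>?F\<^esub> f) w = f w" by simp
  qed
  show "f \<otimes>\<^bsub>?F\<^esub> \<one>\<^bsub>?F\<^esub> = f"
  proof
    fix w
    have "(f \<otimes>\<^bsub>?F\<^esub> \<one>\<^bsub>?F\<^esub>) w = (\<Sum>k\<le>length w. if k = length w then f w else 0)"
      unfolding free_algebra_def monoid.simps by (rule sum.cong) auto
    then show "(f \<otimes>\<^bsub>?F\<^esub> \<one>\<^bsub>?F\<^esub>) w = f w" by simp
  qed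
  show "\<exists>g\<in>carrier ?F. g \<oplus>\<^bsub>?F\<^esub> f = \<zero>\<^bsub>?F\<^esub>"
    using a by (intro bexI[of _ "\<lambda>w. - f w"]) (auto simp: free_algebra_def)
next
  fix f g h :: "nat list \<Rightarrow> 'k" let ?F = "free_algebra n :: (nat list \<Rightarrow> 'k::field) ring"
  show "f \<otimes>\<^bsub>?F\<^esub> g \<otimes>\<^bsub>?F\<^esub> h = f \<otimes>\<^bsub>?F\<^esub> (g \<otimes>\<^bsub>?F\<^esub> h)"
    unfolding free_algebra_def monoid.simps by (rule ext, rule free_algebra_mult_assoc_aux)
qed (auto simp: free_algebra_def fun_eq_iff algebra_simps sum.distrib)

definition gen :: "nat \<Rightarrow> nat list \<Rightarrow> 'k::field" where
  "gen i = (\<lambda>w. if w = [i] then 1 else 0)"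

definition scalar :: "'k \<Rightarrow> nat list \<Rightarrow> 'k::field" where
  "scalar c = (\<lambda>w. if w = [] then c else 0)"

definition free_deg :: "nat \<Rightarrow> nat \<Rightarrow> (nat list \<Rightarrow> 'k::field) set" where
  "free_deg n j = {f \<in> carrier (free_algebra n). \<forall>w. f w \<noteq> 0 \<longrightarrow> length w = j}"

definition hom_component :: "nat \<Rightarrow> (nat list \<Rightarrow> 'k::field) \<Rightarrow> nat list \<Rightarrow> 'k" where
  "hom_component j f = (\<lambda>w. if length w = j then f w else 0)"

definition proper_graded_ideal :: "nat \<Rightarrow> (nat list \<Rightarrow> 'k::field) set \<Rightarrow> bool" where
  "proper_graded_ideal n I \<longleftrightarrow>
     ideal I (free_algebra n) \<and> I \<noteq> carrier (free_algebra n) \<and>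
     (\<forall>f\<in>I. \<forall>j. hom_component j f \<in> I)"

text \<open>A degree graded algebra is given by \<open>n\<close> and a proper graded ideal \<open>I\<close>.\<close>

abbreviation quot_alg :: "nat \<Rightarrow> (nat list \<Rightarrow> 'k::field) set \<Rightarrow> (nat list \<Rightarrow> 'k) set ring" where
  "quot_alg n I \<equiv> free_algebra n Quot I"

definition alg_deg ::
    "nat \<Rightarrow> (nat list \<Rightarrow> 'k::field) set \<Rightarrow> nat \<Rightarrow> (nat list \<Rightarrow> 'k) set set" where
  "alg_deg n I j = (\<lambda>f. I +>\<^bsub>free_algebra n\<^esub> f) ` free_deg n j"

text \<open>Dimension over the copy of the ground field inside the algebra.\<close>

definition alg_dim :: "nat \<Rightarrow> (nat list \<Rightarrow> 'k::field) set \<Rightarrow> nat \<Rightarrow> nat" where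
  "alg_dim n I j =
     ring.dim (quot_alg n I) (range (\<lambda>c. I +>\<^bsub>free_algebra n\<^esub> scalar c)) (alg_deg n I j)"

definition hilbert_series :: "nat \<Rightarrow> (nat list \<Rightarrow> 'k::field) set \<Rightarrow> int fps" where
  "hilbert_series n I = Abs_fps (\<lambda>j. int (alg_dim n I j))"

section \<open>Quadratic algebras and their Koszul duals\<close>

text \<open>\<open>A(V,R)\<close> is \<open>quot_alg n (quadratic_ideal n R)\<close> for \<open>R \<subseteq> free_deg n 2\<close>;
  its Koszul dual is \<open>quot_alg n (quadratic_ideal n (orth n R))\<close>.\<close>

definition quadratic_ideal ::
    "nat \<Rightarrow> (nat list \<Rightarrow> 'k::field) set \<Rightarrow> (nat list \<Rightarrow> 'k) set" where
  "quadratic_ideal n R = Idl\<^bsub>free_algebra n\<^esub> R"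

definition pairing :: "(nat list \<Rightarrow> 'k::field) \<Rightarrow> (nat list \<Rightarrow> 'k) \<Rightarrow> 'k" where
  "pairing f g = (\<Sum>w\<in>{w. f w \<noteq> 0}. f w * g w)"

definition orth :: "nat \<Rightarrow> (nat list \<Rightarrow> 'k::field) set \<Rightarrow> (nat list \<Rightarrow> 'k) set" where
  "orth n R = {u \<in> free_deg n 2. \<forall>r\<in>R. pairing r u = 0}"

section \<open>Left modules over a noncommutative ring\<close>

text \<open>The library locale \<^locale>\<open>module\<close> requires a commutative ring. Its record type is reused;
  the ring multiplication in the record of a module is irrelevant.\<close>

locale left_module = R?: ring R + M?: abelian_group M
    for R :: "('a, 'b) ring_scheme" (structure) and M :: "('a, 'm) module" (structure) +
  assumes smult_closed:
      "\<lbrakk>a \<in> carrier R; x \<in> carrier M\<rbrakk> \<Longrightarrow> a \<odot>\<^bsub>M\<^esub> x \<in> carrier M"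
    and smult_l_distr:
      "\<lbrakk>a \<in> carrier R; b \<in> carrier R; x \<in> carrier M\<rbrakk> \<Longrightarrow>
        (a \<oplus>\<^bsub>R\<^esub> b) \<odot>\<^bsub>M\<^esub> x = a \<odot>\<^bsub>M\<^esub> x \<oplus>\<^bsub>M\<^esub> b \<odot>\<^bsub>M\<^esub> x"
    and smult_r_distr:
      "\<lbrakk>a \<in> carrier R; x \<in> carrier M; y \<in> carrier M\<rbrakk> \<Longrightarrow>
        a \<odot>\<^bsub>M\<^esub> (x \<oplus>\<^bsub>M\<^esub> y) = a \<odot>\<^bsub>M\<^esub> x \<oplus>\<^bsub>M\<^esub> a \<odot>\<^bsub>M\<^esub> y"
    and smult_assoc:
      "\<lbrakk>a \<in> carrier R; b \<in> carrier R; x \<in> carrier M\<rbrakk> \<Longrightarrow>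
        (a \<otimes>\<^bsub>R\<^esub> b) \<odot>\<^bsub>M\<^esub> x = a \<odot>\<^bsub>M\<^esub> (b \<odot>\<^bsub>M\<^esub> x)"
    and smult_one: "x \<in> carrier M \<Longrightarrow> \<one>\<^bsub>R\<^esub> \<odot>\<^bsub>M\<^esub> x = x"

definition lmod_hom ::
    "('a, 'b) ring_scheme \<Rightarrow> ('a, 'm) module \<Rightarrow> ('a, 'n) module \<Rightarrow> ('m \<Rightarrow> 'n) set" where
  "lmod_hom R M N =
     {h \<in> carrier M \<rightarrow> carrier N.
        (\<forall>x\<in>carrier M. \<forall>y\<in>carrier M. h (x \<oplus>\<^bsub>M\<^esub> y) = h x \<oplus>\<^bsub>N\<^esub> h y) \<and>
        (\<forall>a\<in>carrier R. \<forall>x\<in>carrier M. h (a \<odot>\<^bsub>M\<^esub> x) = a \<odot>\<^bsub>N\<^esub> h x)}"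

definition regular_module :: "('a, 'b) ring_scheme \<Rightarrow> ('a, 'a) module" where
  "regular_module R =
    \<lparr>carrier = carrier R, mult = mult R, one = one R, zero = zero R, add = add R,
     smult = mult R\<rparr>"

text \<open>The free module with basis indexed by \<open>B\<close>: finitely supported functions on \<open>B\<close>,
  extended by zero.\<close>

definition free_module :: "('a, 'b) ring_scheme \<Rightarrow> 'i set \<Rightarrow> ('a, 'i \<Rightarrow> 'a) module" where
  "free_module R B =
    \<lparr>carrier = {f. finite {b. f b \<noteq> \<zero>\<^bsub>R\<^esub>} \<and> (\<forall>b\<in>B. f b \<in> carrier R) \<and>
                  (\<forall>b. b \<notin> B \<longrightarrow> f b = \<zero>\<^bsub>R\<^esub>)},
     mult = undefined, one = undefined,
     zero = (\<lambda>b. \<zero>\<^bsub>R\<^esub>),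
     add = (\<lambda>f g b. f b \<oplus>\<^bsub>R\<^esub> g b),
     smult = (\<lambda>a f b. a \<otimes>\<^bsub>R\<^esub> f b)\<rparr>"

section \<open>Koszul algebras\<close>

text \<open>For a proper graded ideal \<open>I\<close> all representatives of a coset have the same constant term.\<close>

definition augmentation :: "(nat list \<Rightarrow> 'k::field) set \<Rightarrow> 'k" where
  "augmentation C = (THE c. \<exists>f\<in>C. f [] = c)"

definition trivial_module :: "((nat list \<Rightarrow> 'k::field) set, 'k) module" where
  "trivial_module =
    \<lparr>carrier = UNIV, mult = (*), one = 1, zero = 0, add = (+),
     smult = (\<lambda>a c. augmentation a * c)\<rparr>"

text \<open>Degree \<open>j\<close> part of the free graded module whose basis \<open>B\<close> is placed in degree \<open>k\<close>.\<close>

definition free_module_deg ::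
    "nat \<Rightarrow> (nat list \<Rightarrow> 'k::field) set \<Rightarrow> nat \<Rightarrow> 'i set \<Rightarrow> nat \<Rightarrow>
       ('i \<Rightarrow> (nat list \<Rightarrow> 'k) set) set" where
  "free_module_deg n I k B j =
     {f \<in> carrier (free_module (quot_alg n I) B).
        \<forall>b\<in>B. f b \<in> (if k \<le> j then alg_deg n I (j - k) else {\<zero>\<^bsub>quot_alg n I\<^esub>})}"

text \<open>Bases indexed by sets of natural numbers suffice: the basis of the \<open>k\<close>-th module of such a
  resolution spans its degree \<open>k\<close> part, which exactness embeds into the degree \<open>k\<close> part of the
  preceding module, so by induction all bases are finite.\<close>

definition koszul :: "nat \<Rightarrow> (nat list \<Rightarrow> 'k::field) set \<Rightarrow> bool" where
  "koszul n I \<longleftrightarrow> proper_graded_ideal n I \<and>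
     (\<exists>(B :: nat \<Rightarrow> nat set) d\<^sub>1 d.
        let A = quot_alg n I; M = (\<lambda>k. free_module A (B k)) in
          augmentation ` carrier (regular_module A) = carrier (trivial_module :: (_, 'k) module) \<and>
          d\<^sub>1 \<in> lmod_hom A (M 1) (regular_module A) \<and>
          (\<forall>j. d\<^sub>1 ` free_module_deg n I 1 (B 1) j \<subseteq> alg_deg n I j) \<and>
          d\<^sub>1 ` carrier (M 1) = a_kernel (regular_module A) trivial_module augmentation \<and>
          (\<forall>k\<ge>2. d k \<in> lmod_hom A (M k) (M (k - 1)) \<and>
             (\<forall>j. d k ` free_module_deg n I k (B k) j \<subseteq> free_module_deg n I (k - 1) (B (k - 1)) j)) \<and>
          d 2 ` carrier (M 2) = a_kernel (M 1) (regular_module A) d\<^sub>1 \<and>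
          (\<forall>k\<ge>2. d (k + 1) ` carrier (M (k + 1)) = a_kernel (M k) (M (k - 1)) (d k)))"

section \<open>Global homological dimension\<close>

text \<open>Projective means direct summand of a free module. Nothing is lost by indexing the basis by
  elements of \<open>P\<close>: a projective \<open>P\<close> is a direct summand of the free module on its carrier.\<close>

definition projective :: "('a, 'b) ring_scheme \<Rightarrow> ('a, 'p) module \<Rightarrow> bool" where
  "projective R P \<longleftrightarrow> left_module R P \<and>
     (\<exists>B :: 'p set. \<exists>s \<in> lmod_hom R P (free_module R B). \<exists>p \<in> lmod_hom R (free_module R B) P.
        \<forall>x\<in>carrier P. p (s x) = x)"

text \<open>\<open>0 \<rightarrow> P\<^sub>n \<rightarrow> \<dots> \<rightarrow> P\<^sub>0 \<rightarrow> M \<rightarrow> 0\<close> exact. The \<open>P\<^sub>i\<close> live on the fixed type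
  \<open>('m \<times> 'a) list \<Rightarrow> 'a\<close>. This is no restriction: the index type \<open>('m \<times> 'a) list\<close> is infinite and
  at least as large as \<open>'m\<close> and \<open>'a\<close>, so \<open>M\<close> and, successively, all syzygies are covered by free
  modules whose bases are subsets of it, and the last syzygy is a submodule of such a module.\<close>

definition has_projective_resolution ::
    "('a, 'b) ring_scheme \<Rightarrow> ('a, 'm) module \<Rightarrow> nat \<Rightarrow> bool" where
  "has_projective_resolution R M n \<longleftrightarrow>
     (\<exists>(P :: nat \<Rightarrow> ('a, ('m \<times> 'a) list \<Rightarrow> 'a) module) \<epsilon> d.
        (\<forall>i. projective R (P i)) \<and>
        (\<forall>i>n. carrier (P i) = {\<zero>\<^bsub>P i\<^esub>}) \<and>
        \<epsilon> \<in> lmod_hom R (P 0) M \<and>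
        (\<forall>i. d i \<in> lmod_hom R (P (Suc i)) (P i)) \<and>
        \<epsilon> ` carrier (P 0) = carrier M \<and>
        d 0 ` carrier (P (Suc 0)) = a_kernel (P 0) M \<epsilon> \<and>
        (\<forall>i. d (Suc i) ` carrier (P (Suc (Suc i))) = a_kernel (P (Suc i)) (P i) (d i)))"

definition projective_dimension :: "('a, 'b) ring_scheme \<Rightarrow> ('a, 'm) module \<Rightarrow> enat" where
  "projective_dimension R M = Inf {enat n | n. has_projective_resolution R M n}"

text \<open>Left global dimension: the supremum of the projective dimensions of all left modules, graded or not. HOL cannot quantify over all
  types at once, so it is taken over the modules carried by subsets of the type \<open>'a set + 'u\<close>. The
  summand \<open>'a set\<close> contains copies of all cyclic modules, hence (Auslander) the value is the global
  dimension for every type \<open>'u\<close>; the free type \<open>'u\<close> lets a theorem about it cover modules on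
  any type.\<close>

definition global_dimension :: "'u itself \<Rightarrow> ('a, 'b) ring_scheme \<Rightarrow> enat" where
  "global_dimension U R =
     (SUP M \<in> {M :: ('a, 'a set + 'u) module. left_module R M}. projective_dimension R M)"

end

theory Submission
  imports Defs
begin

text \<open>
  In the generators \<open>u = x + y\<close>, \<open>x\<close>, \<open>z\<close> the relations read \<open>ux = 0\<close>, \<open>xz = 0\<close>, \<open>zu = zx\<close>. A Groebner
  basis shows that right multiplication by \<open>u\<close> is injective and that the left annihilators of \<open>x\<close> and
  \<open>z\<close> are \<open>Au\<close> and \<open>Ax\<close>; this makes the Koszul complex
  \<open>0 \<rightarrow> A \<rightarrow> A\<^sup>2 \<rightarrow> A\<^sup>3 \<rightarrow> A\<^sup>3 \<rightarrow> A \<rightarrow> K \<rightarrow> 0\<close> exact. Its bimodule version, applied to \<open>A \<otimes>\<^sub>K M\<close>, resolves an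
  arbitrary, not necessarily graded, module \<open>M\<close>: since the additional terms lower the degree of the
  coefficients in \<open>A\<close>, exactness follows from the graded case by induction on the degree. So the global
  dimension is at most \<open>4\<close>. If \<open>K\<close> had a projective resolution of length \<open>3\<close>, comparing it with the Koszul
  resolution would give a retraction of the last differential, that is, a right inverse of \<open>u\<close>.
\<close>

section \<open>Modules over a ring\<close>

text \<open>The relation \<open>xx + yx\<close> factors as \<open>(x + y)x\<close>. After the
  substitution only the third relation has two terms, and it merely exchanges one word for another;
  every reduction sends a word to a word or to zero, and no sums have to be carried along. The
  independence of the normal words is obtained without resolving overlaps: the free algebra acts on
  functions on words, and a normal word applied to the empty word returns itself. A module that is
  not graded offers no degree of its own, so all degrees are measured in coefficients. This requires
  a substitute for the tensor product over the field: the free module on a basis of the module over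
  K, found by Zorn's lemma, on which both factors act by explicit linear operators. The ranks 1, 3,
  3, 2, 1 count chains of overlapping relations, the same chains that index a basis of the dual
  algebra. For the lower bound, \<open>y\<close> acts as zero on K, which leaves of the last
  differential only right multiplication by \<open>u\<close>; that \<open>u\<close> has no right
  inverse is seen from its constant term.\<close>

lemma lmod_homI:
  assumes "\<And>x. x \<in> carrier M \<Longrightarrow> h x \<in> carrier N"
    and "\<And>x y. \<lbrakk>x \<in> carrier M; y \<in> carrier M\<rbrakk> \<Longrightarrow> h (x \<oplus>\<^bsub>M\<^esub> y) = h x \<oplus>\<^bsub>N\<^esub> h y"
    and "\<And>a x. \<lbrakk>a \<in> carrier R; x \<in> carrier M\<rbrakk> \<Longrightarrow> h (a \<odot>\<^bsub>M\<^esub> x) = a \<odot>\<^bsub>N\<^esub> h x"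
  shows "h \<in> lmod_hom R M N"
  using assms by (auto simp: lmod_hom_def)

lemma lmod_homD:
  assumes "h \<in> lmod_hom R M N"
  shows lmod_hom_closed: "x \<in> carrier M \<Longrightarrow> h x \<in> carrier N"
    and lmod_hom_add: "\<lbrakk>x \<in> carrier M; y \<in> carrier M\<rbrakk> \<Longrightarrow> h (x \<oplus>\<^bsub>M\<^esub> y) = h x \<oplus>\<^bsub>N\<^esub> h y"
    and lmod_hom_smult: "\<lbrakk>a \<in> carrier R; x \<in> carrier M\<rbrakk> \<Longrightarrow> h (a \<odot>\<^bsub>M\<^esub> x) = a \<odot>\<^bsub>N\<^esub> h x"
  using assms by (auto simp: lmod_hom_def)

lemma lmod_hom_comp:
  assumes "g \<in> lmod_hom R M N" "h \<in> lmod_hom R N P"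
  shows "(\<lambda>x. h (g x)) \<in> lmod_hom R M P"
  by (rule lmod_homI) (simp_all add: lmod_homD[OF assms(1)] lmod_homD[OF assms(2)])

lemma lmod_hom_id: "(\<lambda>x. x) \<in> lmod_hom R M M"
  by (rule lmod_homI) auto

context left_module
begin

lemma smult_l_null [simp]:
  assumes "x \<in> carrier M" shows "\<zero> \<odot>\<^bsub>M\<^esub> x = \<zero>\<^bsub>M\<^esub>"
proof -
  have "\<zero> \<odot>\<^bsub>M\<^esub> x \<oplus>\<^bsub>M\<^esub> \<zero> \<odot>\<^bsub>M\<^esub> x = \<zero> \<odot>\<^bsub>M\<^esub> x"
    using assms smult_l_distr[of \<zero> \<zero> x] by simp
  then show ?thesis using assms by (metis M.add.r_cancel_one' smult_closed R.zero_closed)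
qed

lemma smult_r_null [simp]:
  assumes "a \<in> carrier R" shows "a \<odot>\<^bsub>M\<^esub> \<zero>\<^bsub>M\<^esub> = \<zero>\<^bsub>M\<^esub>"
proof -
  have "a \<odot>\<^bsub>M\<^esub> \<zero>\<^bsub>M\<^esub> \<oplus>\<^bsub>M\<^esub> a \<odot>\<^bsub>M\<^esub> \<zero>\<^bsub>M\<^esub> = a \<odot>\<^bsub>M\<^esub> \<zero>\<^bsub>M\<^esub>"
    using assms smult_r_distr[of a "\<zero>\<^bsub>M\<^esub>" "\<zero>\<^bsub>M\<^esub>"] by simp
  then show ?thesis using assms by (metis M.add.r_cancel_one' smult_closed M.zero_closed)
qed

lemma smult_l_minus:
  assumes "a \<in> carrier R" "x \<in> carrier M" shows "(\<ominus> a) \<odot>\<^bsub>M\<^esub> x = \<ominus>\<^bsub>M\<^esub> (a \<odot>\<^bsub>M\<^esub> x)"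
  using assms smult_l_distr[of "\<ominus> a" a x]
  by (intro M.minus_equality[symmetric]) (auto simp: R.l_neg smult_closed)

lemma smult_r_minus:
  assumes "a \<in> carrier R" "x \<in> carrier M" shows "a \<odot>\<^bsub>M\<^esub> (\<ominus>\<^bsub>M\<^esub> x) = \<ominus>\<^bsub>M\<^esub> (a \<odot>\<^bsub>M\<^esub> x)"
  using assms smult_r_distr[of a "\<ominus>\<^bsub>M\<^esub> x" x]
  by (intro M.minus_equality[symmetric]) (auto simp: M.l_neg smult_closed)

lemma finsum_smult:
  assumes "a \<in> carrier R" "f \<in> S \<rightarrow> carrier M"
  shows "a \<odot>\<^bsub>M\<^esub> (\<Oplus>\<^bsub>M\<^esub>i\<in>S. f i) = (\<Oplus>\<^bsub>M\<^esub>i\<in>S. a \<odot>\<^bsub>M\<^esub> f i)"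
  using assms(2)
proof (induction S rule: infinite_finite_induct)
  case (insert s S)
  then show ?case using assms(1)
    by (simp add: Pi_iff smult_closed smult_r_distr M.finsum_closed)
qed (use assms(1) in auto)

lemma lmod_hom_zero_map: "left_module R N \<Longrightarrow> (\<lambda>x. \<zero>\<^bsub>M\<^esub>) \<in> lmod_hom R N M"
  by (rule lmod_homI) auto

lemma lmod_hom_add_map:
  assumes "g \<in> lmod_hom R N M" "h \<in> lmod_hom R N M"
  shows "(\<lambda>x. g x \<oplus>\<^bsub>M\<^esub> h x) \<in> lmod_hom R N M"
  by (rule lmod_homI)
    (simp_all add: lmod_homD[OF assms(1)] lmod_homD[OF assms(2)] smult_r_distr M.add.m_ac)

lemma lmod_hom_uminus_map:
  assumes "g \<in> lmod_hom R N M"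
  shows "(\<lambda>x. \<ominus>\<^bsub>M\<^esub> g x) \<in> lmod_hom R N M"
  by (rule lmod_homI) (simp_all add: lmod_homD[OF assms(1)] smult_r_minus M.minus_add)

lemma lmod_hom_minus_map:
  assumes "g \<in> lmod_hom R N M" "h \<in> lmod_hom R N M"
  shows "(\<lambda>x. g x \<ominus>\<^bsub>M\<^esub> h x) \<in> lmod_hom R N M"
  unfolding M.minus_eq by (intro lmod_hom_add_map lmod_hom_uminus_map assms)

end

lemma lmod_hom_zero:
  assumes "left_module R M" "left_module R N" "h \<in> lmod_hom R M N"
  shows "h \<zero>\<^bsub>M\<^esub> = \<zero>\<^bsub>N\<^esub>"
proof -
  interpret M: left_module R M by fact
  interpret N: left_module R N by fact
  have "h (\<zero>\<^bsub>R\<^esub> \<odot>\<^bsub>M\<^esub> \<zero>\<^bsub>M\<^esub>) = \<zero>\<^bsub>R\<^esub> \<odot>\<^bsub>N\<^esub> h \<zero>\<^bsub>M\<^esub>"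
    by (intro lmod_hom_smult[OF assms(3)]) auto
  then show ?thesis by (simp add: lmod_hom_closed[OF assms(3)])
qed

lemma lmod_hom_uminus:
  assumes "left_module R M" "left_module R N" "h \<in> lmod_hom R M N" "x \<in> carrier M"
  shows "h (\<ominus>\<^bsub>M\<^esub> x) = \<ominus>\<^bsub>N\<^esub> h x"
proof -
  interpret M: left_module R M by fact
  interpret N: left_module R N by fact
  have "h (\<ominus>\<^bsub>M\<^esub> x \<oplus>\<^bsub>M\<^esub> x) = h (\<ominus>\<^bsub>M\<^esub> x) \<oplus>\<^bsub>N\<^esub> h x"
    using assms(4) by (intro lmod_hom_add[OF assms(3)]) auto
  then show ?thesis using assms(4)
    by (intro N.M.minus_equality[symmetric])
      (auto simp: lmod_hom_closed[OF assms(3)] M.M.l_neg lmod_hom_zero[OF assms(1-3)])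
qed

lemma lmod_hom_minus:
  assumes "left_module R M" "left_module R N" "h \<in> lmod_hom R M N" "x \<in> carrier M" "y \<in> carrier M"
  shows "h (x \<ominus>\<^bsub>M\<^esub> y) = h x \<ominus>\<^bsub>N\<^esub> h y"
proof -
  interpret M: left_module R M by fact
  interpret N: left_module R N by fact
  show ?thesis using assms(4,5)
    by (simp add: M.M.minus_eq N.M.minus_eq lmod_hom_add[OF assms(3)] lmod_hom_uminus[OF assms(1-3)])
qed

subsection \<open>Free modules\<close>

lemma free_module_simps:
  "f \<in> carrier (free_module R B) \<longleftrightarrow>
     finite {b. f b \<noteq> \<zero>\<^bsub>R\<^esub>} \<and> (\<forall>b\<in>B. f b \<in> carrier R) \<and> (\<forall>b. b \<notin> B \<longrightarrow> f b = \<zero>\<^bsub>R\<^esub>)"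
  "\<zero>\<^bsub>free_module R B\<^esub> = (\<lambda>b. \<zero>\<^bsub>R\<^esub>)"
  "f \<oplus>\<^bsub>free_module R B\<^esub> g = (\<lambda>b. f b \<oplus>\<^bsub>R\<^esub> g b)"
  "a \<odot>\<^bsub>free_module R B\<^esub> f = (\<lambda>b. a \<otimes>\<^bsub>R\<^esub> f b)"
  by (simp_all add: free_module_def)

context ring
begin

lemma free_module_app [simp]: "f \<in> carrier (free_module R B) \<Longrightarrow> f b \<in> carrier R"
  by (cases "b \<in> B") (auto simp: free_module_simps)

lemma free_module_supp: "f \<in> carrier (free_module R B) \<Longrightarrow> {b. f b \<noteq> \<zero>} \<subseteq> B"
  by (auto simp: free_module_simps)

lemma left_module_free_module: "left_module R (free_module R (B :: 'c set))"
proof -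
  have fin: "finite {b. f b \<oplus> g b \<noteq> \<zero>}" if "finite {b. f b \<noteq> \<zero>}" "finite {b. g b \<noteq> \<zero>}" for f g :: "'c \<Rightarrow> 'a"
    by (rule finite_subset[OF _ finite_UnI[OF that]]) auto
  have fin2: "finite {b. a \<otimes> f b \<noteq> \<zero>}" if "finite {b. f b \<noteq> \<zero>}" "a \<in> carrier R" for a and f :: "'c \<Rightarrow> 'a"
    by (rule finite_subset[OF _ that(1)]) (use that in auto)
  have "abelian_group (free_module R B)"
  proof (rule abelian_groupI)
    fix f assume f: "f \<in> carrier (free_module R B)"
    have "(\<lambda>b. \<ominus> f b) \<in> carrier (free_module R B)"
      using f by (auto simp: free_module_simps elim!: rev_finite_subset)
    then show "\<exists>g\<in>carrier (free_module R B). g \<oplus>\<^bsub>free_module R B\<^esub> f = \<zero>\<^bsub>free_module R B\<^esub>"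
      using f by (intro bexI[of _ "\<lambda>b. \<ominus> f b"]) (auto simp: free_module_simps(2-) l_neg)
  next
    fix f g h assume *: "f \<in> carrier (free_module R B)" "g \<in> carrier (free_module R B)" "h \<in> carrier (free_module R B)"
    show "f \<oplus>\<^bsub>free_module R B\<^esub> g \<oplus>\<^bsub>free_module R B\<^esub> h = f \<oplus>\<^bsub>free_module R B\<^esub> (g \<oplus>\<^bsub>free_module R B\<^esub> h)"
      using * by (simp add: free_module_simps(2-) a_assoc)
  next
    fix f g assume *: "f \<in> carrier (free_module R B)" "g \<in> carrier (free_module R B)"
    show "f \<oplus>\<^bsub>free_module R B\<^esub> g \<in> carrier (free_module R B)"
      using * fin[of f g] by (auto simp: free_module_simps)
    show "f \<oplus>\<^bsub>free_module R B\<^esub> g = g \<oplus>\<^bsub>free_module R B\<^esub> f"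
      using * by (simp add: free_module_simps(2-) a_comm)
  next
    fix f assume *: "f \<in> carrier (free_module R B)"
    show "\<zero>\<^bsub>free_module R B\<^esub> \<oplus>\<^bsub>free_module R B\<^esub> f = f"
      using * by (simp add: free_module_simps(2-))
  qed (auto simp: free_module_simps)
  then interpret G: abelian_group "free_module R B" .
  show ?thesis
  proof (unfold_locales)
    fix a f assume "a \<in> carrier R" and f: "f \<in> carrier (free_module R B)"
    then show "a \<odot>\<^bsub>free_module R B\<^esub> f \<in> carrier (free_module R B)"
      by (auto simp: free_module_simps fin2)
  qed (simp_all add: free_module_simps(2-) l_distr r_distr m_assoc)
qed

lemma free_module_uminus:
  assumes "f \<in> carrier (free_module R B)"
  shows "\<ominus>\<^bsub>free_module R B\<^esub> f = (\<lambda>b. \<ominus> f b)"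
proof -
  interpret L: left_module R "free_module R B" by (rule left_module_free_module)
  have "(\<lambda>b. \<ominus> f b) \<in> carrier (free_module R B)"
    using assms by (auto simp: free_module_simps elim!: rev_finite_subset)
  then show ?thesis using assms
    by (intro L.M.minus_equality) (auto simp: free_module_simps(2-) l_neg)
qed

lemma free_module_minus:
  assumes "f \<in> carrier (free_module R B)" "g \<in> carrier (free_module R B)"
  shows "f \<ominus>\<^bsub>free_module R B\<^esub> g = (\<lambda>b. f b \<ominus> g b)"
  using assms by (simp add: a_minus_def free_module_uminus free_module_simps)

definition unit_vec :: "'i \<Rightarrow> 'i \<Rightarrow> 'a" where
  "unit_vec b = (\<lambda>c. if c = b then \<one> else \<zero>)"

lemma unit_vec_closed [simp]: "b \<in> B \<Longrightarrow> unit_vec b \<in> carrier (free_module R B)"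
  by (auto simp: unit_vec_def free_module_simps)

text \<open>Each basis vector is split off once, hence \<open>f b = \<zero>\<close> in the step.
  This makes the coefficient \<open>a\<close> visible in the sum, which \<open>Lm_eta\<close> needs
  to see that \<open>a\<close> and the entries of \<open>f\<close> lie in the subfield.\<close>

lemma free_module_induct [consumes 1, case_names zero add]:
  assumes "f \<in> carrier (free_module R B)" and "Q (\<lambda>b. \<zero>)"
    and step: "\<And>a b f. \<lbrakk>a \<in> carrier R; b \<in> B; f \<in> carrier (free_module R B); f b = \<zero>; Q f\<rbrakk> \<Longrightarrow>
      Q (a \<odot>\<^bsub>free_module R B\<^esub> unit_vec b \<oplus>\<^bsub>free_module R B\<^esub> f)"
  shows "Q f"
proof -
  have "Q f" if "finite S" "f \<in> carrier (free_module R B)" "{b. f b \<noteq> \<zero>} \<subseteq> S" for S f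
    using that
  proof (induction S arbitrary: f rule: finite_induct)
    case empty
    then have "f = (\<lambda>b. \<zero>)" by auto
    then show ?case using assms(2) by simp
  next
    case (insert s S)
    show ?case
    proof (cases "s \<in> B")
      case False
      then have "{b. f b \<noteq> \<zero>} \<subseteq> S" using insert by (auto simp: free_module_simps)
      then show ?thesis using insert by blast
    next
      case True
      define f' where "f' = (\<lambda>b. if b = s then \<zero> else f b)"
      have f': "f' \<in> carrier (free_module R B)" using insert(4)
        by (auto simp: f'_def free_module_simps elim!: rev_finite_subset)
      have "f = f s \<odot>\<^bsub>free_module R B\<^esub> unit_vec s \<oplus>\<^bsub>free_module R B\<^esub> f'"
        using insert(4) by (auto simp: f'_def unit_vec_def free_module_simps(2-) fun_eq_iff)
      moreover have "Q f'" using insert(5) f' by (intro insert(3)) (auto simp: f'_def)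
      then have "Q (f s \<odot>\<^bsub>free_module R B\<^esub> unit_vec s \<oplus>\<^bsub>free_module R B\<^esub> f')"
        using insert(4) True f' by (intro step) (auto simp: f'_def)
      ultimately show ?thesis by simp
    qed
  qed
  from this[OF _ assms(1) order.refl] show ?thesis using assms(1) by (auto simp: free_module_simps)
qed

end

text \<open>The linear map given by the universal property of the free module. The sum runs over the
  support of \<open>f\<close>, so the index set does not have to be passed along; with
  \<open>g\<close> the identity it evaluates formal combinations.\<close>

definition free_ext :: "('a, 'b) ring_scheme \<Rightarrow> ('a, 'm) module \<Rightarrow> ('i \<Rightarrow> 'm) \<Rightarrow> ('i \<Rightarrow> 'a) \<Rightarrow> 'm" where
  "free_ext R M g f = (\<Oplus>\<^bsub>M\<^esub>b\<in>{b. f b \<noteq> \<zero>\<^bsub>R\<^esub>}. f b \<odot>\<^bsub>M\<^esub> g b)"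

context left_module
begin

lemma free_ext_superset:
  assumes "f \<in> carrier (free_module R B)" "g \<in> B \<rightarrow> carrier M"
    and "finite S" "{b. f b \<noteq> \<zero>} \<subseteq> S" "S \<subseteq> B"
  shows "free_ext R M g f = (\<Oplus>\<^bsub>M\<^esub>b\<in>S. f b \<odot>\<^bsub>M\<^esub> g b)"
  unfolding free_ext_def
  using assms
  by (intro M.add.finprod_mono_neutral_cong_left) (auto simp: smult_closed Pi_iff subset_iff)

lemma free_ext_hom:
  assumes g: "g \<in> B \<rightarrow> carrier M"
  shows "free_ext R M g \<in> lmod_hom R (free_module R B) M"
proof -
  let ?F = "free_module R B"
  interpret L: left_module R ?F by (rule left_module_free_module)
  show ?thesis
  proof (rule lmod_homI)
    fix f assume f: "f \<in> carrier ?F"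
    show "free_ext R M g f \<in> carrier M" unfolding free_ext_def
      using f g free_module_supp[OF f] by (intro M.finsum_closed) (auto simp: smult_closed Pi_iff)
  next
    fix f h assume f: "f \<in> carrier ?F" and h: "h \<in> carrier ?F"
    have fh: "f \<oplus>\<^bsub>?F\<^esub> h \<in> carrier ?F" using f h by simp
    define S where "S = {b. f b \<noteq> \<zero>} \<union> {b. h b \<noteq> \<zero>}"
    have S: "finite S" "S \<subseteq> B" using f h by (auto simp: S_def free_module_simps)
    have 1: "{b. f b \<noteq> \<zero>} \<subseteq> S" "{b. h b \<noteq> \<zero>} \<subseteq> S" "{b. (f \<oplus>\<^bsub>?F\<^esub> h) b \<noteq> \<zero>} \<subseteq> S"
      by (auto simp: S_def free_module_simps)
    have gS: "g b \<in> carrier M" if "b \<in> S" for b using that S g by auto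
    have "(\<Oplus>\<^bsub>M\<^esub>b\<in>S. (f \<oplus>\<^bsub>?F\<^esub> h) b \<odot>\<^bsub>M\<^esub> g b)
        = (\<Oplus>\<^bsub>M\<^esub>b\<in>S. f b \<odot>\<^bsub>M\<^esub> g b \<oplus>\<^bsub>M\<^esub> h b \<odot>\<^bsub>M\<^esub> g b)"
      using f h gS by (intro M.finsum_cong') (auto simp: smult_closed smult_l_distr free_module_simps(2-))
    also have "\<dots> = (\<Oplus>\<^bsub>M\<^esub>b\<in>S. f b \<odot>\<^bsub>M\<^esub> g b) \<oplus>\<^bsub>M\<^esub> (\<Oplus>\<^bsub>M\<^esub>b\<in>S. h b \<odot>\<^bsub>M\<^esub> g b)"
      using f h gS by (intro M.finsum_addf) (auto simp: smult_closed)
    finally show "free_ext R M g (f \<oplus>\<^bsub>?F\<^esub> h) = free_ext R M g f \<oplus>\<^bsub>M\<^esub> free_ext R M g h"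
      unfolding free_ext_superset[OF f g S(1) 1(1) S(2)] free_ext_superset[OF h g S(1) 1(2) S(2)]
        free_ext_superset[OF fh g S(1) 1(3) S(2)] .
  next
    fix a f assume a: "a \<in> carrier R" and f: "f \<in> carrier ?F"
    have af: "a \<odot>\<^bsub>?F\<^esub> f \<in> carrier ?F" using f a by (simp add: L.smult_closed)
    define S where "S = {b. f b \<noteq> \<zero>}"
    have S: "finite S" "S \<subseteq> B" using f by (auto simp: S_def free_module_simps)
    have 1: "{b. f b \<noteq> \<zero>} \<subseteq> S" "{b. (a \<odot>\<^bsub>?F\<^esub> f) b \<noteq> \<zero>} \<subseteq> S"
      using a by (auto simp: S_def free_module_simps)
    have gS: "g b \<in> carrier M" if "b \<in> S" for b using that S g by auto
    show "free_ext R M g (a \<odot>\<^bsub>?F\<^esub> f) = a \<odot>\<^bsub>M\<^esub> free_ext R M g f"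
      unfolding free_ext_superset[OF f g S(1) 1(1) S(2)]
        free_ext_superset[OF af g S(1) 1(2) S(2)]
      by (subst finsum_smult)
         (use f a gS in \<open>auto simp: smult_closed smult_assoc free_module_simps(2-) intro!: M.finsum_cong'\<close>)
  qed
qed

lemma free_ext_unit_vec:
  assumes "g \<in> B \<rightarrow> carrier M" "b \<in> B"
  shows "free_ext R M g (unit_vec b) = g b"
proof -
  have "free_ext R M g (unit_vec b) = (\<Oplus>\<^bsub>M\<^esub>c\<in>{b}. unit_vec b c \<odot>\<^bsub>M\<^esub> g c)"
    using assms unit_vec_closed[OF assms(2)] by (intro free_ext_superset[of _ B]) (auto simp: unit_vec_def)
  also have "\<dots> = g b" using assms by (simp add: unit_vec_def smult_one Pi_iff)
  finally show ?thesis .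
qed

text \<open>Identities between operators, such as \<open>Lm_Lm\<close> and \<open>eps_Rm\<close>,
  are later checked on unit vectors through this rule.\<close>

lemma hom_eqI:
  assumes h: "h \<in> lmod_hom R (free_module R B) M" and g: "g \<in> lmod_hom R (free_module R B) M"
    and f: "f \<in> carrier (free_module R B)" and eq: "\<And>b. b \<in> B \<Longrightarrow> h (unit_vec b) = g (unit_vec b)"
  shows "h f = g f"
  using f
proof (induction f rule: free_module_induct)
  interpret L: left_module R "free_module R B" by (rule left_module_free_module)
  case zero
  have "h \<zero>\<^bsub>free_module R B\<^esub> = g \<zero>\<^bsub>free_module R B\<^esub>"
    by (simp only: lmod_hom_zero[OF L.left_module_axioms left_module_axioms h]
        lmod_hom_zero[OF L.left_module_axioms left_module_axioms g])
  then show ?case by (simp add: free_module_simps(2))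
next
  interpret L: left_module R "free_module R B" by (rule left_module_free_module)
  case (add a b f)
  then show ?case
    by (simp add: lmod_hom_add[OF h] lmod_hom_add[OF g] lmod_hom_smult[OF h] lmod_hom_smult[OF g]
        L.smult_closed eq)
qed

end

subsection \<open>Projective modules and comparison of resolutions\<close>

lemma projective_left_module: "projective R P \<Longrightarrow> left_module R P"
  by (simp add: projective_def)

text \<open>\<open>projective\<close> takes its basis from the elements of the module itself, so the
  free module on \<open>S\<close> is re-indexed by its own unit vectors. These are distinct because
  \<open>\<one> \<noteq> \<zero>\<close>.\<close>

lemma (in ring) projective_free_module:
  assumes "\<one> \<noteq> \<zero>"
  shows "projective R (free_module R (S :: 'c set))"
proof -
  have inj: "unit_vec b = unit_vec c \<longleftrightarrow> b = c" for b c :: 'c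
    using assms by (auto simp: unit_vec_def fun_eq_iff)
  define e where "e = (inv_into UNIV unit_vec :: ('c \<Rightarrow> 'a) \<Rightarrow> 'c)"
  have e: "e (unit_vec b) = b" for b using inj unfolding e_def by (intro inv_into_f_f injI) auto
  define B where "B = (unit_vec ` S :: ('c \<Rightarrow> 'a) set)"
  let ?F = "free_module R S" and ?G = "free_module R B"
  define s where "s = (\<lambda>f q. if q \<in> B then f (e q) else \<zero>)"
  define p where "p = (\<lambda>f b. if b \<in> S then f (unit_vec b :: 'c \<Rightarrow> 'a) else \<zero>)"
  have "s \<in> lmod_hom R ?F ?G"
  proof (rule lmod_homI)
    fix f assume f: "f \<in> carrier ?F"
    have "finite (unit_vec ` {b. f b \<noteq> \<zero>} :: ('c \<Rightarrow> 'a) set)" using f by (auto simp: free_module_simps)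
    moreover have "{q. s f q \<noteq> \<zero>} \<subseteq> unit_vec ` {b. f b \<noteq> \<zero>}" by (auto simp: s_def B_def e split: if_splits)
    ultimately have "finite {q. s f q \<noteq> \<zero>}" by (rule rev_finite_subset)
    then show "s f \<in> carrier ?G" using f by (auto simp: free_module_simps(1) s_def B_def e)
  qed (auto simp: s_def free_module_simps(2-))
  moreover have "p \<in> lmod_hom R ?G ?F"
  proof (rule lmod_homI)
    fix f assume f: "f \<in> carrier ?G"
    have "finite (e ` {q. f q \<noteq> \<zero>})" using f by (auto simp: free_module_simps)
    moreover have "{b. p f b \<noteq> \<zero>} \<subseteq> e ` {q. f q \<noteq> \<zero>}"
      using e by (intro subsetI rev_image_eqI[of "unit_vec _"]) (auto simp: p_def split: if_splits)
    ultimately have "finite {b. p f b \<noteq> \<zero>}" by (rule rev_finite_subset)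
    then show "p f \<in> carrier ?F" using f by (auto simp: free_module_simps(1) p_def B_def e)
  qed (auto simp: p_def free_module_simps(2-))
  moreover have "p (s f) = f" if "f \<in> carrier ?F" for f
    using that by (auto simp: p_def s_def B_def e fun_eq_iff free_module_simps)
  ultimately show ?thesis unfolding projective_def
    by (intro conjI left_module_free_module exI[of _ B] bexI[of _ s] bexI[of _ p]) auto
qed

text \<open>Lift the images of the basis vectors of the free module of which \<open>P\<close> is a
  summand, extend linearly and precompose with the section \<open>s\<close>. The image of
  \<open>\<psi>\<close> only has to lie in that of \<open>\<delta>\<close>: in the applications both
  are contained in a kernel.\<close>

lemma projective_lift:
  assumes P: "projective R P" and X: "left_module R X" and Y: "left_module R Y"
    and \<psi>: "\<psi> \<in> lmod_hom R P Y" and \<delta>: "\<delta> \<in> lmod_hom R X Y"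
    and sub: "\<psi> ` carrier P \<subseteq> \<delta> ` carrier X"
  shows "\<exists>\<theta>\<in>lmod_hom R P X. \<forall>x\<in>carrier P. \<delta> (\<theta> x) = \<psi> x"
proof -
  interpret P: left_module R P using P by (rule projective_left_module)
  interpret X: left_module R X by fact
  interpret Y: left_module R Y by fact
  obtain B :: "'c set" and s p where s: "s \<in> lmod_hom R P (free_module R B)"
    and p: "p \<in> lmod_hom R (free_module R B) P" and ps: "\<And>x. x \<in> carrier P \<Longrightarrow> p (s x) = x"
    using P unfolding projective_def by blast
  have "\<exists>y\<in>carrier X. \<delta> y = \<psi> (p (P.unit_vec b))" if "b \<in> B" for b
  proof -
    have "p (P.unit_vec b) \<in> carrier P" using that by (auto intro!: lmod_hom_closed[OF p])
    then show ?thesis using sub by (metis (no_types, lifting) image_iff subset_iff)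
  qed
  then obtain y where y: "\<And>b. b \<in> B \<Longrightarrow> y b \<in> carrier X" "\<And>b. b \<in> B \<Longrightarrow> \<delta> (y b) = \<psi> (p (P.unit_vec b))"
    by metis
  have yX: "y \<in> B \<rightarrow> carrier X" using y by auto
  note ext = X.free_ext_hom[OF yX]
  show ?thesis
  proof (intro bexI[of _ "\<lambda>x. free_ext R X y (s x)"] ballI)
    show "(\<lambda>x. free_ext R X y (s x)) \<in> lmod_hom R P X" by (rule lmod_hom_comp[OF s ext])
    fix x assume x: "x \<in> carrier P"
    have "\<delta> (free_ext R X y (s x)) = \<psi> (p (s x))"
      by (rule Y.hom_eqI[OF lmod_hom_comp[OF ext \<delta>] lmod_hom_comp[OF p \<psi>] lmod_hom_closed[OF s x]])
         (simp add: X.free_ext_unit_vec[OF yX] y)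
    then show "\<delta> (free_ext R X y (s x)) = \<psi> x" using ps x by simp
  qed
qed

text \<open>The length is kept apart from exactness: a bound on it is the vanishing of the modules
  from some index on. The carrier type \<open>'p\<close> is arbitrary, so resolutions on different
  types can be compared.\<close>

definition projective_resolution ::
    "('a, 'b) ring_scheme \<Rightarrow> ('a, 'm) module \<Rightarrow> (nat \<Rightarrow> ('a, 'p) module) \<Rightarrow> ('p \<Rightarrow> 'm) \<Rightarrow> (nat \<Rightarrow> 'p \<Rightarrow> 'p) \<Rightarrow> bool"
  where "projective_resolution R M P \<epsilon> d \<longleftrightarrow>
     (\<forall>i. projective R (P i)) \<and>
     \<epsilon> \<in> lmod_hom R (P 0) M \<and>
     (\<forall>i. d i \<in> lmod_hom R (P (Suc i)) (P i)) \<and>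
     \<epsilon> ` carrier (P 0) = carrier M \<and>
     d 0 ` carrier (P (Suc 0)) = a_kernel (P 0) M \<epsilon> \<and>
     (\<forall>i. d (Suc i) ` carrier (P (Suc (Suc i))) = a_kernel (P (Suc i)) (P i) (d i))"

lemma has_projective_resolution_iff:
  "has_projective_resolution R (M :: ('a, 'm) module) n \<longleftrightarrow>
     (\<exists>(P :: nat \<Rightarrow> ('a, ('m \<times> 'a) list \<Rightarrow> 'a) module) \<epsilon> d.
        projective_resolution R M P \<epsilon> d \<and> (\<forall>i>n. carrier (P i) = {\<zero>\<^bsub>P i\<^esub>}))"
  unfolding has_projective_resolution_def projective_resolution_def
  by (intro ex_cong1) (simp only: conj_ac)

text \<open>The comparison theorem for the identity of \<open>M\<close>. Each component is a lift
  through \<open>projective_lift\<close>: what has been built so far sends the boundaries of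
  \<open>P\<close> to cycles of \<open>Q\<close>, and these are boundaries by exactness.\<close>

lemma projective_resolution_chain_map:
  assumes M: "left_module R M"
    and P: "projective_resolution R M P \<epsilon> d" and Q: "projective_resolution R M Q \<epsilon>' d'"
  shows "\<exists>f. (\<forall>i. f i \<in> lmod_hom R (P i) (Q i)) \<and> (\<forall>x\<in>carrier (P 0). \<epsilon>' (f 0 x) = \<epsilon> x) \<and>
    (\<forall>i. \<forall>x\<in>carrier (P (Suc i)). d' i (f (Suc i) x) = f i (d i x))"
proof -
  have proj: "\<And>i. projective R (P i)" "\<And>i. projective R (Q i)"
    and hom: "\<epsilon> \<in> lmod_hom R (P 0) M" "\<And>i. d i \<in> lmod_hom R (P (Suc i)) (P i)"
      "\<epsilon>' \<in> lmod_hom R (Q 0) M" "\<And>i. d' i \<in> lmod_hom R (Q (Suc i)) (Q i)"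
    and img: "\<epsilon>' ` carrier (Q 0) = carrier M"
    and ex: "d 0 ` carrier (P (Suc 0)) = a_kernel (P 0) M \<epsilon>"
      "\<And>i. d (Suc i) ` carrier (P (Suc (Suc i))) = a_kernel (P (Suc i)) (P i) (d i)"
      "d' 0 ` carrier (Q (Suc 0)) = a_kernel (Q 0) M \<epsilon>'"
      "\<And>i. d' (Suc i) ` carrier (Q (Suc (Suc i))) = a_kernel (Q (Suc i)) (Q i) (d' i)"
    using P Q unfolding projective_resolution_def by auto
  have lm: "\<And>i. left_module R (P i)" "\<And>i. left_module R (Q i)"
    using proj by (auto intro: projective_left_module)
  \<comment> \<open>\<open>good\<close> links two consecutive components. The successor depends on
    the later one, so the sequence is obtained by dependent choice on such pairs.\<close>
  define good where "good i f g \<longleftrightarrow> g \<in> lmod_hom R (P (Suc i)) (Q (Suc i)) \<and>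
    (\<forall>x\<in>carrier (P (Suc i)). d' i (g x) = f (d i x))" for i f g
  have img0: "\<epsilon> ` carrier (P 0) \<subseteq> \<epsilon>' ` carrier (Q 0)"
    using img lmod_hom_closed[OF hom(1)] by auto
  obtain f0 where f0: "f0 \<in> lmod_hom R (P 0) (Q 0)" "\<And>x. x \<in> carrier (P 0) \<Longrightarrow> \<epsilon>' (f0 x) = \<epsilon> x"
    using projective_lift[OF proj(1) lm(2) M hom(1,3) img0] by blast
  have sub0: "(\<lambda>x. f0 (d 0 x)) ` carrier (P (Suc 0)) \<subseteq> d' 0 ` carrier (Q (Suc 0))"
  proof -
    have "\<epsilon> (d 0 x) = \<zero>\<^bsub>M\<^esub>" if "x \<in> carrier (P (Suc 0))" for x
      using ex(1) that by (auto simp: a_kernel_def')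
    then show ?thesis unfolding ex(3)
      by (auto simp: a_kernel_def' lmod_homD[OF hom(2)] lmod_homD[OF f0(1)] f0(2))
  qed
  obtain f1 where "f1 \<in> lmod_hom R (P (Suc 0)) (Q (Suc 0))"
      "\<And>x. x \<in> carrier (P (Suc 0)) \<Longrightarrow> d' 0 (f1 x) = f0 (d 0 x)"
    using projective_lift[OF proj(1) lm(2) lm(2) lmod_hom_comp[OF hom(2) f0(1)] hom(4) sub0] by blast
  then have f1: "good 0 f0 f1" by (simp add: good_def)
  have step: "\<exists>g'. good (Suc i) g g'" if "good i f g" for i f g
  proof -
    from that have g: "g \<in> lmod_hom R (P (Suc i)) (Q (Suc i))"
      and gd: "\<And>x. x \<in> carrier (P (Suc i)) \<Longrightarrow> d' i (g x) = f (d i x)" by (auto simp: good_def)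
    have dd: "d i (d (Suc i) x) = \<zero>\<^bsub>P i\<^esub>" if "x \<in> carrier (P (Suc (Suc i)))" for x
      using ex(2)[of i] that by (auto simp: a_kernel_def')
    interpret Pi: left_module R "P (Suc i)" by (rule lm)
    interpret Pi': left_module R "P i" by (rule lm)
    interpret Qi: left_module R "Q i" by (rule lm)
    \<comment> \<open>\<open>good\<close> records linearity for \<open>g\<close> only; that
      \<open>f\<close> preserves zero is read off from the commuting square at zero.\<close>
    have "f \<zero>\<^bsub>P i\<^esub> = \<zero>\<^bsub>Q i\<^esub>"
      using gd[of "\<zero>\<^bsub>P (Suc i)\<^esub>"]
      by (simp add: lmod_hom_zero[OF lm(1,1) hom(2)] lmod_hom_zero[OF lm(1,2) g] lmod_hom_zero[OF lm(2,2) hom(4)])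
    then have sub: "(\<lambda>x. g (d (Suc i) x)) ` carrier (P (Suc (Suc i))) \<subseteq> d' (Suc i) ` carrier (Q (Suc (Suc i)))"
      unfolding ex(4) by (auto simp: a_kernel_def' lmod_homD[OF hom(2)] lmod_homD[OF g] gd dd)
    obtain g' where "g' \<in> lmod_hom R (P (Suc (Suc i))) (Q (Suc (Suc i)))"
        "\<And>x. x \<in> carrier (P (Suc (Suc i))) \<Longrightarrow> d' (Suc i) (g' x) = g (d (Suc i) x)"
      using projective_lift[OF proj(1) lm(2) lm(2) lmod_hom_comp[OF hom(2) g] hom(4) sub] by blast
    then show ?thesis by (auto simp: good_def)
  qed
  \<comment> \<open>The first pair is pinned to start with \<open>f0\<close>, the component
    compatible with the augmentations.\<close>
  define Pr where "Pr i fg \<longleftrightarrow> good i (fst fg) (snd fg) \<and> (i = 0 \<longrightarrow> fst fg = f0)" for i fg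
  have "\<exists>F. \<forall>i. Pr i (F i) \<and> fst (F (Suc i)) = snd (F i)"
  proof (rule dependent_nat_choice)
    show "\<exists>fg. Pr 0 fg" using f1 by (auto simp: Pr_def)
    fix fg i assume "Pr i fg"
    then have "good i (fst fg) (snd fg)" by (simp add: Pr_def)
    from step[OF this] obtain g' where "good (Suc i) (snd fg) g'" by blast
    then show "\<exists>y. Pr (Suc i) y \<and> fst y = snd fg"
      by (intro exI[of _ "(snd fg, g')"]) (auto simp: Pr_def)
  qed
  then obtain F where F: "\<And>i. Pr i (F i)" "\<And>i. fst (F (Suc i)) = snd (F i)" by blast
  show ?thesis
  proof (intro exI[of _ "\<lambda>i. fst (F i)"] conjI allI ballI)
    show "fst (F i) \<in> lmod_hom R (P i) (Q i)" for i
      using F(1)[of "i - 1"] F(1)[of i] F(2)[of "i - 1"] f0(1) by (cases i) (auto simp: Pr_def good_def)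
    show "\<epsilon>' (fst (F 0) x) = \<epsilon> x" if "x \<in> carrier (P 0)" for x
      using F(1)[of 0] f0(2) that by (auto simp: Pr_def)
    show "d' i (fst (F (Suc i)) x) = fst (F i) (d i x)" if "x \<in> carrier (P (Suc i))" for i x
      using F(1)[of i] F(2)[of i] that by (auto simp: Pr_def good_def)
  qed
qed

text \<open>The map \<open>k (Suc i) - h i \<circ> d i\<close> takes values in the kernel of
  \<open>d i\<close>, which \<open>d (Suc i)\<close> covers by exactness; a lift of it is
  \<open>h (Suc i)\<close>.\<close>

lemma projective_resolution_null_homotopy:
  assumes M: "left_module R M" and P: "projective_resolution R M P \<epsilon> d"
    and k: "\<And>i. k i \<in> lmod_hom R (P i) (P i)"
    and k0: "\<And>x. x \<in> carrier (P 0) \<Longrightarrow> \<epsilon> (k 0 x) = \<zero>\<^bsub>M\<^esub>"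
    and kd: "\<And>i x. x \<in> carrier (P (Suc i)) \<Longrightarrow> d i (k (Suc i) x) = k i (d i x)"
  shows "\<exists>h. (\<forall>i. h i \<in> lmod_hom R (P i) (P (Suc i))) \<and>
    (\<forall>i. \<forall>x\<in>carrier (P (Suc i)).
       k (Suc i) x = d (Suc i) (h (Suc i) x) \<oplus>\<^bsub>P (Suc i)\<^esub> h i (d i x))"
proof -
  have proj: "\<And>i. projective R (P i)"
    and hom: "\<epsilon> \<in> lmod_hom R (P 0) M" "\<And>i. d i \<in> lmod_hom R (P (Suc i)) (P i)"
    and ex: "d 0 ` carrier (P (Suc 0)) = a_kernel (P 0) M \<epsilon>"
      "\<And>i. d (Suc i) ` carrier (P (Suc (Suc i))) = a_kernel (P (Suc i)) (P i) (d i)"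
    using P unfolding projective_resolution_def by auto
  have lm: "\<And>i. left_module R (P i)"
    using proj by (auto intro: projective_left_module)
  have dd: "d i (d (Suc i) x) = \<zero>\<^bsub>P i\<^esub>" if "x \<in> carrier (P (Suc (Suc i)))" for x i
    using ex(2)[of i] that by (auto simp: a_kernel_def')
  define good where "good i g h \<longleftrightarrow>
      g \<in> lmod_hom R (P i) (P (Suc i)) \<and> h \<in> lmod_hom R (P (Suc i)) (P (Suc (Suc i))) \<and>
      (\<forall>x\<in>carrier (P (Suc i)). k (Suc i) x = d (Suc i) (h x) \<oplus>\<^bsub>P (Suc i)\<^esub> g (d i x))" for i g h
  \<comment> \<open>The condition on \<open>g\<close> is the one that turns
    \<open>k (Suc i) - g \<circ> d i\<close> into a map to the cycles. For the next index it follows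
    from the equation in \<open>good\<close>, because \<open>d i \<circ> d (Suc i)\<close>
    vanishes.\<close>
  have step: "\<exists>h'. good i g h'"
    if g: "g \<in> lmod_hom R (P i) (P (Suc i))"
      and kg: "\<And>x. x \<in> carrier (P (Suc i)) \<Longrightarrow> d i (g (d i x)) = k i (d i x)" for i g
  proof -
    interpret A: left_module R "P (Suc i)" by (rule lm)
    interpret B: left_module R "P i" by (rule lm)
    let ?\<psi> = "\<lambda>x. k (Suc i) x \<ominus>\<^bsub>P (Suc i)\<^esub> g (d i x)"
    have \<psi>: "?\<psi> \<in> lmod_hom R (P (Suc i)) (P (Suc i))"
      by (intro A.lmod_hom_minus_map k lmod_hom_comp[OF hom(2) g])
    have cl: "k (Suc i) x \<in> carrier (P (Suc i))" "g (d i x) \<in> carrier (P (Suc i))" "k i (d i x) \<in> carrier (P i)"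
      if "x \<in> carrier (P (Suc i))" for x
      using that by (auto intro!: lmod_hom_closed[OF k] lmod_hom_closed[OF g] lmod_hom_closed[OF hom(2)])
    have "d i (?\<psi> x) = \<zero>\<^bsub>P i\<^esub>" if "x \<in> carrier (P (Suc i))" for x
      using that cl by (simp add: lmod_hom_minus[OF lm lm hom(2)] kd kg)
        (simp add: B.M.minus_eq B.M.r_neg)
    then have sub: "?\<psi> ` carrier (P (Suc i)) \<subseteq> d (Suc i) ` carrier (P (Suc (Suc i)))"
      unfolding ex(2) using lmod_hom_closed[OF \<psi>] by (auto simp: a_kernel_def')
    obtain h' where h': "h' \<in> lmod_hom R (P (Suc i)) (P (Suc (Suc i)))"
      "\<And>x. x \<in> carrier (P (Suc i)) \<Longrightarrow> d (Suc i) (h' x) = ?\<psi> x"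
      using projective_lift[OF proj lm lm \<psi> hom(2) sub] by blast
    have "k (Suc i) x = d (Suc i) (h' x) \<oplus>\<^bsub>P (Suc i)\<^esub> g (d i x)" if "x \<in> carrier (P (Suc i))" for x
      using that cl by (simp add: h'(2) A.M.minus_eq A.M.a_assoc A.M.l_neg)
    with h'(1) g show ?thesis unfolding good_def by blast
  qed
  have sub: "k 0 ` carrier (P 0) \<subseteq> d 0 ` carrier (P (Suc 0))"
    unfolding ex(1) using k0 lmod_hom_closed[OF k] by (auto simp: a_kernel_def')
  obtain h0 where h0: "h0 \<in> lmod_hom R (P 0) (P (Suc 0))"
    "\<And>x. x \<in> carrier (P 0) \<Longrightarrow> d 0 (h0 x) = k 0 x"
    using projective_lift[OF proj lm lm k hom(2) sub] by blast
  have "d 0 (h0 (d 0 x)) = k 0 (d 0 x)" if "x \<in> carrier (P (Suc 0))" for x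
    using h0(2)[OF lmod_hom_closed[OF hom(2) that]] .
  from step[OF h0(1) this] obtain h1 where h1: "good 0 h0 h1" by blast
  have step': "\<exists>h'. good (Suc i) h h'" if gh: "good i g h" for i g h
  proof (rule step)
    interpret A: left_module R "P (Suc i)" by (rule lm)
    interpret B: left_module R "P i" by (rule lm)
    from gh show h: "h \<in> lmod_hom R (P (Suc i)) (P (Suc (Suc i)))" by (auto simp: good_def)
    from gh have g: "g \<in> lmod_hom R (P i) (P (Suc i))" by (auto simp: good_def)
    fix x assume x: "x \<in> carrier (P (Suc (Suc i)))"
    then have dx: "d (Suc i) x \<in> carrier (P (Suc i))" by (auto intro!: lmod_hom_closed[OF hom(2)])
    have "k (Suc i) (d (Suc i) x) = d (Suc i) (h (d (Suc i) x)) \<oplus>\<^bsub>P (Suc i)\<^esub> g (d i (d (Suc i) x))"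
      using gh dx by (auto simp: good_def)
    then show "d (Suc i) (h (d (Suc i) x)) = k (Suc i) (d (Suc i) x)"
      using dx x lmod_hom_closed[OF hom(2) lmod_hom_closed[OF h dx]]
      by (simp add: dd lmod_hom_zero[OF lm lm g])
  qed
  define Pr where "Pr i fg \<longleftrightarrow> good i (fst fg) (snd fg)" for i fg
  have "\<exists>F. \<forall>i. Pr i (F i) \<and> fst (F (Suc i)) = snd (F i)"
  proof (rule dependent_nat_choice)
    show "\<exists>fg. Pr 0 fg" using h1 by (auto simp: Pr_def)
    fix fg i assume "Pr i fg"
    then have "good i (fst fg) (snd fg)" by (simp add: Pr_def)
    from step'[OF this] obtain g' where "good (Suc i) (snd fg) g'" by blast
    then show "\<exists>y. Pr (Suc i) y \<and> fst y = snd fg"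
      by (intro exI[of _ "(snd fg, g')"]) (auto simp: Pr_def)
  qed
  then obtain F where F: "\<And>i. Pr i (F i)" "\<And>i. fst (F (Suc i)) = snd (F i)" by blast
  show ?thesis
  proof (intro exI[of _ "\<lambda>i. fst (F i)"] conjI allI ballI)
    show "fst (F i) \<in> lmod_hom R (P i) (P (Suc i))" for i
      using F(1)[of i] by (auto simp: Pr_def good_def)
    show "k (Suc i) x = d (Suc i) (fst (F (Suc i)) x) \<oplus>\<^bsub>P (Suc i)\<^esub> fst (F i) (d i x)"
      if "x \<in> carrier (P (Suc i))" for i x
      using F(1)[of i] F(2)[of i] that by (auto simp: Pr_def good_def)
  qed
qed

text \<open>Comparison in both directions gives an endomorphism \<open>g \<circ> f\<close> of
  \<open>P\<close> homotopic to the identity. In degree \<open>n + 1\<close> it factors through the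
  zero module of \<open>Q\<close>, so \<open>- id = d h + h d\<close> there, and the term
  \<open>d h\<close> vanishes because \<open>P\<close> is zero one degree further. The sign in the
  conclusion is that of \<open>- id\<close>.\<close>

lemma shorter_resolution_splits:
  assumes M: "left_module R M"
    and P: "projective_resolution R M P \<epsilon> d" and Q: "projective_resolution R M Q \<epsilon>' d'"
    and P0: "carrier (P (Suc (Suc n))) = {\<zero>\<^bsub>P (Suc (Suc n))\<^esub>}"
    and Q0: "carrier (Q (Suc n)) = {\<zero>\<^bsub>Q (Suc n)\<^esub>}"
  shows "\<exists>h\<in>lmod_hom R (P n) (P (Suc n)). \<forall>x\<in>carrier (P (Suc n)). h (d n x) = \<ominus>\<^bsub>P (Suc n)\<^esub> x"
proof -
  interpret M: left_module R M by (rule M)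
  have lm: "\<And>i. left_module R (P i)" "\<And>i. left_module R (Q i)"
    and hom: "\<epsilon> \<in> lmod_hom R (P 0) M" "\<And>i. d i \<in> lmod_hom R (P (Suc i)) (P i)"
    using P Q by (auto simp: projective_resolution_def intro: projective_left_module)
  obtain f where f: "\<And>i. f i \<in> lmod_hom R (P i) (Q i)"
    "\<And>x. x \<in> carrier (P 0) \<Longrightarrow> \<epsilon>' (f 0 x) = \<epsilon> x"
    "\<And>i x. x \<in> carrier (P (Suc i)) \<Longrightarrow> d' i (f (Suc i) x) = f i (d i x)"
    using projective_resolution_chain_map[OF M P Q] by blast
  obtain g where g: "\<And>i. g i \<in> lmod_hom R (Q i) (P i)"
    "\<And>x. x \<in> carrier (Q 0) \<Longrightarrow> \<epsilon> (g 0 x) = \<epsilon>' x"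
    "\<And>i x. x \<in> carrier (Q (Suc i)) \<Longrightarrow> d i (g (Suc i) x) = g i (d' i x)"
    using projective_resolution_chain_map[OF M Q P] by blast
  define k where "k i x = g i (f i x) \<ominus>\<^bsub>P i\<^esub> x" for i x
  have fc: "f i x \<in> carrier (Q i)" if "x \<in> carrier (P i)" for i x using that by (rule lmod_hom_closed[OF f(1)])
  have gc: "g i x \<in> carrier (P i)" if "x \<in> carrier (Q i)" for i x using that by (rule lmod_hom_closed[OF g(1)])
  have dc: "d i x \<in> carrier (P i)" if "x \<in> carrier (P (Suc i))" for i x using that by (rule lmod_hom_closed[OF hom(2)])
  have khom: "k i \<in> lmod_hom R (P i) (P i)" for i
  proof -
    interpret A: left_module R "P i" by (rule lm)
    show ?thesis unfolding k_def by (intro A.lmod_hom_minus_map lmod_hom_comp[OF f(1) g(1)] lmod_hom_id)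
  qed
  have k0: "\<epsilon> (k 0 x) = \<zero>\<^bsub>M\<^esub>" if "x \<in> carrier (P 0)" for x
    using that lmod_hom_closed[OF hom(1) that]
    by (simp add: k_def lmod_hom_minus[OF lm(1) M hom(1)] fc gc f(2) g(2) M.M.minus_eq M.M.r_neg)
  have kd: "d i (k (Suc i) x) = k i (d i x)" if "x \<in> carrier (P (Suc i))" for i x
    using that by (simp add: k_def lmod_hom_minus[OF lm(1,1) hom(2)] fc gc f(3) g(3))
  obtain h where h: "\<And>i. h i \<in> lmod_hom R (P i) (P (Suc i))"
    "\<And>i x. x \<in> carrier (P (Suc i)) \<Longrightarrow>
           k (Suc i) x = d (Suc i) (h (Suc i) x) \<oplus>\<^bsub>P (Suc i)\<^esub> h i (d i x)"
    using projective_resolution_null_homotopy[OF M P khom k0 kd] by blast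
  interpret A: left_module R "P (Suc n)" by (rule lm)
  show ?thesis
  proof (intro bexI[of _ "h n"] ballI)
    show "h n \<in> lmod_hom R (P n) (P (Suc n))" by (rule h)
    fix x assume x: "x \<in> carrier (P (Suc n))"
    have "f (Suc n) x = \<zero>\<^bsub>Q (Suc n)\<^esub>" using fc[OF x] Q0 by simp
    then have "k (Suc n) x = \<ominus>\<^bsub>P (Suc n)\<^esub> x"
      using x by (simp add: k_def lmod_hom_zero[OF lm(2,1) g(1)] A.M.minus_eq)
    moreover have "h (Suc n) x = \<zero>\<^bsub>P (Suc (Suc n))\<^esub>" using lmod_hom_closed[OF h(1) x] P0 by simp
    ultimately show "h n (d n x) = \<ominus>\<^bsub>P (Suc n)\<^esub> x"
      using h(2)[OF x] lmod_hom_closed[OF h(1) dc[OF x]] by (simp add: lmod_hom_zero[OF lm(1,1) hom(2)])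
  qed
qed

subsection \<open>Bases over a subfield\<close>

context left_module
begin

text \<open>Formal combinations with coefficients in \<open>K\<close> are vectors of the free module
  over the whole ring. Thus \<open>combination\<close> evaluates them and is at the same time the
  ring-linear map from the free module on a basis to \<open>M\<close>.\<close>

definition field_vec :: "'a set \<Rightarrow> 'i set \<Rightarrow> ('i \<Rightarrow> 'a) set" where
  "field_vec K B = {f \<in> carrier (free_module R B). \<forall>b. f b \<in> K}"

abbreviation combination :: "('m \<Rightarrow> 'a) \<Rightarrow> 'm" where
  "combination \<equiv> free_ext R M (\<lambda>b. b)"

definition lin_indep :: "'a set \<Rightarrow> 'm set \<Rightarrow> bool" where
  "lin_indep K B \<longleftrightarrow> B \<subseteq> carrier M \<and>
     (\<forall>f\<in>field_vec K B. combination f = \<zero>\<^bsub>M\<^esub> \<longrightarrow> f = (\<lambda>b. \<zero>))"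

definition basis_over :: "'a set \<Rightarrow> 'm set \<Rightarrow> bool" where
  "basis_over K B \<longleftrightarrow> lin_indep K B \<and>
     (\<forall>m\<in>carrier M. \<exists>f\<in>field_vec K B. combination f = m)"

lemma field_vec_supp:
  assumes "f \<in> field_vec K B" "{b. f b \<noteq> \<zero>} \<subseteq> C"
  shows "f \<in> field_vec K C"
  using assms by (auto simp: field_vec_def free_module_simps)

lemma field_vec_add:
  assumes "subfield K R" "f \<in> field_vec K B" "g \<in> field_vec K B"
  shows "f \<oplus>\<^bsub>free_module R B\<^esub> g \<in> field_vec K B"
proof -
  interpret L: left_module R "free_module R B" by (rule left_module_free_module)
  have "f \<oplus>\<^bsub>free_module R B\<^esub> g \<in> carrier (free_module R B)"
    using assms by (auto simp: field_vec_def)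
  then show ?thesis using assms(2,3) subringE(7)[OF subfieldE(1)[OF assms(1)]]
    by (auto simp: field_vec_def free_module_simps(3))
qed

lemma field_vec_smult:
  assumes "subfield K R" "k \<in> K" "f \<in> field_vec K B"
  shows "k \<odot>\<^bsub>free_module R B\<^esub> f \<in> field_vec K B"
proof -
  interpret L: left_module R "free_module R B" by (rule left_module_free_module)
  have "k \<odot>\<^bsub>free_module R B\<^esub> f \<in> carrier (free_module R B)"
    using assms subsetD[OF subfieldE(3)[OF assms(1)]] by (auto simp: field_vec_def intro!: L.smult_closed)
  then show ?thesis using assms(2,3) subringE(6)[OF subfieldE(1)[OF assms(1)]]
    by (auto simp: field_vec_def free_module_simps(4))
qed

lemma field_vec_unit_vec:
  assumes "subfield K R" "b \<in> B"
  shows "unit_vec b \<in> field_vec K B"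
  using assms(2) subringE(2,3)[OF subfieldE(1)[OF assms(1)]] unit_vec_closed[of b B]
  by (auto simp: field_vec_def unit_vec_def)

text \<open>Zorn's lemma; a maximal independent set spans because a dependence that involves a new
  vector can be solved for it.\<close>

lemma basis_over_exists:
  assumes K: "subfield K R"
  shows "\<exists>B. basis_over K B"
proof -
  note sr = subringE[OF subfieldE(1)[OF K]]
  have "\<exists>B\<in>Collect (lin_indep K). \<forall>X\<in>Collect (lin_indep K). B \<subseteq> X \<longrightarrow> X = B"
  proof (rule subset_Zorn')
    fix C assume C: "subset.chain (Collect (lin_indep K)) C"
    then have sub: "\<And>X. X \<in> C \<Longrightarrow> lin_indep K X" by (auto simp: subset.chain_def)
    have "f = (\<lambda>b. \<zero>)" if f: "f \<in> field_vec K (\<Union>C)" "combination f = \<zero>\<^bsub>M\<^esub>" for f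
    proof (cases "C = {}")
      case True
      then show ?thesis using f by (auto simp: field_vec_def free_module_simps)
    next
      case False
      have "finite {b. f b \<noteq> \<zero>}" "{b. f b \<noteq> \<zero>} \<subseteq> \<Union>C"
        using f by (auto simp: field_vec_def free_module_simps)
      then obtain X where X: "X \<in> C" "{b. f b \<noteq> \<zero>} \<subseteq> X"
        using finite_subset_Union_chain[OF _ _ False C] by metis
      then show ?thesis using field_vec_supp[OF f(1) X(2)] f(2) sub[OF X(1)]
        by (auto simp: lin_indep_def)
    qed
    then show "\<Union>C \<in> Collect (lin_indep K)" using sub by (auto simp: lin_indep_def)
  qed
  then obtain B where B: "lin_indep K B" and max: "\<And>X. lin_indep K X \<Longrightarrow> B \<subseteq> X \<Longrightarrow> X = B" by auto
  have Bc: "B \<subseteq> carrier M" using B by (auto simp: lin_indep_def)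
  have "\<exists>f\<in>field_vec K B. combination f = m" if m: "m \<in> carrier M" for m
  proof (cases "m \<in> B")
    case True
    have "combination (unit_vec m) = m"
      by (rule free_ext_unit_vec[of _ B]) (use True Bc in auto)
    then show ?thesis using field_vec_unit_vec[OF K True] by blast
  next
    case False
    let ?B = "insert m B"
    interpret L: left_module R "free_module R ?B" by (rule left_module_free_module)
    have hom: "combination \<in> lmod_hom R (free_module R ?B) M"
      using m Bc by (intro free_ext_hom) auto
    have "\<not> lin_indep K ?B" using max[of ?B] False by auto
    then obtain f where f: "f \<in> field_vec K ?B" "combination f = \<zero>\<^bsub>M\<^esub>" "f \<noteq> (\<lambda>b. \<zero>)"
      using m Bc unfolding lin_indep_def by blast
    have fc: "f \<in> carrier (free_module R ?B)" using f by (auto simp: field_vec_def)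
    have fm: "f m \<noteq> \<zero>"
    proof
      assume "f m = \<zero>"
      then have "{b. f b \<noteq> \<zero>} \<subseteq> B" using fc by (auto simp: free_module_simps)
      then show False using field_vec_supp[OF f(1), of B] f(2,3) B by (auto simp: lin_indep_def)
    qed
    \<comment> \<open>Scaled by this factor the dependence has coefficient \<open>-1\<close> at
      \<open>m\<close>. Adding the unit vector removes \<open>m\<close> and leaves a combination of
      \<open>B\<close> with value \<open>m\<close>.\<close>
    define k where "k = \<ominus> (inv (f m))"
    have fmK: "f m \<in> K - {\<zero>}" using f(1) fm by (auto simp: field_vec_def)
    then have inv: "inv (f m) \<in> K" "inv (f m) \<in> carrier R" "f m \<in> carrier R" "inv (f m) \<otimes> f m = \<one>"
      using subfield_m_inv[OF K fmK] subsetD[OF subfieldE(3)[OF K]] by auto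
    then have k: "k \<in> K" "k \<in> carrier R" "k \<otimes> f m = \<ominus> \<one>"
      using sr(5) by (auto simp: k_def R.l_minus)
    define g where "g = k \<odot>\<^bsub>free_module R ?B\<^esub> f \<oplus>\<^bsub>free_module R ?B\<^esub> unit_vec m"
    have g: "g \<in> field_vec K ?B" unfolding g_def
      by (intro field_vec_add[OF K] field_vec_smult[OF K] k f field_vec_unit_vec[OF K]) auto
    have "g m = \<zero>" using k by (simp add: g_def free_module_simps unit_vec_def R.l_neg)
    then have "{b. g b \<noteq> \<zero>} \<subseteq> B" using g by (auto simp: field_vec_def free_module_simps)
    then have "g \<in> field_vec K B" using field_vec_supp[OF g] by blast
    moreover have "combination (unit_vec m) = m"
      by (rule free_ext_unit_vec[of _ ?B]) (use m Bc in auto)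
    then have "combination g = m"
      using k m fc f(2) by (simp add: g_def lmod_hom_add[OF hom] lmod_hom_smult[OF hom] L.smult_closed)
    ultimately show ?thesis by blast
  qed
  then show ?thesis using B by (auto simp: basis_over_def)
qed

end

section \<open>A length four resolution\<close>

context abelian_group
begin

lemma eq_of_minus_zero:
  "\<lbrakk>a \<in> carrier G; b \<in> carrier G; a \<ominus> b = \<zero>\<rbrakk> \<Longrightarrow> a = b"
  using minus_equality[of a "\<ominus> b"] by (simp add: minus_eq)

lemma diff_eq_eq:
  "\<lbrakk>a \<in> carrier G; b \<in> carrier G; c \<in> carrier G\<rbrakk> \<Longrightarrow> a \<ominus> b = c \<longleftrightarrow> a = c \<oplus> b"
  by (auto simp: minus_eq a_assoc l_neg r_neg)

lemma eq_diff_eq: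
  "\<lbrakk>a \<in> carrier G; b \<in> carrier G; c \<in> carrier G\<rbrakk> \<Longrightarrow> a = c \<ominus> b \<longleftrightarrow> a \<oplus> b = c"
  by (auto simp: minus_eq a_assoc l_neg r_neg)

lemma diff_add_eq_diff:
  assumes "a \<in> carrier G" "b \<in> carrier G" "c \<in> carrier G"
  shows "(a \<ominus> b) \<oplus> c = (a \<oplus> c) \<ominus> b" "a \<oplus> (b \<ominus> c) = (a \<oplus> b) \<ominus> c"
    "(a \<ominus> b) \<ominus> c = a \<ominus> (b \<oplus> c)" "a \<ominus> (b \<ominus> c) = (a \<oplus> c) \<ominus> b"
    "\<ominus> a \<oplus> b = b \<ominus> a" "a \<oplus> \<ominus> b = a \<ominus> b" "\<ominus> (a \<ominus> b) = b \<ominus> a" "a \<ominus> (\<ominus> b) = a \<oplus> b"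
    "\<ominus> a \<ominus> b = \<ominus> (a \<oplus> b)"
  using assms by (simp_all add: minus_eq minus_add a_ac)

lemma uminus_eq_iff:
  "\<lbrakk>a \<in> carrier G; b \<in> carrier G\<rbrakk> \<Longrightarrow> \<ominus> a = b \<longleftrightarrow> \<zero> = a \<oplus> b"
  "\<lbrakk>a \<in> carrier G; b \<in> carrier G\<rbrakk> \<Longrightarrow> a = \<ominus> b \<longleftrightarrow> a \<oplus> b = \<zero>"
  by (metis minus_equality r_neg a_comm minus_minus)+

text \<open>Normalisation of signed sums: differences are pulled to the outside, equations between
  differences become equations between sums, and these are settled by commutativity.\<close>

lemmas diff_simps = diff_add_eq_diff diff_eq_eq eq_diff_eq uminus_eq_iff add.m_ac

end

text \<open>The properties of the algebra on which the homological part rests. \<open>filt n\<close>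
  stands for the elements of degree less than \<open>n\<close>, whence \<open>filt 0\<close> is
  zero. \<open>filt_syzygy\<close> is exactness of the Koszul complex at the generators, stated for
  leading terms: if the products of a triple cancel in top degree, the boundary of
  \<open>(\<alpha>, \<beta>, \<gamma>)\<close> removes the leading parts of the triple.
  \<open>filt_expand\<close> says that \<open>K\<close> and \<open>u\<close>, \<open>x\<close>,
  \<open>z\<close> generate the ring.\<close>

locale uxz_algebra = ring R for R :: "('a, 'b) ring_scheme" (structure) +
  fixes K :: "'a set" and u x z :: 'a and filt :: "nat \<Rightarrow> 'a set"
  assumes K_subfield: "subfield K R"
    and K_central: "\<lbrakk>k \<in> K; a \<in> carrier R\<rbrakk> \<Longrightarrow> k \<otimes> a = a \<otimes> k"
    and gens [simp, intro]: "u \<in> carrier R" "x \<in> carrier R" "z \<in> carrier R"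
    and ux: "u \<otimes> x = \<zero>" and xz: "x \<otimes> z = \<zero>" and zu: "z \<otimes> u = z \<otimes> x"
    and filt_carrier: "filt n \<subseteq> carrier R" and filt_zero: "filt 0 = {\<zero>}"
    and filt_mono: "filt n \<subseteq> filt (Suc n)"
    and filt_exhaust: "a \<in> carrier R \<Longrightarrow> \<exists>n. a \<in> filt n"
    and filt_add: "\<lbrakk>a \<in> filt n; b \<in> filt n\<rbrakk> \<Longrightarrow> a \<oplus> b \<in> filt n"
    and filt_smult: "\<lbrakk>k \<in> K; a \<in> filt n\<rbrakk> \<Longrightarrow> k \<otimes> a \<in> filt n"
    and filt_u: "\<lbrakk>a \<in> carrier R; a \<otimes> u \<in> filt (Suc n)\<rbrakk> \<Longrightarrow> a \<in> filt n"
    and ann_x: "\<lbrakk>a \<in> carrier R; a \<otimes> x = \<zero>\<rbrakk> \<Longrightarrow> \<exists>b\<in>carrier R. a = b \<otimes> u"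
    and ann_z: "\<lbrakk>a \<in> carrier R; a \<otimes> z = \<zero>\<rbrakk> \<Longrightarrow> \<exists>b\<in>carrier R. a = b \<otimes> x"
    and filt_syzygy: "\<lbrakk>a \<in> filt (Suc n); b \<in> filt (Suc n); c \<in> filt (Suc n);
        a \<otimes> u \<oplus> b \<otimes> x \<oplus> c \<otimes> z \<in> filt (Suc n)\<rbrakk> \<Longrightarrow>
      \<exists>\<alpha>\<in>filt n. \<exists>\<beta>\<in>filt n. \<exists>\<gamma>\<in>filt n.
        a \<ominus> \<gamma> \<otimes> z \<in> filt n \<and> b \<ominus> (\<alpha> \<otimes> u \<ominus> \<gamma> \<otimes> z) \<in> filt n \<and> c \<ominus> \<beta> \<otimes> x \<in> filt n"
    and filt_expand: "a \<in> filt (Suc n) \<Longrightarrow> \<exists>k\<in>K. \<exists>a1\<in>filt n. \<exists>a2\<in>filt n. \<exists>a3\<in>filt n.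
        a = k \<oplus> a1 \<otimes> u \<oplus> a2 \<otimes> x \<oplus> a3 \<otimes> z"
begin

lemma K_carrier: "k \<in> K \<Longrightarrow> k \<in> carrier R"
  using subfieldE(3)[OF K_subfield] by auto

lemma K_ops: "\<zero> \<in> K" "\<one> \<in> K" "k \<in> K \<Longrightarrow> \<ominus> k \<in> K" "\<lbrakk>k \<in> K; l \<in> K\<rbrakk> \<Longrightarrow> k \<oplus> l \<in> K"
  "\<lbrakk>k \<in> K; l \<in> K\<rbrakk> \<Longrightarrow> k \<otimes> l \<in> K"
  using subringE[OF subfieldE(1)[OF K_subfield]] by auto

lemma filt_closed: "a \<in> filt n \<Longrightarrow> a \<in> carrier R"
  using filt_carrier by auto

lemma filt_le: "n \<le> m \<Longrightarrow> filt n \<subseteq> filt m"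
  by (rule lift_Suc_mono_le[of filt]) (auto intro: filt_mono[THEN subsetD])

lemma zero_in_filt: "\<zero> \<in> filt n"
  using filt_le[of 0 n] filt_zero by auto

lemma filt_uminus: "a \<in> filt n \<Longrightarrow> \<ominus> a \<in> filt n"
  using filt_smult[of "\<ominus> \<one>" a n] K_ops filt_closed[of a n] by (simp add: l_minus)

lemma filt_minus: "\<lbrakk>a \<in> filt n; b \<in> filt n\<rbrakk> \<Longrightarrow> a \<ominus> b \<in> filt n"
  by (simp add: minus_eq filt_add filt_uminus)

text \<open>The lowest case of \<open>filt_u\<close>, in which the conclusion
  \<open>a \<in> filt 0\<close> means \<open>a = \<zero>\<close>.\<close>

lemma mult_u_inj: "\<lbrakk>a \<in> carrier R; a \<otimes> u = \<zero>\<rbrakk> \<Longrightarrow> a = \<zero>"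
  using filt_u[of a 0] zero_in_filt[of 1] filt_zero by auto

definition y :: 'a where "y = u \<ominus> x"

lemma y_closed [simp, intro]: "y \<in> carrier R"
  by (simp add: y_def)

lemma zy: "z \<otimes> y = \<zero>"
  by (simp add: y_def minus_eq r_distr r_minus zu r_neg)

end

locale uxz_module = uxz_algebra R K u x z filt + M?: left_module R M
  for R :: "('a, 'b) ring_scheme" (structure) and K u x z filt and M :: "('a, 'm) module" (structure) +
  fixes B :: "'m set"
  assumes basis: "basis_over K B"
begin

abbreviation P :: "('a, 'm \<Rightarrow> 'a) module" where "P \<equiv> free_module R B"

sublocale P: left_module R P by (rule left_module_free_module)

lemma basis_carrier: "B \<subseteq> carrier M"
  using basis by (auto simp: basis_over_def lin_indep_def)

abbreviation \<epsilon> :: "('m \<Rightarrow> 'a) \<Rightarrow> 'm" where "\<epsilon> \<equiv> combination"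

lemma eps_hom: "\<epsilon> \<in> lmod_hom R P M"
  using basis_carrier by (intro free_ext_hom) auto

lemma eps_unit_vec: "b \<in> B \<Longrightarrow> \<epsilon> (unit_vec b) = b"
  using basis_carrier by (intro free_ext_unit_vec[of _ B]) auto

definition \<eta> :: "'m \<Rightarrow> 'm \<Rightarrow> 'a" where
  "\<eta> m = (SOME f. f \<in> field_vec K B \<and> \<epsilon> f = m)"

lemma eta: "m \<in> carrier M \<Longrightarrow> \<eta> m \<in> field_vec K B" "m \<in> carrier M \<Longrightarrow> \<epsilon> (\<eta> m) = m"
  unfolding \<eta>_def using basis
  by (metis (mono_tags, lifting) basis_over_def someI_ex)+

lemma eta_closed: "m \<in> carrier M \<Longrightarrow> \<eta> m \<in> carrier P"
  using eta(1) by (auto simp: field_vec_def)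

lemma eta_unique:
  assumes f: "f \<in> field_vec K B" and m: "\<epsilon> f = m"
  shows "\<eta> m = f"
proof -
  have fc: "f \<in> carrier P" using f by (auto simp: field_vec_def)
  then have mc: "m \<in> carrier M" using m lmod_hom_closed[OF eps_hom] by auto
  let ?g = "\<eta> m \<oplus>\<^bsub>P\<^esub> (\<ominus> \<one>) \<odot>\<^bsub>P\<^esub> f"
  have "?g \<in> field_vec K B"
    by (intro M.field_vec_add M.field_vec_smult K_subfield K_ops f eta mc)
  moreover have "\<epsilon> ?g = \<zero>\<^bsub>M\<^esub>"
    using mc fc eta_closed[OF mc]
    by (simp add: lmod_hom_add[OF eps_hom] lmod_hom_smult[OF eps_hom] P.smult_closed m eta
        M.smult_l_minus M.smult_one M.M.r_neg)
  ultimately have "?g = \<zero>\<^bsub>P\<^esub>" using basis by (auto simp: basis_over_def lin_indep_def free_module_simps)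
  then have "\<eta> m \<ominus>\<^bsub>P\<^esub> f = \<zero>\<^bsub>P\<^esub>"
    using fc by (simp only: P.smult_l_minus P.smult_one P.M.minus_eq one_closed)
  from P.M.eq_of_minus_zero[OF eta_closed[OF mc] fc this] show ?thesis .
qed

lemma eta_add:
  assumes "m \<in> carrier M" "n \<in> carrier M" shows "\<eta> (m \<oplus>\<^bsub>M\<^esub> n) = \<eta> m \<oplus>\<^bsub>P\<^esub> \<eta> n"
  using assms by (intro eta_unique M.field_vec_add K_subfield eta)
    (simp_all add: lmod_hom_add[OF eps_hom] eta eta_closed)

lemma eta_smult:
  assumes "m \<in> carrier M" "k \<in> K" shows "\<eta> (k \<odot>\<^bsub>M\<^esub> m) = k \<odot>\<^bsub>P\<^esub> \<eta> m"
  using assms by (intro eta_unique M.field_vec_smult K_subfield eta)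
    (simp_all add: lmod_hom_smult[OF eps_hom] eta eta_closed K_carrier)

lemma eta_basis: "b \<in> B \<Longrightarrow> \<eta> b = unit_vec b"
  by (intro eta_unique M.field_vec_unit_vec K_subfield eps_unit_vec)

lemma eta_zero: "\<eta> \<zero>\<^bsub>M\<^esub> = \<zero>\<^bsub>P\<^esub>"
  using eta_smult[of "\<zero>\<^bsub>M\<^esub>" \<zero>] K_ops eta_closed by simp

text \<open>With \<open>P\<close> in the role of \<open>A \<otimes>\<^sub>K M\<close> and \<open>\<eta> m\<close> in that of \<open>1 \<otimes> m\<close>, these are the operators
  \<open>a \<otimes> m \<mapsto> ag \<otimes> m\<close> and \<open>a \<otimes> m \<mapsto> a \<otimes> gm\<close>.\<close>

definition Rm :: "'a \<Rightarrow> ('m \<Rightarrow> 'a) \<Rightarrow> 'm \<Rightarrow> 'a" where "Rm g f = (\<lambda>b. f b \<otimes> g)"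

definition Lm :: "'a \<Rightarrow> ('m \<Rightarrow> 'a) \<Rightarrow> 'm \<Rightarrow> 'a" where
  "Lm g = free_ext R P (\<lambda>b. \<eta> (g \<odot>\<^bsub>M\<^esub> b))"

lemma Rm_hom:
  assumes "g \<in> carrier R" shows "Rm g \<in> lmod_hom R P P"
proof (rule lmod_homI)
  fix f assume f: "f \<in> carrier P"
  then have "finite {b. f b \<noteq> \<zero>}" by (simp add: free_module_simps)
  moreover have "{b. Rm g f b \<noteq> \<zero>} \<subseteq> {b. f b \<noteq> \<zero>}" using assms by (auto simp: Rm_def)
  ultimately have "finite {b. Rm g f b \<noteq> \<zero>}" by (rule rev_finite_subset)
  then show "Rm g f \<in> carrier P" using f assms by (simp add: free_module_simps Rm_def)
qed (use assms in \<open>auto simp: Rm_def free_module_simps(2-) l_distr m_assoc\<close>)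

lemma Lm_hom:
  assumes "g \<in> carrier R" shows "Lm g \<in> lmod_hom R P P"
  unfolding Lm_def using assms basis_carrier by (intro P.free_ext_hom) (auto intro!: eta_closed M.smult_closed)

lemma Lm_unit_vec:
  assumes "g \<in> carrier R" "b \<in> B" shows "Lm g (unit_vec b) = \<eta> (g \<odot>\<^bsub>M\<^esub> b)"
  unfolding Lm_def using assms basis_carrier
  by (intro P.free_ext_unit_vec[of _ B]) (auto intro!: eta_closed M.smult_closed)

lemmas Rm_closed = lmod_hom_closed[OF Rm_hom]
lemmas Lm_closed = lmod_hom_closed[OF Lm_hom]
lemmas Rm_add = lmod_hom_add[OF Rm_hom]
lemmas Lm_add = lmod_hom_add[OF Lm_hom]
lemmas Rm_minus = lmod_hom_minus[OF P.left_module_axioms P.left_module_axioms Rm_hom]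
lemmas Lm_minus = lmod_hom_minus[OF P.left_module_axioms P.left_module_axioms Lm_hom]
lemmas Rm_zero = lmod_hom_zero[OF P.left_module_axioms P.left_module_axioms Rm_hom]
lemmas Lm_zero = lmod_hom_zero[OF P.left_module_axioms P.left_module_axioms Lm_hom]
lemmas Rm_uminus = lmod_hom_uminus[OF P.left_module_axioms P.left_module_axioms Rm_hom]
lemmas Lm_uminus = lmod_hom_uminus[OF P.left_module_axioms P.left_module_axioms Lm_hom]

text \<open>The coordinates of \<open>\<eta> m\<close> lie in the central subfield, so they may be
  multiplied by \<open>g\<close> from either side.\<close>

lemma Rm_eta:
  assumes "g \<in> carrier R" "m \<in> carrier M" shows "Rm g (\<eta> m) = g \<odot>\<^bsub>P\<^esub> \<eta> m"
  using assms eta[of m] by (auto simp: Rm_def free_module_simps(4) field_vec_def K_central)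

text \<open>By its definition \<open>Lm\<close> has this value on basis elements only. The general
  case is the \<open>K\<close>-linearity of \<open>\<eta>\<close> and of the action of
  \<open>g\<close>, the latter because \<open>K\<close> is central.\<close>

lemma Lm_eta:
  assumes g: "g \<in> carrier R" and m: "m \<in> carrier M" shows "Lm g (\<eta> m) = \<eta> (g \<odot>\<^bsub>M\<^esub> m)"
proof -
  \<comment> \<open>The induction runs over all vectors and carries the restriction to coefficients
    in \<open>K\<close> as a premise of the claim.\<close>
  have "f \<in> field_vec K B \<longrightarrow> Lm g f = \<eta> (g \<odot>\<^bsub>M\<^esub> \<epsilon> f)" if "f \<in> carrier P" for f
    using that
  proof (induction f rule: free_module_induct)
    case zero
    have "Lm g \<zero>\<^bsub>P\<^esub> = \<eta> (g \<odot>\<^bsub>M\<^esub> \<epsilon> \<zero>\<^bsub>P\<^esub>)"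
      using g by (simp add: Lm_zero lmod_hom_zero[OF P.left_module_axioms M.left_module_axioms eps_hom] eta_zero)
    then show ?case by (simp add: free_module_simps(2))
  next
    case (add k b f)
    note [simp] = add(1-3) g P.smult_closed M.smult_closed eta_closed
    have [simp]: "b \<in> carrier M" "\<epsilon> f \<in> carrier M"
      using basis_carrier add(2) lmod_hom_closed[OF eps_hom add(3)] by auto
    show ?case
    proof
      assume sum: "k \<odot>\<^bsub>P\<^esub> unit_vec b \<oplus>\<^bsub>P\<^esub> f \<in> field_vec K B"
      then have K: "k \<otimes> unit_vec b c \<oplus> f c \<in> K" for c
        by (simp add: field_vec_def free_module_simps(3,4))
      \<comment> \<open>At \<open>b\<close> the remaining vector vanishes, so this entry of the sum
        is \<open>k\<close> itself.\<close>
      have k: "k \<in> K" using K[of b] add(4) by (simp add: unit_vec_def)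
      have "f c \<in> K" for c
        using K[of c] add(4) K_ops(1) free_module_app[OF add(3), of c] by (cases "c = b") (simp_all add: unit_vec_def)
      then have IH: "Lm g f = \<eta> (g \<odot>\<^bsub>M\<^esub> \<epsilon> f)" using add(3,5) by (simp add: field_vec_def)
      have "g \<odot>\<^bsub>M\<^esub> (k \<odot>\<^bsub>M\<^esub> b) = k \<odot>\<^bsub>M\<^esub> (g \<odot>\<^bsub>M\<^esub> b)"
        using K_central[OF k g] by (simp add: M.smult_assoc[symmetric])
      then show "Lm g (k \<odot>\<^bsub>P\<^esub> unit_vec b \<oplus>\<^bsub>P\<^esub> f) = \<eta> (g \<odot>\<^bsub>M\<^esub> \<epsilon> (k \<odot>\<^bsub>P\<^esub> unit_vec b \<oplus>\<^bsub>P\<^esub> f))"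
        by (simp add: Lm_add lmod_hom_smult[OF Lm_hom] Lm_unit_vec IH lmod_hom_add[OF eps_hom]
            lmod_hom_smult[OF eps_hom] eps_unit_vec M.smult_r_distr eta_add eta_smult k)
    qed
  qed
  then show ?thesis using eta_closed[OF m] eta[OF m] by simp
qed

lemma unit_vec_eta: "b \<in> B \<Longrightarrow> unit_vec b = \<eta> b" "b \<in> B \<Longrightarrow> b \<in> carrier M"
  using eta_basis basis_carrier by auto

text \<open>The two operators act on different tensor factors.\<close>

lemma Lm_Rm:
  assumes "g \<in> carrier R" "h \<in> carrier R" "f \<in> carrier P"
  shows "Lm h (Rm g f) = Rm g (Lm h f)"
  by (rule P.hom_eqI[OF lmod_hom_comp[OF Rm_hom Lm_hom] lmod_hom_comp[OF Lm_hom Rm_hom]])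
    (use assms in \<open>simp_all add: unit_vec_eta Rm_eta Lm_eta lmod_hom_smult[OF Lm_hom] eta_closed M.smult_closed\<close>)

lemma Lm_Lm:
  assumes "g \<in> carrier R" "h \<in> carrier R" "f \<in> carrier P"
  shows "Lm g (Lm h f) = Lm (g \<otimes> h) f"
  by (rule P.hom_eqI[OF lmod_hom_comp[OF Lm_hom Lm_hom] Lm_hom])
    (use assms in \<open>simp_all add: unit_vec_eta Lm_eta M.smult_closed M.smult_assoc\<close>)

lemma Lm_0:
  assumes "f \<in> carrier P" shows "Lm \<zero> f = \<zero>\<^bsub>P\<^esub>"
  by (rule P.hom_eqI[OF Lm_hom P.lmod_hom_zero_map])
    (use assms in \<open>simp_all add: unit_vec_eta Lm_eta eta_zero P.left_module_axioms\<close>)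

lemma Lm_diff:
  assumes "g \<in> carrier R" "h \<in> carrier R" "f \<in> carrier P"
  shows "Lm (g \<ominus> h) f = Lm g f \<ominus>\<^bsub>P\<^esub> Lm h f"
proof (rule P.hom_eqI[OF Lm_hom P.lmod_hom_minus_map[OF Lm_hom Lm_hom]])
  fix b assume b: "b \<in> B"
  have m: "m \<in> carrier M \<Longrightarrow> \<eta> (\<ominus>\<^bsub>M\<^esub> m) = \<ominus>\<^bsub>P\<^esub> \<eta> m" for m
    using eta_smult[of m "\<ominus> \<one>"] K_ops by (simp add: M.smult_l_minus P.smult_l_minus M.smult_one P.smult_one eta_closed)
  have bM: "b \<in> carrier M" "g \<odot>\<^bsub>M\<^esub> b \<in> carrier M" "h \<odot>\<^bsub>M\<^esub> b \<in> carrier M"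
    using b basis_carrier assms(1,2) by (auto intro!: M.smult_closed)
  have "(g \<ominus> h) \<odot>\<^bsub>M\<^esub> b = g \<odot>\<^bsub>M\<^esub> b \<oplus>\<^bsub>M\<^esub> \<ominus>\<^bsub>M\<^esub> (h \<odot>\<^bsub>M\<^esub> b)"
    using assms(1,2) bM(1) by (simp add: a_minus_def M.smult_l_distr M.smult_l_minus)
  then have "\<eta> ((g \<ominus> h) \<odot>\<^bsub>M\<^esub> b) = \<eta> (g \<odot>\<^bsub>M\<^esub> b) \<ominus>\<^bsub>P\<^esub> \<eta> (h \<odot>\<^bsub>M\<^esub> b)"
    using bM by (simp only: eta_add m M.M.a_inv_closed a_minus_def)
  then show "Lm (g \<ominus> h) (unit_vec b) = Lm g (unit_vec b) \<ominus>\<^bsub>P\<^esub> Lm h (unit_vec b)"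
    using assms(1,2) b by (simp add: Lm_unit_vec)
qed (use assms in auto)

lemma Lm_y: "f \<in> carrier P \<Longrightarrow> Lm y f = Lm u f \<ominus>\<^bsub>P\<^esub> Lm x f"
  by (simp add: y_def Lm_diff)

lemma Rm_Rm:
  assumes "g \<in> carrier R" "h \<in> carrier R" "f \<in> carrier P"
  shows "Rm g (Rm h f) = Rm (h \<otimes> g) f"
  using assms by (simp add: Rm_def m_assoc)

lemma Rm_0: "f \<in> carrier P \<Longrightarrow> Rm \<zero> f = \<zero>\<^bsub>P\<^esub>"
  by (simp add: Rm_def free_module_simps(2))

text \<open>\<open>Rm\<close> reverses products and \<open>Lm\<close> preserves them, so each
  relation among \<open>u\<close>, \<open>x\<close>, \<open>z\<close> appears twice, with the
  operators composed in opposite orders.\<close>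

lemma Rm_Lm_relations:
  assumes "f \<in> carrier P"
  shows "Rm x (Rm u f) = \<zero>\<^bsub>P\<^esub>" "Rm z (Rm x f) = \<zero>\<^bsub>P\<^esub>" "Rm u (Rm z f) = Rm x (Rm z f)"
    "Lm u (Lm x f) = \<zero>\<^bsub>P\<^esub>" "Lm x (Lm z f) = \<zero>\<^bsub>P\<^esub>" "Lm z (Lm u f) = Lm z (Lm x f)" "Lm z (Lm y f) = \<zero>\<^bsub>P\<^esub>"
  using assms by (simp_all add: Rm_Rm Lm_Lm ux xz zu zy Rm_0 Lm_0)

text \<open>Both \<open>ag \<otimes> m\<close> and \<open>a \<otimes> gm\<close> are sent to
  \<open>agm\<close>. The differences \<open>Rm g f - Lm g f\<close> thus lie in the kernel of
  \<open>\<epsilon>\<close>, which is what makes \<open>D1\<close> a differential.\<close>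

lemma eps_Rm:
  assumes "g \<in> carrier R" "f \<in> carrier P"
  shows "\<epsilon> (Rm g f) = \<epsilon> (Lm g f)"
  by (rule M.hom_eqI[OF lmod_hom_comp[OF Rm_hom eps_hom] lmod_hom_comp[OF Lm_hom eps_hom]])
    (use assms in \<open>simp_all add: unit_vec_eta Rm_eta Lm_eta lmod_hom_smult[OF eps_hom] eta eta_closed M.smult_closed\<close>)

end

lemma (in abelian_group) minus_zero_right: "a \<in> carrier G \<Longrightarrow> a \<ominus> \<zero> = a"
  by (simp add: minus_eq)

section \<open>Exactness of the bimodule Koszul complex with coefficients in a module\<close>

context uxz_module
begin

definition D1 :: "('m \<Rightarrow> 'a) \<Rightarrow> ('m \<Rightarrow> 'a) \<Rightarrow> ('m \<Rightarrow> 'a) \<Rightarrow> 'm \<Rightarrow> 'a" where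
  "D1 p q r = (Rm u p \<ominus>\<^bsub>P\<^esub> Lm u p) \<oplus>\<^bsub>P\<^esub> (Rm x q \<ominus>\<^bsub>P\<^esub> Lm x q) \<oplus>\<^bsub>P\<^esub> (Rm z r \<ominus>\<^bsub>P\<^esub> Lm z r)"

text \<open>The arguments \<alpha>, \<beta>, \<gamma> of \<open>D2u\<close>, \<open>D2x\<close>,
  \<open>D2z\<close> are the coefficients of the relations \<open>ux\<close>, \<open>xz\<close> and
  \<open>zy\<close>. A relation \<open>gh\<close> contributes \<open>Rm g\<close> to the component
  of \<open>h\<close> and \<open>Lm h\<close> to that of \<open>g\<close>. For \<open>zy\<close> the
  component of \<open>y = u - x\<close> is split, which is why \<open>Rm z \<gamma>\<close> occurs
  in \<open>D2u\<close> and, negated, in \<open>D2x\<close>.\<close>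

definition D2u :: "('m \<Rightarrow> 'a) \<Rightarrow> ('m \<Rightarrow> 'a) \<Rightarrow> 'm \<Rightarrow> 'a" where
  "D2u \<alpha> \<gamma> = Lm x \<alpha> \<oplus>\<^bsub>P\<^esub> Rm z \<gamma>"

definition D2x :: "('m \<Rightarrow> 'a) \<Rightarrow> ('m \<Rightarrow> 'a) \<Rightarrow> ('m \<Rightarrow> 'a) \<Rightarrow> 'm \<Rightarrow> 'a" where
  "D2x \<alpha> \<beta> \<gamma> = Rm u \<alpha> \<oplus>\<^bsub>P\<^esub> Lm z \<beta> \<ominus>\<^bsub>P\<^esub> Rm z \<gamma>"

definition D2z :: "('m \<Rightarrow> 'a) \<Rightarrow> ('m \<Rightarrow> 'a) \<Rightarrow> 'm \<Rightarrow> 'a" where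
  "D2z \<beta> \<gamma> = Rm x \<beta> \<oplus>\<^bsub>P\<^esub> Lm y \<gamma>"

lemmas RL_closed [simp] = Rm_closed Lm_closed P.M.minus_closed

lemmas RL_simps = Rm_add Lm_add Rm_minus Lm_minus Rm_zero Lm_zero Rm_uminus Lm_uminus Lm_Rm Rm_Lm_relations

lemma D_closed [simp]:
  "\<lbrakk>p \<in> carrier P; q \<in> carrier P; r \<in> carrier P\<rbrakk> \<Longrightarrow> D1 p q r \<in> carrier P"
  "\<lbrakk>p \<in> carrier P; r \<in> carrier P\<rbrakk> \<Longrightarrow> D2u p r \<in> carrier P"
  "\<lbrakk>p \<in> carrier P; q \<in> carrier P; r \<in> carrier P\<rbrakk> \<Longrightarrow> D2x p q r \<in> carrier P"
  "\<lbrakk>p \<in> carrier P; r \<in> carrier P\<rbrakk> \<Longrightarrow> D2z p r \<in> carrier P"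
  by (simp_all add: D1_def D2u_def D2x_def D2z_def)

lemma D1_D2:
  assumes [simp]: "\<alpha> \<in> carrier P" "\<beta> \<in> carrier P" "\<gamma> \<in> carrier P"
  shows "D1 (D2u \<alpha> \<gamma>) (D2x \<alpha> \<beta> \<gamma>) (D2z \<beta> \<gamma>) = \<zero>\<^bsub>P\<^esub>"
proof -
  have *: "Rm u (D2u \<alpha> \<gamma>) = Rm u (Lm x \<alpha>) \<oplus>\<^bsub>P\<^esub> Rm x (Rm z \<gamma>)" "Lm u (D2u \<alpha> \<gamma>) = Rm z (Lm u \<gamma>)"
    "Rm x (D2x \<alpha> \<beta> \<gamma>) = Rm x (Lm z \<beta>) \<ominus>\<^bsub>P\<^esub> Rm x (Rm z \<gamma>)"
    "Lm x (D2x \<alpha> \<beta> \<gamma>) = Rm u (Lm x \<alpha>) \<ominus>\<^bsub>P\<^esub> Rm z (Lm x \<gamma>)"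
    "Rm z (D2z \<beta> \<gamma>) = Rm z (Lm u \<gamma>) \<ominus>\<^bsub>P\<^esub> Rm z (Lm x \<gamma>)" "Lm z (D2z \<beta> \<gamma>) = Rm x (Lm z \<beta>)"
    by (simp_all add: D2u_def D2x_def D2z_def RL_simps) (simp add: Lm_y Rm_minus)
  show ?thesis unfolding D1_def * by (simp add: P.M.diff_simps)
qed

text \<open>The degree is measured in the coefficients alone, since \<open>M\<close> carries no
  grading.\<close>

definition PF :: "nat \<Rightarrow> ('m \<Rightarrow> 'a) set" where
  "PF n = {f \<in> carrier P. \<forall>b. f b \<in> filt n}"

lemma PF_exhaust: assumes "f \<in> carrier P" shows "\<exists>n. f \<in> PF n"
proof -
  have "\<forall>b. \<exists>n. f b \<in> filt n" using filt_exhaust free_module_app[OF assms] by blast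
  then obtain N where N: "\<And>b. f b \<in> filt (N b)" by metis
  have "f b \<in> filt (Max (N ` {b. f b \<noteq> \<zero>}))" for b
  proof (cases "f b = \<zero>")
    case False
    have "N b \<le> Max (N ` {b. f b \<noteq> \<zero>})"
      using False assms by (intro Max_ge) (auto simp: free_module_simps)
    then show ?thesis using N filt_le by blast
  qed (simp add: zero_in_filt)
  then show ?thesis using assms by (auto simp: PF_def)
qed

lemma PF_le: "n \<le> m \<Longrightarrow> PF n \<subseteq> PF m"
  using filt_le by (auto simp: PF_def)

lemma PF_0: "f \<in> PF 0 \<Longrightarrow> f = \<zero>\<^bsub>P\<^esub>"
  by (auto simp: PF_def filt_zero free_module_simps)

lemma PF_closed: "f \<in> PF n \<Longrightarrow> f \<in> carrier P" by (simp add: PF_def)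

lemma PF_add: "\<lbrakk>f \<in> PF n; g \<in> PF n\<rbrakk> \<Longrightarrow> f \<oplus>\<^bsub>P\<^esub> g \<in> PF n"
  using P.M.a_closed[of f g] by (auto simp: PF_def free_module_simps(3) filt_add)

lemma PF_minus: "\<lbrakk>f \<in> PF n; g \<in> PF n\<rbrakk> \<Longrightarrow> f \<ominus>\<^bsub>P\<^esub> g \<in> PF n"
  using P.M.minus_closed[of f g] by (auto simp: PF_def free_module_minus filt_minus)

lemma PF_zero: "\<zero>\<^bsub>P\<^esub> \<in> PF n"
  using P.M.zero_closed by (simp only: PF_def mem_Collect_eq) (simp add: free_module_simps(2) zero_in_filt)

text \<open>\<open>\<eta>\<close> has its coordinates in \<open>K\<close>, and \<open>filt n\<close>
  is closed under multiplication by \<open>K\<close> and under sums. So an operator on the factor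
  \<open>M\<close> does not raise the degree, in contrast to right multiplication.\<close>

lemma PF_Lm:
  assumes g: "g \<in> carrier R" and f: "f \<in> PF n"
  shows "Lm g f \<in> PF n"
proof -
  have fP: "f \<in> carrier P" using f by (rule PF_closed)
  have t: "f b \<odot>\<^bsub>P\<^esub> \<eta> (g \<odot>\<^bsub>M\<^esub> b) \<in> PF n" if b: "b \<in> B" for b
  proof -
    have bM: "g \<odot>\<^bsub>M\<^esub> b \<in> carrier M" using b g basis_carrier by (auto intro: M.smult_closed)
    have "f b \<odot>\<^bsub>P\<^esub> \<eta> (g \<odot>\<^bsub>M\<^esub> b) \<in> carrier P"
      using fP by (intro P.smult_closed eta_closed bM) auto
    moreover have "f b \<otimes> \<eta> (g \<odot>\<^bsub>M\<^esub> b) c \<in> filt n" for c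
    proof -
      have k: "\<eta> (g \<odot>\<^bsub>M\<^esub> b) c \<in> K" using eta(1)[OF bM] by (simp add: field_vec_def)
      show ?thesis using filt_smult[OF k, of "f b" n] K_central[OF k, of "f b"] f fP
        by (simp add: PF_def)
    qed
    ultimately show ?thesis by (simp add: PF_def free_module_simps(4))
  qed
  have "(\<Oplus>\<^bsub>P\<^esub>b\<in>S. f b \<odot>\<^bsub>P\<^esub> \<eta> (g \<odot>\<^bsub>M\<^esub> b)) \<in> PF n" if "finite S" "S \<subseteq> B" for S
    using that
  proof (induction S rule: finite_induct)
    case empty then show ?case using PF_zero by simp
  next
    case (insert s S)
    then have "(\<lambda>b. f b \<odot>\<^bsub>P\<^esub> \<eta> (g \<odot>\<^bsub>M\<^esub> b)) \<in> S \<rightarrow> carrier P" "f s \<odot>\<^bsub>P\<^esub> \<eta> (g \<odot>\<^bsub>M\<^esub> s) \<in> carrier P"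
      using t PF_closed by (auto simp: Pi_iff)
    then show ?case using insert t by (simp add: PF_add)
  qed
  from this[OF _ free_module_supp[OF fP]] fP show ?thesis
    by (simp add: Lm_def free_ext_def free_module_simps(1))
qed

lemma PF_Rm_u:
  assumes "f \<in> carrier P" "Rm u f \<in> PF (Suc n)"
  shows "f \<in> PF n"
proof -
  have "f b \<in> filt n" for b
    using assms by - (rule filt_u, auto simp: PF_def Rm_def)
  then show ?thesis using assms(1) by (simp add: PF_def)
qed

lemma Rm_u_inj:
  assumes "f \<in> carrier P" "Rm u f = \<zero>\<^bsub>P\<^esub>"
  shows "f = \<zero>\<^bsub>P\<^esub>"
  using PF_Rm_u[of f 0] PF_zero assms by (auto intro: PF_0)

text \<open>Right multiplication by \<open>u\<close> raises the degree of the coefficients by one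
  while \<open>Lm x\<close> does not raise it, so the equation lowers any bound on the degree of
  \<open>f\<close> until nothing remains.\<close>

lemma Rm_u_eq_Lm_x:
  assumes f: "f \<in> carrier P" and eq: "Rm u f = \<ominus>\<^bsub>P\<^esub> Lm x f"
  shows "f = \<zero>\<^bsub>P\<^esub>"
proof -
  have "f \<in> PF n \<Longrightarrow> f \<in> PF 0" for n
  proof (induction n)
    case (Suc n)
    have "\<zero>\<^bsub>P\<^esub> \<ominus>\<^bsub>P\<^esub> Lm x f \<in> PF (Suc n)"
      by (intro PF_minus PF_zero PF_Lm Suc) auto
    then have "Rm u f \<in> PF (Suc n)" using f by (simp add: eq P.M.minus_eq)
    then show ?case using PF_Rm_u[OF f] Suc by blast
  qed
  then show ?thesis using PF_exhaust[OF f] PF_0 by blast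
qed

text \<open>Preimages are chosen coordinate by coordinate, with zero over zero so that the support
  stays finite.\<close>

lemma Rm_preimage:
  assumes "\<And>a. \<lbrakk>a \<in> carrier R; a \<otimes> g = \<zero>\<rbrakk> \<Longrightarrow> \<exists>b\<in>carrier R. a = b \<otimes> h"
    and f: "f \<in> carrier P" and h: "h \<in> carrier R" and "Rm g f = \<zero>\<^bsub>P\<^esub>"
  shows "\<exists>f'\<in>carrier P. f = Rm h f'"
proof -
  have "\<exists>c\<in>carrier R. f b = c \<otimes> h \<and> (f b = \<zero> \<longrightarrow> c = \<zero>)" for b
  proof (cases "f b = \<zero>")
    case True then show ?thesis using h by auto
  next
    case False
    have "f b \<otimes> g = \<zero>" using assms(4) by (metis Rm_def free_module_simps(2))
    then show ?thesis using assms(1)[of "f b"] f False by auto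
  qed
  then obtain f' where f': "\<And>b. f' b \<in> carrier R" "\<And>b. f b = f' b \<otimes> h" "\<And>b. f b = \<zero> \<Longrightarrow> f' b = \<zero>"
    by metis
  have "{b. f' b \<noteq> \<zero>} \<subseteq> {b. f b \<noteq> \<zero>}" using f'(3) by auto
  then have "f' \<in> carrier P" using f f'(1,3) finite_subset by (auto simp: free_module_simps(1))
  then show ?thesis using f'(2) by (auto simp: Rm_def fun_eq_iff)
qed

lemma ker_Rm_x: "\<lbrakk>f \<in> carrier P; Rm x f = \<zero>\<^bsub>P\<^esub>\<rbrakk> \<Longrightarrow> \<exists>f'\<in>carrier P. f = Rm u f'"
  by (rule Rm_preimage[OF ann_x]) auto

lemma ker_Rm_z: "\<lbrakk>f \<in> carrier P; Rm z f = \<zero>\<^bsub>P\<^esub>\<rbrakk> \<Longrightarrow> \<exists>f'\<in>carrier P. f = Rm x f'"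
  by (rule Rm_preimage[OF ann_z]) auto

lemma exact_3:
  assumes [simp]: "p \<in> carrier P" "q \<in> carrier P"
    and "Rm u p \<ominus>\<^bsub>P\<^esub> Lm y q = \<zero>\<^bsub>P\<^esub>" and "Rm x q = \<zero>\<^bsub>P\<^esub>"
  shows "\<exists>r\<in>carrier P. p = Lm y r \<and> q = Rm u r"
proof -
  obtain r where r [simp]: "r \<in> carrier P" and q: "q = Rm u r" using ker_Rm_x[of q] assms by auto
  have "Rm u (p \<ominus>\<^bsub>P\<^esub> Lm y r) = \<zero>\<^bsub>P\<^esub>" using assms(3) by (simp add: q RL_simps)
  then have "p \<ominus>\<^bsub>P\<^esub> Lm y r = \<zero>\<^bsub>P\<^esub>" by - (rule Rm_u_inj, auto)
  then have "p = Lm y r" by - (rule P.M.eq_of_minus_zero, auto)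
  then show ?thesis using q r by blast
qed

text \<open>After substitution of the first equation, applying \<open>Lm x\<close> to the second one
  kills the term with \<open>\<beta>\<close>, by \<open>xz = 0\<close>, and leaves
  \<open>Rm u w = - Lm x w\<close> for \<open>w = Lm x \<alpha>\<close>. Hence \<open>w = 0\<close>,
  the first equation reduces to \<open>Rm z \<gamma> = 0\<close>, and the annihilators of
  \<open>z\<close> and \<open>x\<close> yield \<open>q\<close> and \<open>p\<close>.\<close>

lemma exact_2:
  assumes [simp]: "\<alpha> \<in> carrier P" "\<beta> \<in> carrier P" "\<gamma> \<in> carrier P"
    and eu: "D2u \<alpha> \<gamma> = \<zero>\<^bsub>P\<^esub>" and ex: "D2x \<alpha> \<beta> \<gamma> = \<zero>\<^bsub>P\<^esub>" and ez: "D2z \<beta> \<gamma> = \<zero>\<^bsub>P\<^esub>"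
  shows "\<exists>p\<in>carrier P. \<exists>q\<in>carrier P. \<alpha> = \<ominus>\<^bsub>P\<^esub> Lm z p \<and> \<beta> = Rm u p \<ominus>\<^bsub>P\<^esub> Lm y q \<and> \<gamma> = Rm x q"
proof -
  have eu': "Rm z \<gamma> = \<ominus>\<^bsub>P\<^esub> Lm x \<alpha>"
    using eu P.M.minus_equality[of "Rm z \<gamma>" "Lm x \<alpha>"] by (simp add: D2u_def P.M.a_comm)
  have "Lm x (Rm u \<alpha> \<oplus>\<^bsub>P\<^esub> Lm z \<beta> \<oplus>\<^bsub>P\<^esub> Lm x \<alpha>) = Lm x \<zero>\<^bsub>P\<^esub>"
    using ex by (simp add: D2x_def eu' P.M.minus_eq)
  then have "Rm u (Lm x \<alpha>) \<oplus>\<^bsub>P\<^esub> Lm x (Lm x \<alpha>) = \<zero>\<^bsub>P\<^esub>" by (simp add: RL_simps)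
  then have "Rm u (Lm x \<alpha>) = \<ominus>\<^bsub>P\<^esub> Lm x (Lm x \<alpha>)"
    using P.M.minus_equality[of "Rm u (Lm x \<alpha>)" "Lm x (Lm x \<alpha>)"] by simp
  then have L: "Lm x \<alpha> = \<zero>\<^bsub>P\<^esub>" by - (rule Rm_u_eq_Lm_x, auto)
  with eu' have Rz: "Rm z \<gamma> = \<zero>\<^bsub>P\<^esub>" by simp
  then obtain q where [simp]: "q \<in> carrier P" and q: "\<gamma> = Rm x q" using ker_Rm_z[of \<gamma>] by auto
  have "Rm x (\<beta> \<oplus>\<^bsub>P\<^esub> Lm y q) = \<zero>\<^bsub>P\<^esub>" using ez by (simp add: D2z_def q RL_simps)
  then obtain p where [simp]: "p \<in> carrier P" and p: "\<beta> \<oplus>\<^bsub>P\<^esub> Lm y q = Rm u p"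
    using ker_Rm_x[of "\<beta> \<oplus>\<^bsub>P\<^esub> Lm y q"] by auto
  have \<beta>: "\<beta> = Rm u p \<ominus>\<^bsub>P\<^esub> Lm y q" using p by (simp add: P.M.eq_diff_eq)
  have "Rm u (\<alpha> \<oplus>\<^bsub>P\<^esub> Lm z p) = \<zero>\<^bsub>P\<^esub>"
    using ex Rz by (simp add: D2x_def \<beta> RL_simps P.M.minus_zero_right)
  then have "\<alpha> \<oplus>\<^bsub>P\<^esub> Lm z p = \<zero>\<^bsub>P\<^esub>" by - (rule Rm_u_inj, auto)
  then have "\<alpha> = \<ominus>\<^bsub>P\<^esub> Lm z p" using P.M.minus_equality[of \<alpha> "Lm z p"] by simp
  then show ?thesis using \<beta> q by (intro bexI[of _ p] bexI[of _ q]) auto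
qed

lemma D1_minus:
  "\<lbrakk>p \<in> carrier P; q \<in> carrier P; r \<in> carrier P; p' \<in> carrier P; q' \<in> carrier P; r' \<in> carrier P\<rbrakk> \<Longrightarrow>
    D1 (p \<ominus>\<^bsub>P\<^esub> p') (q \<ominus>\<^bsub>P\<^esub> q') (r \<ominus>\<^bsub>P\<^esub> r') = D1 p q r \<ominus>\<^bsub>P\<^esub> D1 p' q' r'"
  unfolding D1_def by (simp add: RL_simps P.M.diff_simps)

lemma D2_add:
  "\<lbrakk>p \<in> carrier P; r \<in> carrier P; p' \<in> carrier P; r' \<in> carrier P\<rbrakk> \<Longrightarrow>
    D2u (p \<oplus>\<^bsub>P\<^esub> p') (r \<oplus>\<^bsub>P\<^esub> r') = D2u p r \<oplus>\<^bsub>P\<^esub> D2u p' r'"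
  "\<lbrakk>p \<in> carrier P; q \<in> carrier P; r \<in> carrier P; p' \<in> carrier P; q' \<in> carrier P; r' \<in> carrier P\<rbrakk> \<Longrightarrow>
    D2x (p \<oplus>\<^bsub>P\<^esub> p') (q \<oplus>\<^bsub>P\<^esub> q') (r \<oplus>\<^bsub>P\<^esub> r') = D2x p q r \<oplus>\<^bsub>P\<^esub> D2x p' q' r'"
  "\<lbrakk>p \<in> carrier P; r \<in> carrier P; p' \<in> carrier P; r' \<in> carrier P\<rbrakk> \<Longrightarrow>
    D2z (p \<oplus>\<^bsub>P\<^esub> p') (r \<oplus>\<^bsub>P\<^esub> r') = D2z p r \<oplus>\<^bsub>P\<^esub> D2z p' r'"
  unfolding D2u_def D2x_def D2z_def by (simp_all add: RL_simps P.M.diff_simps)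

lemma D2_zero [simp]:
  "D2u \<zero>\<^bsub>P\<^esub> \<zero>\<^bsub>P\<^esub> = \<zero>\<^bsub>P\<^esub>" "D2x \<zero>\<^bsub>P\<^esub> \<zero>\<^bsub>P\<^esub> \<zero>\<^bsub>P\<^esub> = \<zero>\<^bsub>P\<^esub>" "D2z \<zero>\<^bsub>P\<^esub> \<zero>\<^bsub>P\<^esub> = \<zero>\<^bsub>P\<^esub>"
  unfolding D2u_def D2x_def D2z_def by (simp_all add: RL_simps P.M.minus_eq)

lemma PF_syzygy:
  assumes p: "p \<in> PF (Suc n)" and q: "q \<in> PF (Suc n)" and r: "r \<in> PF (Suc n)"
    and s: "Rm u p \<oplus>\<^bsub>P\<^esub> Rm x q \<oplus>\<^bsub>P\<^esub> Rm z r \<in> PF (Suc n)"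
  shows "\<exists>\<alpha>\<in>PF n. \<exists>\<beta>\<in>PF n. \<exists>\<gamma>\<in>PF n. p \<ominus>\<^bsub>P\<^esub> Rm z \<gamma> \<in> PF n \<and>
    q \<ominus>\<^bsub>P\<^esub> (Rm u \<alpha> \<ominus>\<^bsub>P\<^esub> Rm z \<gamma>) \<in> PF n \<and> r \<ominus>\<^bsub>P\<^esub> Rm x \<beta> \<in> PF n"
proof -
  \<comment> \<open>The last clause makes the coefficients zero off the common support of
    \<open>p\<close>, \<open>q\<close>, \<open>r\<close>; it secures the finite support of the
    chosen functions.\<close>
  define Q where "Q b \<alpha> \<beta> \<gamma> \<longleftrightarrow> \<alpha> \<in> filt n \<and> \<beta> \<in> filt n \<and> \<gamma> \<in> filt n \<and> p b \<ominus> \<gamma> \<otimes> z \<in> filt n \<and>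
    q b \<ominus> (\<alpha> \<otimes> u \<ominus> \<gamma> \<otimes> z) \<in> filt n \<and> r b \<ominus> \<beta> \<otimes> x \<in> filt n \<and>
    (p b = \<zero> \<and> q b = \<zero> \<and> r b = \<zero> \<longrightarrow> \<alpha> = \<zero> \<and> \<beta> = \<zero> \<and> \<gamma> = \<zero>)" for b \<alpha> \<beta> \<gamma>
  have "\<exists>\<alpha> \<beta> \<gamma>. Q b \<alpha> \<beta> \<gamma>" for b
  proof (cases "p b = \<zero> \<and> q b = \<zero> \<and> r b = \<zero>")
    case True
    then have "Q b \<zero> \<zero> \<zero>" by (simp add: Q_def zero_in_filt filt_minus)
    then show ?thesis by blast
  next
    case False
    have "p b \<otimes> u \<oplus> q b \<otimes> x \<oplus> r b \<otimes> z \<in> filt (Suc n)"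
      using s by (simp add: PF_def Rm_def free_module_simps(3))
    then show ?thesis using filt_syzygy[of "p b" n "q b" "r b"] p q r False
      unfolding Q_def PF_def by blast
  qed
  then obtain \<alpha> \<beta> \<gamma> where Q: "\<And>b. Q b (\<alpha> b) (\<beta> b) (\<gamma> b)" by metis
  define S where "S = {b. p b \<noteq> \<zero>} \<union> {b. q b \<noteq> \<zero>} \<union> {b. r b \<noteq> \<zero>}"
  have S: "finite S" "S \<subseteq> B" using p q r by (auto simp: S_def PF_def free_module_simps(1))
  have "{b. \<alpha> b \<noteq> \<zero>} \<subseteq> S" "{b. \<beta> b \<noteq> \<zero>} \<subseteq> S" "{b. \<gamma> b \<noteq> \<zero>} \<subseteq> S" using Q by (auto simp: S_def Q_def)
  then have c: "\<alpha> \<in> carrier P" "\<beta> \<in> carrier P" "\<gamma> \<in> carrier P"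
    using S Q filt_closed finite_subset unfolding free_module_simps(1) Q_def by blast+
  then have PF: "\<alpha> \<in> PF n" "\<beta> \<in> PF n" "\<gamma> \<in> PF n" using Q by (auto simp: PF_def Q_def)
  have e: "(p \<ominus>\<^bsub>P\<^esub> Rm z \<gamma>) b = p b \<ominus> \<gamma> b \<otimes> z"
    "(q \<ominus>\<^bsub>P\<^esub> (Rm u \<alpha> \<ominus>\<^bsub>P\<^esub> Rm z \<gamma>)) b = q b \<ominus> (\<alpha> b \<otimes> u \<ominus> \<gamma> b \<otimes> z)"
    "(r \<ominus>\<^bsub>P\<^esub> Rm x \<beta>) b = r b \<ominus> \<beta> b \<otimes> x" for b
  proof -
    have [simp]: "p \<in> carrier P" "q \<in> carrier P" "r \<in> carrier P" using p q r PF_closed by auto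
    have s: "(f \<ominus>\<^bsub>P\<^esub> g) b = f b \<ominus> g b" if "f \<in> carrier P" "g \<in> carrier P" for f g
      using that by (simp add: free_module_minus)
    show "(p \<ominus>\<^bsub>P\<^esub> Rm z \<gamma>) b = p b \<ominus> \<gamma> b \<otimes> z" "(r \<ominus>\<^bsub>P\<^esub> Rm x \<beta>) b = r b \<ominus> \<beta> b \<otimes> x"
      "(q \<ominus>\<^bsub>P\<^esub> (Rm u \<alpha> \<ominus>\<^bsub>P\<^esub> Rm z \<gamma>)) b = q b \<ominus> (\<alpha> b \<otimes> u \<ominus> \<gamma> b \<otimes> z)"
      using c by (simp_all add: s) (simp_all add: Rm_def)
  qed
  have "p \<ominus>\<^bsub>P\<^esub> Rm z \<gamma> \<in> PF n" "q \<ominus>\<^bsub>P\<^esub> (Rm u \<alpha> \<ominus>\<^bsub>P\<^esub> Rm z \<gamma>) \<in> PF n" "r \<ominus>\<^bsub>P\<^esub> Rm x \<beta> \<in> PF n"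
    using c p q r Q by (auto simp: PF_def e Q_def)
  then show ?thesis using PF by blast
qed

lemma exact_1:
  assumes "p \<in> carrier P" "q \<in> carrier P" "r \<in> carrier P" "D1 p q r = \<zero>\<^bsub>P\<^esub>"
  shows "\<exists>\<alpha>\<in>carrier P. \<exists>\<beta>\<in>carrier P. \<exists>\<gamma>\<in>carrier P. p = D2u \<alpha> \<gamma> \<and> q = D2x \<alpha> \<beta> \<gamma> \<and> r = D2z \<beta> \<gamma>"
proof -
  have "\<exists>\<alpha>\<in>carrier P. \<exists>\<beta>\<in>carrier P. \<exists>\<gamma>\<in>carrier P. p = D2u \<alpha> \<gamma> \<and> q = D2x \<alpha> \<beta> \<gamma> \<and> r = D2z \<beta> \<gamma>"
    if "p \<in> PF n" "q \<in> PF n" "r \<in> PF n" "D1 p q r = \<zero>\<^bsub>P\<^esub>" for n p q r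
    using that
  proof (induction n arbitrary: p q r)
    case 0
    then have "p = \<zero>\<^bsub>P\<^esub>" "q = \<zero>\<^bsub>P\<^esub>" "r = \<zero>\<^bsub>P\<^esub>" by (auto intro: PF_0)
    then show ?case by (intro bexI[of _ "\<zero>\<^bsub>P\<^esub>"]) auto
  next
    case (Suc n)
    have [simp]: "p \<in> carrier P" "q \<in> carrier P" "r \<in> carrier P" using Suc.prems PF_closed by auto
    \<comment> \<open>\<open>D1 = 0\<close> equates the products with the terms that act on
      \<open>M\<close>, which stay within the degree bound. So the products cancel in top degree,
      and this is the hypothesis of \<open>PF_syzygy\<close>.\<close>
    have "Rm u p \<oplus>\<^bsub>P\<^esub> Rm x q \<oplus>\<^bsub>P\<^esub> Rm z r = Lm u p \<oplus>\<^bsub>P\<^esub> Lm x q \<oplus>\<^bsub>P\<^esub> Lm z r"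
      using Suc.prems(4) unfolding D1_def by (simp add: P.M.diff_simps)
    also have "\<dots> \<in> PF (Suc n)" by (intro PF_add PF_Lm Suc.prems) auto
    finally obtain \<alpha> \<beta> \<gamma> where a: "\<alpha> \<in> PF n" "\<beta> \<in> PF n" "\<gamma> \<in> PF n"
      and b: "p \<ominus>\<^bsub>P\<^esub> Rm z \<gamma> \<in> PF n" "q \<ominus>\<^bsub>P\<^esub> (Rm u \<alpha> \<ominus>\<^bsub>P\<^esub> Rm z \<gamma>) \<in> PF n" "r \<ominus>\<^bsub>P\<^esub> Rm x \<beta> \<in> PF n"
      using PF_syzygy[OF Suc.prems(1-3)] by blast
    have [simp]: "\<alpha> \<in> carrier P" "\<beta> \<in> carrier P" "\<gamma> \<in> carrier P" using a PF_closed by auto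
    \<comment> \<open>The boundary splits into right multiplications, whose subtraction lowers the
      degree bound, and an \<open>Lm\<close> term, which lies in \<open>PF n\<close> because
      \<alpha>, \<beta>, \<gamma> do.\<close>
    have e: "p \<ominus>\<^bsub>P\<^esub> D2u \<alpha> \<gamma> = (p \<ominus>\<^bsub>P\<^esub> Rm z \<gamma>) \<ominus>\<^bsub>P\<^esub> Lm x \<alpha>"
      "q \<ominus>\<^bsub>P\<^esub> D2x \<alpha> \<beta> \<gamma> = (q \<ominus>\<^bsub>P\<^esub> (Rm u \<alpha> \<ominus>\<^bsub>P\<^esub> Rm z \<gamma>)) \<ominus>\<^bsub>P\<^esub> Lm z \<beta>"
      "r \<ominus>\<^bsub>P\<^esub> D2z \<beta> \<gamma> = (r \<ominus>\<^bsub>P\<^esub> Rm x \<beta>) \<ominus>\<^bsub>P\<^esub> Lm y \<gamma>"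
      unfolding D2u_def D2x_def D2z_def by (simp_all add: P.M.diff_simps)
    have "p \<ominus>\<^bsub>P\<^esub> D2u \<alpha> \<gamma> \<in> PF n" "q \<ominus>\<^bsub>P\<^esub> D2x \<alpha> \<beta> \<gamma> \<in> PF n" "r \<ominus>\<^bsub>P\<^esub> D2z \<beta> \<gamma> \<in> PF n"
      unfolding e by (intro PF_minus PF_Lm a b; simp)+
    moreover have "D1 (p \<ominus>\<^bsub>P\<^esub> D2u \<alpha> \<gamma>) (q \<ominus>\<^bsub>P\<^esub> D2x \<alpha> \<beta> \<gamma>) (r \<ominus>\<^bsub>P\<^esub> D2z \<beta> \<gamma>) = \<zero>\<^bsub>P\<^esub>"
      by (simp add: D1_minus D1_D2 Suc.prems(4)) (simp add: P.M.minus_eq)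
    ultimately obtain \<alpha>' \<beta>' \<gamma>' where c [simp]: "\<alpha>' \<in> carrier P" "\<beta>' \<in> carrier P" "\<gamma>' \<in> carrier P"
      and d: "p \<ominus>\<^bsub>P\<^esub> D2u \<alpha> \<gamma> = D2u \<alpha>' \<gamma>'" "q \<ominus>\<^bsub>P\<^esub> D2x \<alpha> \<beta> \<gamma> = D2x \<alpha>' \<beta>' \<gamma>'" "r \<ominus>\<^bsub>P\<^esub> D2z \<beta> \<gamma> = D2z \<beta>' \<gamma>'"
      using Suc.IH by blast
    have "p = D2u (\<alpha>' \<oplus>\<^bsub>P\<^esub> \<alpha>) (\<gamma>' \<oplus>\<^bsub>P\<^esub> \<gamma>)" "q = D2x (\<alpha>' \<oplus>\<^bsub>P\<^esub> \<alpha>) (\<beta>' \<oplus>\<^bsub>P\<^esub> \<beta>) (\<gamma>' \<oplus>\<^bsub>P\<^esub> \<gamma>)"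
      "r = D2z (\<beta>' \<oplus>\<^bsub>P\<^esub> \<beta>) (\<gamma>' \<oplus>\<^bsub>P\<^esub> \<gamma>)"
      using d by (simp_all add: D2_add P.M.diff_eq_eq)
    then show ?case
      by (intro bexI[of _ "\<alpha>' \<oplus>\<^bsub>P\<^esub> \<alpha>"] bexI[of _ "\<beta>' \<oplus>\<^bsub>P\<^esub> \<beta>"] bexI[of _ "\<gamma>' \<oplus>\<^bsub>P\<^esub> \<gamma>"]) auto
  qed
  moreover obtain n1 n2 n3 where "p \<in> PF n1" "q \<in> PF n2" "r \<in> PF n3"
    using assms PF_exhaust by metis
  then have "p \<in> PF (max n1 (max n2 n3))" "q \<in> PF (max n1 (max n2 n3))" "r \<in> PF (max n1 (max n2 n3))"
    using PF_le[of _ "max n1 (max n2 n3)"] by (meson subsetD max.cobounded1 max.cobounded2 order_trans)+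
  ultimately show ?thesis using assms(4) by blast
qed

end

section \<open>The image of the first differential\<close>

context uxz_module
begin

lemma D1_add:
  "\<lbrakk>p \<in> carrier P; q \<in> carrier P; r \<in> carrier P; p' \<in> carrier P; q' \<in> carrier P; r' \<in> carrier P\<rbrakk> \<Longrightarrow>
    D1 (p \<oplus>\<^bsub>P\<^esub> p') (q \<oplus>\<^bsub>P\<^esub> q') (r \<oplus>\<^bsub>P\<^esub> r') = D1 p q r \<oplus>\<^bsub>P\<^esub> D1 p' q' r'"
  unfolding D1_def by (simp add: RL_simps P.M.diff_simps)

definition W :: "('m \<Rightarrow> 'a) set" where
  "W = {D1 p q r | p q r. p \<in> carrier P \<and> q \<in> carrier P \<and> r \<in> carrier P}"

lemma W_add: "\<lbrakk>f \<in> W; g \<in> W\<rbrakk> \<Longrightarrow> f \<oplus>\<^bsub>P\<^esub> g \<in> W"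
  unfolding W_def by clarify (metis D1_add P.M.a_closed)

lemma W_zero: "\<zero>\<^bsub>P\<^esub> \<in> W"
proof -
  have "D1 \<zero>\<^bsub>P\<^esub> \<zero>\<^bsub>P\<^esub> \<zero>\<^bsub>P\<^esub> = \<zero>\<^bsub>P\<^esub>" by (simp add: D1_def RL_simps P.M.minus_zero_right)
  then show ?thesis unfolding W_def by (metis (mono_tags, lifting) P.M.zero_closed mem_Collect_eq)
qed

lemma W_diff:
  assumes [simp]: "f \<in> carrier P"
  shows "Rm u f \<ominus>\<^bsub>P\<^esub> Lm u f \<in> W" "Rm x f \<ominus>\<^bsub>P\<^esub> Lm x f \<in> W" "Rm z f \<ominus>\<^bsub>P\<^esub> Lm z f \<in> W"
proof -
  have "D1 f \<zero>\<^bsub>P\<^esub> \<zero>\<^bsub>P\<^esub> = Rm u f \<ominus>\<^bsub>P\<^esub> Lm u f" "D1 \<zero>\<^bsub>P\<^esub> f \<zero>\<^bsub>P\<^esub> = Rm x f \<ominus>\<^bsub>P\<^esub> Lm x f"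
    "D1 \<zero>\<^bsub>P\<^esub> \<zero>\<^bsub>P\<^esub> f = Rm z f \<ominus>\<^bsub>P\<^esub> Lm z f"
    by (simp_all add: D1_def RL_simps P.M.minus_zero_right)
  then show "Rm u f \<ominus>\<^bsub>P\<^esub> Lm u f \<in> W" "Rm x f \<ominus>\<^bsub>P\<^esub> Lm x f \<in> W" "Rm z f \<ominus>\<^bsub>P\<^esub> Lm z f \<in> W"
    unfolding W_def using assms P.M.zero_closed by (metis (mono_tags, lifting) mem_Collect_eq)+
qed

text \<open>Modulo the image of \<open>D1\<close> ring elements can be moved across the tensor sign.
  The element \<open>a\<close> is expanded in \<open>u\<close>, \<open>x\<close>, \<open>z\<close>
  and its letters are moved one at a time, the last letter first; this changes \<open>m\<close>,
  hence the statement for all \<open>m\<close>.\<close>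

lemma smult_eta_mod_W:
  assumes "a \<in> filt n" "m \<in> carrier M"
  shows "a \<odot>\<^bsub>P\<^esub> \<eta> m \<ominus>\<^bsub>P\<^esub> \<eta> (a \<odot>\<^bsub>M\<^esub> m) \<in> W"
  using assms
proof (induction n arbitrary: a m)
  case 0
  then have "a = \<zero>" by (simp add: filt_zero)
  then show ?case using 0 W_zero by (simp add: eta_closed eta_zero P.M.minus_zero_right)
next
  case (Suc n)
  note m [simp] = \<open>m \<in> carrier M\<close>
  obtain k a1 a2 a3 where k: "k \<in> K" and a: "a1 \<in> filt n" "a2 \<in> filt n" "a3 \<in> filt n"
    and e: "a = k \<oplus> a1 \<otimes> u \<oplus> a2 \<otimes> x \<oplus> a3 \<otimes> z"
    using filt_expand[OF Suc.prems(1)] by blast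
  have [simp]: "k \<in> carrier R" "a1 \<in> carrier R" "a2 \<in> carrier R" "a3 \<in> carrier R"
    using a k K_carrier filt_closed by auto
  note [simp] = eta_closed P.smult_closed M.smult_closed
  \<comment> \<open>Two moves: \<open>cg \<otimes> m\<close> to \<open>c \<otimes> gm\<close> by a
    value of \<open>D1\<close>, then to \<open>1 \<otimes> cgm\<close> by the induction hypothesis
    for \<open>gm\<close>.\<close>
  have *: "(c \<otimes> g) \<odot>\<^bsub>P\<^esub> \<eta> m \<ominus>\<^bsub>P\<^esub> \<eta> ((c \<otimes> g) \<odot>\<^bsub>M\<^esub> m) \<in> W"
    if c: "c \<in> filt n" and g [simp]: "g \<in> carrier R"
      and W: "\<And>f. f \<in> carrier P \<Longrightarrow> Rm g f \<ominus>\<^bsub>P\<^esub> Lm g f \<in> W" for c g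
  proof -
    have [simp]: "c \<in> carrier R" using c filt_closed by auto
    have "Rm g (c \<odot>\<^bsub>P\<^esub> \<eta> m) \<ominus>\<^bsub>P\<^esub> Lm g (c \<odot>\<^bsub>P\<^esub> \<eta> m) \<in> W" using W by simp
    then have "(c \<otimes> g) \<odot>\<^bsub>P\<^esub> \<eta> m \<ominus>\<^bsub>P\<^esub> c \<odot>\<^bsub>P\<^esub> \<eta> (g \<odot>\<^bsub>M\<^esub> m) \<in> W"
      by (simp add: lmod_hom_smult[OF Rm_hom] lmod_hom_smult[OF Lm_hom] Rm_eta Lm_eta P.smult_assoc)
    moreover have "c \<odot>\<^bsub>P\<^esub> \<eta> (g \<odot>\<^bsub>M\<^esub> m) \<ominus>\<^bsub>P\<^esub> \<eta> (c \<odot>\<^bsub>M\<^esub> (g \<odot>\<^bsub>M\<^esub> m)) \<in> W"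
      using c by (intro Suc.IH) auto
    ultimately have "((c \<otimes> g) \<odot>\<^bsub>P\<^esub> \<eta> m \<ominus>\<^bsub>P\<^esub> c \<odot>\<^bsub>P\<^esub> \<eta> (g \<odot>\<^bsub>M\<^esub> m)) \<oplus>\<^bsub>P\<^esub>
        (c \<odot>\<^bsub>P\<^esub> \<eta> (g \<odot>\<^bsub>M\<^esub> m) \<ominus>\<^bsub>P\<^esub> \<eta> (c \<odot>\<^bsub>M\<^esub> (g \<odot>\<^bsub>M\<^esub> m))) \<in> W" by (rule W_add)
    moreover have "((c \<otimes> g) \<odot>\<^bsub>P\<^esub> \<eta> m \<ominus>\<^bsub>P\<^esub> c \<odot>\<^bsub>P\<^esub> \<eta> (g \<odot>\<^bsub>M\<^esub> m)) \<oplus>\<^bsub>P\<^esub>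
        (c \<odot>\<^bsub>P\<^esub> \<eta> (g \<odot>\<^bsub>M\<^esub> m) \<ominus>\<^bsub>P\<^esub> \<eta> (c \<odot>\<^bsub>M\<^esub> (g \<odot>\<^bsub>M\<^esub> m)))
      = (c \<otimes> g) \<odot>\<^bsub>P\<^esub> \<eta> m \<ominus>\<^bsub>P\<^esub> \<eta> ((c \<otimes> g) \<odot>\<^bsub>M\<^esub> m)"
      by (simp add: M.smult_assoc P.M.diff_simps)
    ultimately show ?thesis by simp
  qed
  define T where "T c = c \<odot>\<^bsub>P\<^esub> \<eta> m \<ominus>\<^bsub>P\<^esub> \<eta> (c \<odot>\<^bsub>M\<^esub> m)" for c
  have T: "T (c \<oplus> c') = T c \<oplus>\<^bsub>P\<^esub> T c'" if [simp]: "c \<in> carrier R" "c' \<in> carrier R" for c c'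
    by (simp add: T_def P.smult_l_distr M.smult_l_distr eta_add P.M.diff_simps)
  have "T k = \<zero>\<^bsub>P\<^esub>" using k by (simp add: T_def eta_smult P.M.minus_eq P.M.r_neg)
  then have "T k \<in> W" using W_zero by simp
  moreover have "T (a1 \<otimes> u) \<in> W" "T (a2 \<otimes> x) \<in> W" "T (a3 \<otimes> z) \<in> W"
    unfolding T_def using a by (auto intro!: * W_diff)
  ultimately have "T a \<in> W" unfolding e by (simp add: T W_add)
  then show ?case by (simp add: T_def)
qed

text \<open>Modulo the image of \<open>D1\<close> every \<open>f\<close> equals
  \<open>1 \<otimes> \<epsilon> f\<close>, which is zero on the kernel of
  \<open>\<epsilon>\<close>.\<close>

lemma exact_0:
  assumes "f \<in> carrier P" "\<epsilon> f = \<zero>\<^bsub>M\<^esub>"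
  shows "f \<in> W"
proof -
  have "f \<ominus>\<^bsub>P\<^esub> \<eta> (\<epsilon> f) \<in> W" using assms(1)
  proof (induction f rule: free_module_induct)
    case zero
    have "\<epsilon> \<zero>\<^bsub>P\<^esub> = \<zero>\<^bsub>M\<^esub>" by (rule lmod_hom_zero[OF P.left_module_axioms M.left_module_axioms eps_hom])
    then have "\<zero>\<^bsub>P\<^esub> \<ominus>\<^bsub>P\<^esub> \<eta> (\<epsilon> \<zero>\<^bsub>P\<^esub>) \<in> W" by (simp add: eta_zero P.M.minus_zero_right W_zero)
    then show ?case by (simp add: free_module_simps(2))
  next
    case (add a b f)
    note [simp] = add(1-3) eta_closed P.smult_closed M.smult_closed
    have [simp]: "b \<in> carrier M" using basis_carrier add(2) by auto
    have [simp]: "\<epsilon> f \<in> carrier M" by (intro lmod_hom_closed[OF eps_hom] add)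
    obtain n where "a \<in> filt n" using filt_exhaust[OF add(1)] by blast
    then have "(a \<odot>\<^bsub>P\<^esub> \<eta> b \<ominus>\<^bsub>P\<^esub> \<eta> (a \<odot>\<^bsub>M\<^esub> b)) \<oplus>\<^bsub>P\<^esub> (f \<ominus>\<^bsub>P\<^esub> \<eta> (\<epsilon> f)) \<in> W"
      by (intro W_add add(5) smult_eta_mod_W) auto
    also have "(a \<odot>\<^bsub>P\<^esub> \<eta> b \<ominus>\<^bsub>P\<^esub> \<eta> (a \<odot>\<^bsub>M\<^esub> b)) \<oplus>\<^bsub>P\<^esub> (f \<ominus>\<^bsub>P\<^esub> \<eta> (\<epsilon> f))
      = (a \<odot>\<^bsub>P\<^esub> \<eta> b \<oplus>\<^bsub>P\<^esub> f) \<ominus>\<^bsub>P\<^esub> \<eta> (a \<odot>\<^bsub>M\<^esub> b \<oplus>\<^bsub>M\<^esub> \<epsilon> f)"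
      by (simp add: eta_add P.M.diff_simps)
    also have "a \<odot>\<^bsub>M\<^esub> b \<oplus>\<^bsub>M\<^esub> \<epsilon> f = \<epsilon> (a \<odot>\<^bsub>P\<^esub> unit_vec b \<oplus>\<^bsub>P\<^esub> f)"
      by (simp add: lmod_hom_add[OF eps_hom] lmod_hom_smult[OF eps_hom] eps_unit_vec)
    finally show ?case by (simp add: eta_basis)
  qed
  then show ?thesis using assms by (simp add: eta_zero P.M.minus_zero_right)
qed

end

lemma (in abelian_group) uminus_zero: "\<ominus> \<zero> = \<zero>"
  by (rule minus_equality) auto

section \<open>The resolution on the prescribed index type\<close>

context uxz_module
begin

text \<open>The direct sum of \<open>n\<close> copies of \<open>P\<close>, realised on the index type of
  \<^const>\<open>has_projective_resolution\<close>: a list of length \<open>k + 1\<close> stands for the \<open>k\<close>-th copy.\<close>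

definition idx :: "nat \<Rightarrow> ('m \<times> 'a) list set" where
  "idx n = {replicate (Suc k) (b, undefined) | k b. k < n \<and> b \<in> B}"

abbreviation BP :: "nat \<Rightarrow> ('a, ('m \<times> 'a) list \<Rightarrow> 'a) module" where
  "BP n \<equiv> free_module R (idx n)"

definition pr :: "nat \<Rightarrow> (('m \<times> 'a) list \<Rightarrow> 'a) \<Rightarrow> 'm \<Rightarrow> 'a" where
  "pr k F = (\<lambda>b. if b \<in> B then F (replicate (Suc k) (b, undefined)) else \<zero>)"

text \<open>Lists in \<open>idx n\<close> are nonempty, so \<open>hd\<close> finds the basis element
  also in copy \<open>0\<close>; the length minus one is the number of the copy.\<close>

definition tup :: "nat \<Rightarrow> (nat \<Rightarrow> 'm \<Rightarrow> 'a) \<Rightarrow> ('m \<times> 'a) list \<Rightarrow> 'a" where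
  "tup n h = (\<lambda>l. if l \<in> idx n then h (length l - 1) (fst (hd l)) else \<zero>)"

lemma idx_iff: "l \<in> idx n \<longleftrightarrow> (\<exists>k b. k < n \<and> b \<in> B \<and> l = replicate (Suc k) (b, undefined))"
  by (auto simp: idx_def)

lemma replicate_idx: "\<lbrakk>k < n; b \<in> B\<rbrakk> \<Longrightarrow> (b, undefined) # replicate k (b, undefined) \<in> idx n"
  unfolding idx_iff by (intro exI[of _ k] exI[of _ b]) simp

lemma pr_hom: "pr k \<in> lmod_hom R (BP n) P"
proof (rule lmod_homI)
  fix F assume F: "F \<in> carrier (BP n)"
  have "{b. pr k F b \<noteq> \<zero>} \<subseteq> (fst \<circ> hd) ` {l. F l \<noteq> \<zero>}"
    by (rule subsetI, rule_tac x = "replicate (Suc k) (x, undefined)" in rev_image_eqI)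
      (auto simp: pr_def split: if_splits)
  moreover have "finite {l. F l \<noteq> \<zero>}" using F by (simp add: free_module_simps)
  ultimately have "finite {b. pr k F b \<noteq> \<zero>}" by (meson finite_surj)
  then show "pr k F \<in> carrier P" using F by (simp add: free_module_simps(1)[of _ R B]) (simp add: pr_def)
qed (auto simp: pr_def free_module_simps(2-))

lemmas pr_closed = lmod_hom_closed[OF pr_hom]

lemma tup_closed:
  assumes "\<And>k. k < n \<Longrightarrow> h k \<in> carrier P"
  shows "tup n h \<in> carrier (BP n)"
proof -
  have "{l. tup n h l \<noteq> \<zero>} \<subseteq> (\<lambda>(k, b). replicate (Suc k) (b, undefined)) ` (SIGMA k:{..<n}. {b. h k b \<noteq> \<zero>})"
  proof
    fix l assume l: "l \<in> {l. tup n h l \<noteq> \<zero>}"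
    then obtain k b where kb: "k < n" "b \<in> B" "l = replicate (Suc k) (b, undefined)"
      by (auto simp: tup_def idx_iff split: if_splits)
    then have "h k b \<noteq> \<zero>" using l replicate_idx[of k n b] by (simp add: tup_def)
    then show "l \<in> (\<lambda>(k, b). replicate (Suc k) (b, undefined)) ` (SIGMA k:{..<n}. {b. h k b \<noteq> \<zero>})"
      using kb by (intro rev_image_eqI[of "(k, b)"]) auto
  qed
  moreover have "finite (SIGMA k:{..<n}. {b. h k b \<noteq> \<zero>})"
    using assms by (intro finite_SigmaI) (auto simp: free_module_simps)
  ultimately have "finite {l. tup n h l \<noteq> \<zero>}" by (meson finite_surj)
  moreover have "tup n h l \<in> carrier R" if "l \<in> idx n" for l
    using that assms by (auto simp: tup_def idx_iff intro!: free_module_app[of _ B])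
  ultimately show ?thesis by (simp add: free_module_simps(1)) (simp add: tup_def)
qed

lemma pr_tup:
  assumes "k < n" "h k \<in> carrier P"
  shows "pr k (tup n h) = h k"
  using assms by (auto simp: pr_def tup_def replicate_idx fun_eq_iff free_module_simps)

lemma tup_pr:
  assumes "F \<in> carrier (BP n)"
  shows "tup n (\<lambda>k. pr k F) = F"
  using assms by (auto simp: tup_def pr_def fun_eq_iff free_module_simps idx_iff)

lemma tup_cong: "(\<And>k. k < n \<Longrightarrow> h k = h' k) \<Longrightarrow> tup n h = tup n h'"
  by (auto simp: tup_def fun_eq_iff idx_iff)

lemma tup_eq_iff:
  assumes "\<And>k. k < n \<Longrightarrow> h k \<in> carrier P" "\<And>k. k < n \<Longrightarrow> h' k \<in> carrier P"
  shows "tup n h = tup n h' \<longleftrightarrow> (\<forall>k<n. h k = h' k)"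
  using pr_tup assms tup_cong by metis

lemma zero_eq_tup: "\<zero>\<^bsub>BP n\<^esub> = tup n (\<lambda>k. \<zero>\<^bsub>P\<^esub>)"
  by (auto simp: free_module_simps tup_def)

lemma tup_hom:
  assumes "\<And>k. k < n \<Longrightarrow> (\<lambda>F. h F k) \<in> lmod_hom R N P"
  shows "(\<lambda>F. tup n (h F)) \<in> lmod_hom R N (BP n)"
proof (rule lmod_homI)
  fix F assume F: "F \<in> carrier N"
  show "tup n (h F) \<in> carrier (BP n)"
    using lmod_hom_closed[OF assms F] by (rule tup_closed)
next
  fix F G assume "F \<in> carrier N" "G \<in> carrier N"
  then have "tup n (h (F \<oplus>\<^bsub>N\<^esub> G)) = tup n (\<lambda>k. h F k \<oplus>\<^bsub>P\<^esub> h G k)"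
    using lmod_hom_add[OF assms] by (intro tup_cong) auto
  then show "tup n (h (F \<oplus>\<^bsub>N\<^esub> G)) = tup n (h F) \<oplus>\<^bsub>BP n\<^esub> tup n (h G)"
    by (auto simp: free_module_simps(2-) tup_def)
next
  fix a F assume a: "a \<in> carrier R" and "F \<in> carrier N"
  then have "tup n (h (a \<odot>\<^bsub>N\<^esub> F)) = tup n (\<lambda>k. a \<odot>\<^bsub>P\<^esub> h F k)"
    using lmod_hom_smult[OF assms] by (intro tup_cong) auto
  then show "tup n (h (a \<odot>\<^bsub>N\<^esub> F)) = a \<odot>\<^bsub>BP n\<^esub> tup n (h F)"
    using a by (auto simp: free_module_simps(2-) tup_def)
qed

text \<open>The number of chains of each length: the empty chain; \<open>u\<close>,
  \<open>x\<close>, \<open>z\<close>; \<open>ux\<close>, \<open>xz\<close>, \<open>zy\<close>;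
  \<open>uxz\<close>, \<open>xzy\<close>; \<open>uxzy\<close>. From index five on the complex is
  zero.\<close>

definition rk :: "nat \<Rightarrow> nat" where
  "rk i = (if i = 0 then 1 else if i = 1 then 3 else if i = 2 then 3 else if i = 3 then 2 else
     if i = 4 then 1 else 0)"

definition d0 where
  "d0 F = tup 1 (\<lambda>k. D1 (pr 0 F) (pr 1 F) (pr 2 F))"

definition d1 where
  "d1 F = tup 3 (\<lambda>k. if k = 0 then D2u (pr 0 F) (pr 2 F)
     else if k = 1 then D2x (pr 0 F) (pr 1 F) (pr 2 F) else D2z (pr 1 F) (pr 2 F))"

text \<open>The components of \<open>F\<close> belong to \<open>uxz\<close> and \<open>xzy\<close>.
  Cutting off the first letter gives a right multiplication, cutting off the last one an operator on
  \<open>M\<close>, here with the sign \<open>-1\<close> of odd degree: \<open>uxz\<close> is sent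
  to \<open>u[xz] - [ux]z\<close>.\<close>

definition d2 where
  "d2 F = tup 3 (\<lambda>k. if k = 0 then \<ominus>\<^bsub>P\<^esub> Lm z (pr 0 F)
     else if k = 1 then Rm u (pr 0 F) \<ominus>\<^bsub>P\<^esub> Lm y (pr 1 F) else Rm x (pr 1 F))"

text \<open>The single component belongs to \<open>uxzy\<close>, which is sent to
  \<open>u[xzy] + [uxz]y\<close>; copy \<open>0\<close> is that of \<open>uxz\<close>.\<close>

definition d3 where
  "d3 F = tup 2 (\<lambda>k. if k = 0 then Lm y (pr 0 F) else Rm u (pr 0 F))"

definition dm :: "nat \<Rightarrow> (('m \<times> 'a) list \<Rightarrow> 'a) \<Rightarrow> ('m \<times> 'a) list \<Rightarrow> 'a" where
  "dm i = (if i = 0 then d0 else if i = 1 then d1 else if i = 2 then d2 else if i = 3 then d3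
     else (\<lambda>F l. \<zero>))"

lemma lmod_hom_if:
  "\<lbrakk>c \<Longrightarrow> f \<in> lmod_hom R N P; \<not> c \<Longrightarrow> g \<in> lmod_hom R N P\<rbrakk> \<Longrightarrow> (\<lambda>F. if c then f F else g F) \<in> lmod_hom R N P"
  by (cases c) auto

lemma d_hom:
  "d0 \<in> lmod_hom R (BP 3) (BP 1)" "d1 \<in> lmod_hom R (BP 3) (BP 3)" "d2 \<in> lmod_hom R (BP 2) (BP 3)"
  "d3 \<in> lmod_hom R (BP 1) (BP 2)"
proof -
  note * = P.lmod_hom_add_map P.lmod_hom_minus_map P.lmod_hom_uminus_map
    lmod_hom_comp[OF pr_hom Rm_hom] lmod_hom_comp[OF pr_hom Lm_hom]
  show "d0 \<in> lmod_hom R (BP 3) (BP 1)" unfolding d0_def D1_def by (intro tup_hom * gens)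
  show "d1 \<in> lmod_hom R (BP 3) (BP 3)" unfolding d1_def D2u_def D2x_def D2z_def
    by (intro tup_hom lmod_hom_if * gens y_closed)
  show "d2 \<in> lmod_hom R (BP 2) (BP 3)" unfolding d2_def
    by (intro tup_hom lmod_hom_if * gens y_closed)
  show "d3 \<in> lmod_hom R (BP 1) (BP 2)" unfolding d3_def
    by (intro tup_hom lmod_hom_if * gens y_closed)
qed

lemma left_module_BP: "left_module R (BP n)"
  by (rule left_module_free_module)

lemma less_3_iff: "(\<forall>k<3. Q k) \<longleftrightarrow> Q 0 \<and> Q 1 \<and> Q (2::nat)" and less_2_iff: "(\<forall>k<2. Q k) \<longleftrightarrow> Q 0 \<and> Q (1::nat)"
  by (auto simp: numeral_3_eq_3 numeral_2_eq_2 less_Suc_eq)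

lemma D_eq_0:
  "F \<in> carrier (BP 3) \<Longrightarrow> d0 F = \<zero>\<^bsub>BP 1\<^esub> \<longleftrightarrow> D1 (pr 0 F) (pr 1 F) (pr 2 F) = \<zero>\<^bsub>P\<^esub>"
  "F \<in> carrier (BP 3) \<Longrightarrow> d1 F = \<zero>\<^bsub>BP 3\<^esub> \<longleftrightarrow> D2u (pr 0 F) (pr 2 F) = \<zero>\<^bsub>P\<^esub> \<and>
     D2x (pr 0 F) (pr 1 F) (pr 2 F) = \<zero>\<^bsub>P\<^esub> \<and> D2z (pr 1 F) (pr 2 F) = \<zero>\<^bsub>P\<^esub>"
  "F \<in> carrier (BP 2) \<Longrightarrow> d2 F = \<zero>\<^bsub>BP 3\<^esub> \<longleftrightarrow> \<ominus>\<^bsub>P\<^esub> Lm z (pr 0 F) = \<zero>\<^bsub>P\<^esub> \<and>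
     Rm u (pr 0 F) \<ominus>\<^bsub>P\<^esub> Lm y (pr 1 F) = \<zero>\<^bsub>P\<^esub> \<and> Rm x (pr 1 F) = \<zero>\<^bsub>P\<^esub>"
  "F \<in> carrier (BP 1) \<Longrightarrow> d3 F = \<zero>\<^bsub>BP 2\<^esub> \<longleftrightarrow> Lm y (pr 0 F) = \<zero>\<^bsub>P\<^esub> \<and> Rm u (pr 0 F) = \<zero>\<^bsub>P\<^esub>"
proof -
  note [simp] = pr_closed[of _ 3] pr_closed[of _ 2] pr_closed[of _ 1]
  show "d0 F = \<zero>\<^bsub>BP 1\<^esub> \<longleftrightarrow> D1 (pr 0 F) (pr 1 F) (pr 2 F) = \<zero>\<^bsub>P\<^esub>" if "F \<in> carrier (BP 3)"
    unfolding zero_eq_tup d0_def using that by (subst tup_eq_iff) auto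
  show "d1 F = \<zero>\<^bsub>BP 3\<^esub> \<longleftrightarrow> D2u (pr 0 F) (pr 2 F) = \<zero>\<^bsub>P\<^esub> \<and>
     D2x (pr 0 F) (pr 1 F) (pr 2 F) = \<zero>\<^bsub>P\<^esub> \<and> D2z (pr 1 F) (pr 2 F) = \<zero>\<^bsub>P\<^esub>" if "F \<in> carrier (BP 3)"
    unfolding zero_eq_tup d1_def using that by (subst tup_eq_iff) (simp_all add: less_3_iff)
  show "d2 F = \<zero>\<^bsub>BP 3\<^esub> \<longleftrightarrow> \<ominus>\<^bsub>P\<^esub> Lm z (pr 0 F) = \<zero>\<^bsub>P\<^esub> \<and>
     Rm u (pr 0 F) \<ominus>\<^bsub>P\<^esub> Lm y (pr 1 F) = \<zero>\<^bsub>P\<^esub> \<and> Rm x (pr 1 F) = \<zero>\<^bsub>P\<^esub>" if "F \<in> carrier (BP 2)"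
    unfolding zero_eq_tup d2_def using that by (subst tup_eq_iff) (simp_all add: less_3_iff)
  show "d3 F = \<zero>\<^bsub>BP 2\<^esub> \<longleftrightarrow> Lm y (pr 0 F) = \<zero>\<^bsub>P\<^esub> \<and> Rm u (pr 0 F) = \<zero>\<^bsub>P\<^esub>" if "F \<in> carrier (BP 1)"
    unfolding zero_eq_tup d3_def using that by (subst tup_eq_iff) (simp_all add: less_2_iff)
qed

text \<open>Carries \<open>exact_0\<close> from triples of vectors over to the list-indexed modules;
  the next three lemmas do the same for \<open>exact_1\<close>, \<open>exact_2\<close> and
  \<open>exact_3\<close>.\<close>

lemma exact_d0:
  "d0 ` carrier (BP 3) = {F \<in> carrier (BP 1). \<epsilon> (pr 0 F) = \<zero>\<^bsub>M\<^esub>}"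
proof (intro equalityI subsetI)
  fix G assume "G \<in> d0 ` carrier (BP 3)"
  then obtain F where F: "F \<in> carrier (BP 3)" "G = d0 F" by auto
  have [simp]: "pr k F \<in> carrier P" for k using F pr_closed by auto
  have "\<epsilon> (Rm g f \<ominus>\<^bsub>P\<^esub> Lm g f) = \<zero>\<^bsub>M\<^esub>" if [simp]: "f \<in> carrier P" "g \<in> carrier R" for f g
    using lmod_hom_closed[OF eps_hom, of "Lm g f"]
    by (simp add: lmod_hom_minus[OF P.left_module_axioms M.left_module_axioms eps_hom] eps_Rm M.M.minus_eq M.M.r_neg)
  then have "\<epsilon> (D1 (pr 0 F) (pr 1 F) (pr 2 F)) = \<zero>\<^bsub>M\<^esub>"
    by (simp add: D1_def lmod_hom_add[OF eps_hom])
  moreover have "pr 0 G = D1 (pr 0 F) (pr 1 F) (pr 2 F)" unfolding F d0_def by (simp add: pr_tup)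
  ultimately show "G \<in> {F \<in> carrier (BP 1). \<epsilon> (pr 0 F) = \<zero>\<^bsub>M\<^esub>}"
    using lmod_hom_closed[OF d_hom(1) F(1)] F(2) by simp
next
  fix G assume "G \<in> {F \<in> carrier (BP 1). \<epsilon> (pr 0 F) = \<zero>\<^bsub>M\<^esub>}"
  then have G: "G \<in> carrier (BP 1)" "\<epsilon> (pr 0 G) = \<zero>\<^bsub>M\<^esub>" by auto
  from exact_0[OF pr_closed[OF G(1)] G(2)] obtain p q r where
    e: "pr 0 G = D1 p q r" and c: "p \<in> carrier P" "q \<in> carrier P" "r \<in> carrier P" by (auto simp: W_def)
  define F where "F = tup 3 (\<lambda>k. if k = 0 then p else if k = 1 then q else r)"
  have F: "F \<in> carrier (BP 3)" unfolding F_def using c by (intro tup_closed) auto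
  have "pr 0 F = p" "pr 1 F = q" "pr 2 F = r" unfolding F_def using c by (simp_all add: pr_tup)
  then have "d0 F = tup 1 (\<lambda>k. pr k G)" unfolding d0_def using e by (intro tup_cong) auto
  then have "G = d0 F" using tup_pr[OF G(1)] by simp
  then show "G \<in> d0 ` carrier (BP 3)" using F by blast
qed

lemma exact_d1:
  "d1 ` carrier (BP 3) = {F \<in> carrier (BP 3). d0 F = \<zero>\<^bsub>BP 1\<^esub>}"
proof (intro equalityI subsetI)
  fix G assume "G \<in> d1 ` carrier (BP 3)"
  then obtain F where F: "F \<in> carrier (BP 3)" "G = d1 F" by auto
  have [simp]: "pr k F \<in> carrier P" for k using F pr_closed by auto
  have "G \<in> carrier (BP 3)" using lmod_hom_closed[OF d_hom(2) F(1)] F(2) by simp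
  moreover have "pr 0 G = D2u (pr 0 F) (pr 2 F)" "pr 1 G = D2x (pr 0 F) (pr 1 F) (pr 2 F)"
    "pr 2 G = D2z (pr 1 F) (pr 2 F)" unfolding F d1_def by (simp_all add: pr_tup)
  ultimately show "G \<in> {F \<in> carrier (BP 3). d0 F = \<zero>\<^bsub>BP 1\<^esub>}"
    by (simp add: D_eq_0 D1_D2 del: One_nat_def)
next
  fix G assume "G \<in> {F \<in> carrier (BP 3). d0 F = \<zero>\<^bsub>BP 1\<^esub>}"
  then have G: "G \<in> carrier (BP 3)" "D1 (pr 0 G) (pr 1 G) (pr 2 G) = \<zero>\<^bsub>P\<^esub>" by (auto simp: D_eq_0 simp del: One_nat_def)
  note prG = pr_closed[OF G(1)]
  from exact_1[OF prG prG prG G(2)] obtain \<alpha> \<beta> \<gamma> where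
    e: "pr 0 G = D2u \<alpha> \<gamma>" "pr 1 G = D2x \<alpha> \<beta> \<gamma>" "pr 2 G = D2z \<beta> \<gamma>"
    and c: "\<alpha> \<in> carrier P" "\<beta> \<in> carrier P" "\<gamma> \<in> carrier P" by blast
  define F where "F = tup 3 (\<lambda>k. if k = 0 then \<alpha> else if k = 1 then \<beta> else \<gamma>)"
  have F: "F \<in> carrier (BP 3)" unfolding F_def using c by (intro tup_closed) auto
  have "pr 0 F = \<alpha>" "pr 1 F = \<beta>" "pr 2 F = \<gamma>" unfolding F_def using c by (simp_all add: pr_tup)
  then have "d1 F = tup 3 (\<lambda>k. pr k G)" unfolding d1_def
    by (intro tup_cong) (auto simp: e[symmetric] numeral_3_eq_3 numeral_2_eq_2 less_Suc_eq)
  then have "G = d1 F" using tup_pr[OF G(1)] by simp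
  then show "G \<in> d1 ` carrier (BP 3)" using F by blast
qed

lemma exact_d2:
  "d2 ` carrier (BP 2) = {F \<in> carrier (BP 3). d1 F = \<zero>\<^bsub>BP 3\<^esub>}"
proof (intro equalityI subsetI)
  fix G assume "G \<in> d2 ` carrier (BP 2)"
  then obtain F where F: "F \<in> carrier (BP 2)" "G = d2 F" by auto
  have [simp]: "pr k F \<in> carrier P" for k using F pr_closed by auto
  have "G \<in> carrier (BP 3)" using lmod_hom_closed[OF d_hom(3) F(1)] F(2) by simp
  moreover have "pr 0 G = \<ominus>\<^bsub>P\<^esub> Lm z (pr 0 F)" "pr 1 G = Rm u (pr 0 F) \<ominus>\<^bsub>P\<^esub> Lm y (pr 1 F)"
    "pr 2 G = Rm x (pr 1 F)" unfolding F d2_def by (simp_all add: pr_tup)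
  ultimately show "G \<in> {F \<in> carrier (BP 3). d1 F = \<zero>\<^bsub>BP 3\<^esub>}"
    by (simp add: D_eq_0 D2u_def D2x_def D2z_def RL_simps P.M.minus_eq P.M.l_neg P.M.r_neg P.M.uminus_zero del: One_nat_def)
next
  fix G assume "G \<in> {F \<in> carrier (BP 3). d1 F = \<zero>\<^bsub>BP 3\<^esub>}"
  then have G: "G \<in> carrier (BP 3)" "D2u (pr 0 G) (pr 2 G) = \<zero>\<^bsub>P\<^esub>"
     "D2x (pr 0 G) (pr 1 G) (pr 2 G) = \<zero>\<^bsub>P\<^esub>" "D2z (pr 1 G) (pr 2 G) = \<zero>\<^bsub>P\<^esub>" by (auto simp: D_eq_0 simp del: One_nat_def)
  note prG = pr_closed[OF G(1)]
  from exact_2[OF prG prG prG G(2-4)] obtain p q where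
    e: "pr 0 G = \<ominus>\<^bsub>P\<^esub> Lm z p" "pr 1 G = Rm u p \<ominus>\<^bsub>P\<^esub> Lm y q" "pr 2 G = Rm x q"
    and c: "p \<in> carrier P" "q \<in> carrier P" by blast
  define F where "F = tup 2 (\<lambda>k. if k = 0 then p else q)"
  have F: "F \<in> carrier (BP 2)" unfolding F_def using c by (intro tup_closed) auto
  have "pr 0 F = p" "pr 1 F = q" unfolding F_def using c by (simp_all add: pr_tup)
  then have "d2 F = tup 3 (\<lambda>k. pr k G)" unfolding d2_def
    by (intro tup_cong) (auto simp: e[symmetric] numeral_3_eq_3 numeral_2_eq_2 less_Suc_eq)
  then have "G = d2 F" using tup_pr[OF G(1)] by simp
  then show "G \<in> d2 ` carrier (BP 2)" using F by blast
qed

lemma exact_d3: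
  "d3 ` carrier (BP 1) = {F \<in> carrier (BP 2). d2 F = \<zero>\<^bsub>BP 3\<^esub>}"
proof (intro equalityI subsetI)
  fix G assume "G \<in> d3 ` carrier (BP 1)"
  then obtain F where F: "F \<in> carrier (BP 1)" "G = d3 F" by auto
  have [simp]: "pr k F \<in> carrier P" for k using F pr_closed by auto
  have "G \<in> carrier (BP 2)" using lmod_hom_closed[OF d_hom(4) F(1)] F(2) by simp
  moreover have "pr 0 G = Lm y (pr 0 F)" "pr 1 G = Rm u (pr 0 F)"
    unfolding F d3_def by (simp_all add: pr_tup)
  ultimately show "G \<in> {F \<in> carrier (BP 2). d2 F = \<zero>\<^bsub>BP 3\<^esub>}"
    by (simp add: D_eq_0 RL_simps P.M.minus_eq P.M.r_neg del: One_nat_def)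
next
  fix G assume "G \<in> {F \<in> carrier (BP 2). d2 F = \<zero>\<^bsub>BP 3\<^esub>}"
  then have G: "G \<in> carrier (BP 2)"
     "Rm u (pr 0 G) \<ominus>\<^bsub>P\<^esub> Lm y (pr 1 G) = \<zero>\<^bsub>P\<^esub>" "Rm x (pr 1 G) = \<zero>\<^bsub>P\<^esub>" by (auto simp: D_eq_0 simp del: One_nat_def)
  note prG = pr_closed[OF G(1)]
  from exact_3[OF prG prG G(2-3)] obtain r where
    e: "pr 0 G = Lm y r" "pr 1 G = Rm u r" and c: "r \<in> carrier P" by blast
  define F where "F = tup 1 (\<lambda>k. r)"
  have F: "F \<in> carrier (BP 1)" unfolding F_def using c by (intro tup_closed) auto
  have "pr 0 F = r" unfolding F_def using c by (simp add: pr_tup)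
  then have "d3 F = tup 2 (\<lambda>k. pr k G)" unfolding d3_def
    by (intro tup_cong) (auto simp: e[symmetric] numeral_2_eq_2 less_Suc_eq)
  then have "G = d3 F" using tup_pr[OF G(1)] by simp
  then show "G \<in> d3 ` carrier (BP 1)" using F by blast
qed

lemma d3_inj:
  assumes "F \<in> carrier (BP 1)" "d3 F = \<zero>\<^bsub>BP 2\<^esub>" shows "F = \<zero>\<^bsub>BP 1\<^esub>"
proof -
  have "pr 0 F = \<zero>\<^bsub>P\<^esub>" using assms pr_closed[OF assms(1)] by - (rule Rm_u_inj, auto simp: D_eq_0)
  then have "tup 1 (\<lambda>k. pr k F) = tup 1 (\<lambda>k. \<zero>\<^bsub>P\<^esub>)" by (intro tup_cong) auto
  then show ?thesis using tup_pr[OF assms(1)] zero_eq_tup by simp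
qed

lemma BP_0: "carrier (BP 0) = {\<zero>\<^bsub>BP 0\<^esub>}"
  by (auto simp: free_module_simps idx_def)

theorem projective_resolution_BP:
  assumes "\<one> \<noteq> \<zero>"
  shows "projective_resolution R M (\<lambda>i. BP (rk i)) (\<lambda>F. \<epsilon> (pr 0 F)) dm"
  unfolding projective_resolution_def
proof (intro conjI allI)
  show "projective R (BP (rk i))" for i by (rule projective_free_module[OF assms])
  show "(\<lambda>F. \<epsilon> (pr 0 F)) \<in> lmod_hom R (BP (rk 0)) M"
    by (rule lmod_hom_comp[OF pr_hom eps_hom])
  show "dm i \<in> lmod_hom R (BP (rk (Suc i))) (BP (rk i))" for i
  proof -
    have z: "(\<lambda>F l. \<zero>) \<in> lmod_hom R N (BP n)" if "left_module R N" for N :: "('a, 'n) module" and n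
      using left_module.lmod_hom_zero_map[OF left_module_BP that, of n] by (simp add: free_module_simps)
    show ?thesis using d_hom by (simp add: dm_def rk_def z left_module_BP numeral_2_eq_2 numeral_3_eq_3)
  qed
  show "(\<lambda>F. \<epsilon> (pr 0 F)) ` carrier (BP (rk 0)) = carrier M"
  proof (intro equalityI subsetI)
    fix m assume m: "m \<in> carrier M"
    have "tup 1 (\<lambda>k. \<eta> m) \<in> carrier (BP (rk 0))" unfolding rk_def using eta_closed[OF m] by (auto intro: tup_closed)
    moreover have "\<epsilon> (pr 0 (tup 1 (\<lambda>k. \<eta> m))) = m" using m by (simp add: pr_tup eta_closed eta)
    ultimately show "m \<in> (\<lambda>F. \<epsilon> (pr 0 F)) ` carrier (BP (rk 0))" by (metis image_eqI)
  qed (auto intro!: lmod_hom_closed[OF eps_hom] pr_closed)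
  show "dm 0 ` carrier (BP (rk (Suc 0))) = a_kernel (BP (rk 0)) M (\<lambda>F. \<epsilon> (pr 0 F))"
    using exact_d0 by (simp add: dm_def rk_def a_kernel_def')
  show "dm (Suc i) ` carrier (BP (rk (Suc (Suc i)))) = a_kernel (BP (rk (Suc i))) (BP (rk i)) (dm i)" for i
  proof -
    consider "i = 0" | "i = 1" | "i = 2" | "i = 3" | "i > 3" by linarith
    then show ?thesis
    proof cases
      case 4
      have "{F \<in> carrier (BP 1). d3 F = \<zero>\<^bsub>BP 2\<^esub>} = {\<zero>\<^bsub>BP 1\<^esub>}"
      proof (intro equalityI subsetI)
        fix F assume "F \<in> {\<zero>\<^bsub>BP 1\<^esub>}"
        then show "F \<in> {F \<in> carrier (BP 1). d3 F = \<zero>\<^bsub>BP 2\<^esub>}"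
          using lmod_hom_zero[OF left_module_BP left_module_BP d_hom(4)] tup_closed[of 1 "\<lambda>k. \<zero>\<^bsub>P\<^esub>"]
          by (simp add: zero_eq_tup)
      qed (use d3_inj in blast)
      moreover have "dm 4 ` carrier (BP 0) = {\<zero>\<^bsub>BP 1\<^esub>}" unfolding BP_0 by (simp add: dm_def free_module_simps)
      ultimately show ?thesis using 4 by (simp add: dm_def rk_def a_kernel_def')
    next
      case 5
      have "dm (Suc i) ` carrier (BP 0) = {\<zero>\<^bsub>BP 0\<^esub>}" unfolding BP_0 using 5 by (simp add: dm_def free_module_simps)
      moreover have "a_kernel (BP (rk (Suc i))) (BP (rk i)) (dm i) = {\<zero>\<^bsub>BP 0\<^esub>}"
        using 5 BP_0 by (auto simp: dm_def rk_def a_kernel_def' free_module_simps)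
      ultimately show ?thesis using 5 by (simp add: rk_def)
    qed (use exact_d1 exact_d2 exact_d3 in \<open>simp_all add: dm_def rk_def a_kernel_def' numeral_2_eq_2[symmetric] numeral_3_eq_3[symmetric]\<close>)
  qed
qed

lemma has_resolution_4:
  assumes "\<one> \<noteq> \<zero>"
  shows "has_projective_resolution R M 4"
  unfolding has_projective_resolution_iff
  using projective_resolution_BP[OF assms] BP_0
  by (intro exI[of _ "\<lambda>i. BP (rk i)"] exI[of _ "\<lambda>F. \<epsilon> (pr 0 F)"] exI[of _ dm]) (auto simp: rk_def)

text \<open>A resolution of length three would make the last differential, multiplication by \<open>u\<close>, split.\<close>

lemma no_resolution_3:
  assumes one: "\<one> \<noteq> \<zero>" and nz: "carrier M \<noteq> {\<zero>\<^bsub>M\<^esub>}"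
    and act: "\<And>m. m \<in> carrier M \<Longrightarrow> y \<odot>\<^bsub>M\<^esub> m = \<zero>\<^bsub>M\<^esub>"
    and nu: "\<And>a. a \<in> carrier R \<Longrightarrow> u \<otimes> a \<noteq> \<one>" and n: "n \<le> 3"
  shows "\<not> has_projective_resolution R M n"
proof
  assume "has_projective_resolution R M n"
  then obtain Q :: "nat \<Rightarrow> ('a, ('m \<times> 'a) list \<Rightarrow> 'a) module" and \<epsilon>' d' where
    Q': "projective_resolution R M Q \<epsilon>' d' \<and> (\<forall>i>n. carrier (Q i) = {\<zero>\<^bsub>Q i\<^esub>})"
    unfolding has_projective_resolution_iff by (elim exE)
  then have Q: "projective_resolution R M Q \<epsilon>' d'" "\<And>i. i > n \<Longrightarrow> carrier (Q i) = {\<zero>\<^bsub>Q i\<^esub>}"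
    by simp_all
  have P5: "carrier (BP (rk (Suc (Suc 3)))) = {\<zero>\<^bsub>BP (rk (Suc (Suc 3)))\<^esub>}" using BP_0 by (simp add: rk_def)
  have Q4: "carrier (Q (Suc 3)) = {\<zero>\<^bsub>Q (Suc 3)\<^esub>}" using Q(2)[of "Suc 3"] n by simp
  note shorter_resolution_splits[OF M.left_module_axioms projective_resolution_BP[OF one] Q(1) P5 Q4]
  then obtain h where h: "h \<in> lmod_hom R (BP 2) (BP 1)" "\<And>F. F \<in> carrier (BP 1) \<Longrightarrow> h (d3 F) = \<ominus>\<^bsub>BP 1\<^esub> F"
    by (auto simp: rk_def dm_def)
  have "B \<noteq> {}"
  proof
    assume "B = {}"
    then have "\<eta> m = \<zero>\<^bsub>P\<^esub>" if "m \<in> carrier M" for m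
      using eta_closed[OF that] by (auto simp: free_module_simps)
    then have "m = \<zero>\<^bsub>M\<^esub>" if "m \<in> carrier M" for m
      using eta(2)[OF that] that lmod_hom_zero[OF P.left_module_axioms M.left_module_axioms eps_hom] by simp
    then show False using nz by auto
  qed
  then obtain b where b: "b \<in> B" by blast
  then have bM: "b \<in> carrier M" using basis_carrier by auto
  let ?e = "unit_vec b" and ?l = "replicate (Suc 0) (b, undefined)"
  define F where "F = tup 1 (\<lambda>k. ?e)"
  define G where "G = tup 2 (\<lambda>k. if k = 0 then \<zero>\<^bsub>P\<^esub> else ?e)"
  have F: "F \<in> carrier (BP 1)" and G: "G \<in> carrier (BP 2)" unfolding F_def G_def using b by (auto intro!: tup_closed)
  have prF: "pr 0 F = ?e" unfolding F_def using b by (simp add: pr_tup)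
  \<comment> \<open>The hypothesis on \<open>y\<close> removes the component in copy
    \<open>0\<close>. On a unit vector, right multiplication by \<open>u\<close> is also the scalar
    action of \<open>u\<close>, so \<open>d3 F\<close> is \<open>u\<close> times \<open>G\<close>
    and the linearity of \<open>h\<close> applies.\<close>
  have "Lm y ?e = \<zero>\<^bsub>P\<^esub>" using b bM act by (simp add: Lm_unit_vec eta_zero)
  moreover have "Rm u ?e = u \<odot>\<^bsub>P\<^esub> ?e" by (auto simp: Rm_def unit_vec_def free_module_simps)
  ultimately have "d3 F = tup 2 (\<lambda>k. u \<odot>\<^bsub>P\<^esub> (if k = 0 then \<zero>\<^bsub>P\<^esub> else ?e))"
    unfolding d3_def prF by (intro tup_cong) auto
  also have "\<dots> = u \<odot>\<^bsub>BP 2\<^esub> G" unfolding G_def by (auto simp: tup_def free_module_simps)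
  finally have "\<ominus>\<^bsub>BP 1\<^esub> F = u \<odot>\<^bsub>BP 1\<^esub> h G" using h(2)[OF F] lmod_hom_smult[OF h(1)] G by simp
  \<comment> \<open>Reading the entry at \<open>?l\<close>, where \<open>F\<close> is
    \<open>\<one>\<close>, turns the splitting into \<open>u a = \<one>\<close> with
    \<open>a = - h G ?l\<close>.\<close>
  then have "(\<ominus>\<^bsub>BP 1\<^esub> F) ?l = u \<otimes> h G ?l" by (simp add: free_module_simps(4))
  moreover have "F ?l = \<one>" using b replicate_idx[of 0 1 b] by (simp add: F_def tup_def unit_vec_def)
  ultimately have "\<ominus> \<one> = u \<otimes> h G ?l" using F by (simp add: free_module_uminus)
  moreover have c: "h G ?l \<in> carrier R" using free_module_app[OF lmod_hom_closed[OF h(1) G]] .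
  ultimately have "u \<otimes> (\<ominus> h G ?l) = \<ominus> (\<ominus> \<one>)" by (simp only: r_minus gens)
  then have "u \<otimes> (\<ominus> h G ?l) = \<one>" by simp
  then show False using nu[of "\<ominus> h G ?l"] c by simp
qed

end

section \<open>The free algebra and its quotients\<close>

abbreviation q :: "nat \<Rightarrow> (nat list \<Rightarrow> 'k::field) set \<Rightarrow> (nat list \<Rightarrow> 'k) \<Rightarrow> (nat list \<Rightarrow> 'k) set" where
  "q n I f \<equiv> I +>\<^bsub>free_algebra n\<^esub> f"

definition word_vec :: "nat list \<Rightarrow> nat list \<Rightarrow> 'k::field" where
  "word_vec w = (\<lambda>v. if v = w then 1 else 0)"

lemma free_algebra_carrier:
  "f \<in> carrier (free_algebra n) \<longleftrightarrow> finite {w. f w \<noteq> 0} \<and> (\<forall>w. f w \<noteq> 0 \<longrightarrow> set w \<subseteq> {..<n})"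
  by (simp add: free_algebra_def)

lemma free_algebra_simps:
  "f \<oplus>\<^bsub>free_algebra n\<^esub> g = (\<lambda>w. f w + g w)"
  "\<zero>\<^bsub>free_algebra n\<^esub> = (\<lambda>w. 0)"
  "\<one>\<^bsub>free_algebra n\<^esub> = word_vec []"
  "f \<otimes>\<^bsub>free_algebra n\<^esub> g = (\<lambda>w. \<Sum>k\<le>length w. f (take k w) * g (drop k w))"
  by (simp_all add: free_algebra_def word_vec_def)

lemma word_vec_closed [simp]: "set w \<subseteq> {..<n} \<Longrightarrow> word_vec w \<in> carrier (free_algebra n)"
  by (auto simp: free_algebra_carrier word_vec_def)

lemma gen_eq_word_vec: "gen i = word_vec [i]"
  by (simp add: gen_def word_vec_def)

lemma scalar_closed [simp]: "scalar c \<in> carrier (free_algebra n)"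
  by (auto simp: free_algebra_carrier scalar_def)

lemma add_pointwise_closed:
  assumes "f \<in> carrier (free_algebra n)" "g \<in> carrier (free_algebra n)"
  shows "(\<lambda>w. f w + g w) \<in> carrier (free_algebra n)"
proof -
  interpret F: ring "free_algebra n :: (nat list \<Rightarrow> 'a) ring" by (rule ring_free_algebra)
  show ?thesis using F.a_closed[OF assms] by (simp add: free_algebra_simps)
qed

lemma scale_pointwise_closed:
  "f \<in> carrier (free_algebra n) \<Longrightarrow> (\<lambda>w. c * f w) \<in> carrier (free_algebra n)"
  by (auto simp: free_algebra_carrier elim: rev_finite_subset)

lemma free_algebra_uminus:
  assumes "f \<in> carrier (free_algebra n)"
  shows "\<ominus>\<^bsub>free_algebra n\<^esub> f = (\<lambda>w. - f w)"
proof -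
  interpret F: ring "free_algebra n :: (nat list \<Rightarrow> 'a) ring" by (rule ring_free_algebra)
  have "(\<lambda>w. - f w) \<in> carrier (free_algebra n)"
    using scale_pointwise_closed[OF assms, of "-1"] by simp
  then show ?thesis using assms by (intro F.minus_equality) (auto simp: free_algebra_simps)
qed

lemma free_algebra_minus:
  assumes "f \<in> carrier (free_algebra n)" "g \<in> carrier (free_algebra n)"
  shows "f \<ominus>\<^bsub>free_algebra n\<^esub> g = (\<lambda>w. f w - g w)"
  using assms by (simp add: a_minus_def free_algebra_uminus free_algebra_simps(1))

lemma word_vec_mult: "word_vec u \<otimes>\<^bsub>free_algebra n\<^esub> word_vec v = word_vec (u @ v)"
proof
  fix w
  have "(word_vec u \<otimes>\<^bsub>free_algebra n\<^esub> word_vec v) w = (\<Sum>k\<le>length w. if k = length u \<and> w = u @ v then 1 else 0)"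
    unfolding free_algebra_simps word_vec_def
    by (intro sum.cong) (auto simp: append_eq_conv_conj min_def)
  then show "(word_vec u \<otimes>\<^bsub>free_algebra n\<^esub> word_vec v) w = word_vec (u @ v) w"
    by (auto simp: word_vec_def if_distrib cong: if_cong)
qed

lemma scalar_mult:
  "scalar c \<otimes>\<^bsub>free_algebra n\<^esub> f = (\<lambda>w. c * f w)" "f \<otimes>\<^bsub>free_algebra n\<^esub> scalar c = (\<lambda>w. c * f w)"
proof -
  show "scalar c \<otimes>\<^bsub>free_algebra n\<^esub> f = (\<lambda>w. c * f w)"
  proof
    fix w
    have "(scalar c \<otimes>\<^bsub>free_algebra n\<^esub> f) w = (\<Sum>k\<le>length w. if k = 0 then c * f w else 0)"
      unfolding free_algebra_simps scalar_def by (intro sum.cong) auto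
    then show "(scalar c \<otimes>\<^bsub>free_algebra n\<^esub> f) w = c * f w" by simp
  qed
  show "f \<otimes>\<^bsub>free_algebra n\<^esub> scalar c = (\<lambda>w. c * f w)"
  proof
    fix w
    have "(f \<otimes>\<^bsub>free_algebra n\<^esub> scalar c) w = (\<Sum>k\<le>length w. if k = length w then c * f w else 0)"
      unfolding free_algebra_simps scalar_def by (intro sum.cong) auto
    then show "(f \<otimes>\<^bsub>free_algebra n\<^esub> scalar c) w = c * f w" by simp
  qed
qed

text \<open>The common root of the inductions on the free algebra, on normal form vectors and on a
  graded component. The summand is left as an \<open>if\<close> because \<open>word_vec\<close> and
  \<open>delta\<close> both unfold to it.\<close>

lemma finsupp_induct [consumes 2, case_names zero add]:
  fixes f :: "'i \<Rightarrow> 'k::comm_ring_1"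
  assumes "finite {w. f w \<noteq> 0}" "{w. f w \<noteq> 0} \<subseteq> S" and "Q (\<lambda>w. 0)"
    and step: "\<And>f c w. \<lbrakk>finite {w. f w \<noteq> 0}; {w. f w \<noteq> 0} \<subseteq> S; w \<in> S; Q f\<rbrakk> \<Longrightarrow>
      Q (\<lambda>v. f v + c * (if v = w then 1 else 0))"
  shows "Q f"
proof -
  have "Q f" if "finite T" "{w. f w \<noteq> 0} \<subseteq> T" "T \<subseteq> S" for T f
    using that
  proof (induction T arbitrary: f rule: finite_induct)
    case empty
    then have "f = (\<lambda>w. 0)" by auto
    then show ?case using assms(3) by simp
  next
    case (insert t T)
    have "Q (f(t := 0))" using insert by (intro insert(3)) auto
    moreover have "{w. (f(t := 0)) w \<noteq> 0} \<subseteq> T" using insert by auto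
    ultimately have "Q (\<lambda>v. (f(t := 0)) v + f t * (if v = t then 1 else 0))"
      using insert(1,5) by (intro step[of "f(t := 0)" t "f t"]) (auto simp del: fun_upd_apply elim: finite_subset)
    moreover have "(\<lambda>v. (f(t := 0)) v + f t * (if v = t then 1 else 0)) = f" by auto
    ultimately show ?case by simp
  qed
  from this[OF assms(1) order.refl assms(2)] show ?thesis .
qed

lemma free_algebra_induct [consumes 1, case_names zero add]:
  fixes f :: "nat list \<Rightarrow> 'k::field"
  assumes "f \<in> carrier (free_algebra n)" and "Q (\<lambda>w. 0)"
    and step: "\<And>f c w. \<lbrakk>f \<in> carrier (free_algebra n); set w \<subseteq> {..<n}; Q f\<rbrakk> \<Longrightarrow> Q (\<lambda>v. f v + c * word_vec w v)"
  shows "Q f"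
proof -
  have "finite {w. f w \<noteq> 0}" "{w. f w \<noteq> 0} \<subseteq> {w. set w \<subseteq> {..<n}}"
    using assms(1) by (auto simp: free_algebra_carrier)
  then show ?thesis
  proof (induction f rule: finsupp_induct)
    case (add f c w)
    then show ?case using step[of f w c] by (auto simp: word_vec_def free_algebra_carrier subset_iff)
  qed (rule assms(2))
qed

lemma mult_pointwise:
  "(\<lambda>w. f w + g w) \<otimes>\<^bsub>free_algebra n\<^esub> h = (\<lambda>w. (f \<otimes>\<^bsub>free_algebra n\<^esub> h) w + (g \<otimes>\<^bsub>free_algebra n\<^esub> h) w)"
  "h \<otimes>\<^bsub>free_algebra n\<^esub> (\<lambda>w. f w + g w) = (\<lambda>w. (h \<otimes>\<^bsub>free_algebra n\<^esub> f) w + (h \<otimes>\<^bsub>free_algebra n\<^esub> g) w)"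
  "(\<lambda>w. c * f w) \<otimes>\<^bsub>free_algebra n\<^esub> h = (\<lambda>w. c * (f \<otimes>\<^bsub>free_algebra n\<^esub> h) w)"
  "h \<otimes>\<^bsub>free_algebra n\<^esub> (\<lambda>w. c * f w) = (\<lambda>w. c * (h \<otimes>\<^bsub>free_algebra n\<^esub> f) w)"
  "(\<lambda>w. 0) \<otimes>\<^bsub>free_algebra n\<^esub> h = (\<lambda>w. 0)" "h \<otimes>\<^bsub>free_algebra n\<^esub> (\<lambda>w. 0) = (\<lambda>w. 0)"
  by (simp_all add: free_algebra_simps sum.distrib sum_distrib_left algebra_simps)

locale free_algebra_quotient =
  fixes n :: nat and I :: "(nat list \<Rightarrow> 'k::field) set"
  assumes ideal: "ideal I (free_algebra n)"
begin

abbreviation FA :: "(nat list \<Rightarrow> 'k) ring" where "FA \<equiv> free_algebra n"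
abbreviation A :: "(nat list \<Rightarrow> 'k) set ring" where "A \<equiv> quot_alg n I"

sublocale I: ideal I FA by (rule ideal)

sublocale A: ring A by (rule I.quotient_is_ring)

lemma q_ring_hom: "q n I \<in> ring_hom FA A" by (rule I.rcos_ring_hom)

lemma q_closed [simp]: "f \<in> carrier FA \<Longrightarrow> q n I f \<in> carrier A"
  using q_ring_hom by (rule ring_hom_closed)

lemma q_mult: "\<lbrakk>f \<in> carrier FA; g \<in> carrier FA\<rbrakk> \<Longrightarrow> q n I (f \<otimes>\<^bsub>FA\<^esub> g) = q n I f \<otimes>\<^bsub>A\<^esub> q n I g"
  using q_ring_hom by (rule ring_hom_mult)

lemma q_add: "\<lbrakk>f \<in> carrier FA; g \<in> carrier FA\<rbrakk> \<Longrightarrow> q n I (\<lambda>w. f w + g w) = q n I f \<oplus>\<^bsub>A\<^esub> q n I g"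
  using ring_hom_add[OF q_ring_hom] by (simp add: free_algebra_simps(1))

lemma q_one: "q n I (word_vec []) = \<one>\<^bsub>A\<^esub>"
  using ring_hom_one[OF q_ring_hom] by (simp add: free_algebra_simps(3))

lemma q_scale: "f \<in> carrier FA \<Longrightarrow> q n I (\<lambda>w. c * f w) = q n I (scalar c) \<otimes>\<^bsub>A\<^esub> q n I f"
  using q_mult[of "scalar c" f] by (simp add: scalar_mult)

lemma q_eq_iff:
  assumes "f \<in> carrier FA" "g \<in> carrier FA"
  shows "q n I f = q n I g \<longleftrightarrow> (\<lambda>w. f w - g w) \<in> I"
  using I.quotient_eq_iff_same_a_r_cos[OF ideal assms] assms by (simp add: free_algebra_minus)

lemma q_zero: "q n I (\<lambda>w. 0) = \<zero>\<^bsub>A\<^esub>"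
  using I.a_rcos_zero[OF ideal additive_subgroup.zero_closed[OF I.is_additive_subgroup]] by (simp add: free_algebra_simps(2) FactRing_def)

lemma q_eq_zero_iff: "f \<in> carrier FA \<Longrightarrow> q n I f = \<zero>\<^bsub>A\<^esub> \<longleftrightarrow> f \<in> I"
  using q_eq_iff[of f "\<lambda>w. 0"] q_zero by (simp add: free_algebra_carrier)

lemma A_carrier: "carrier A = q n I ` carrier FA"
  by (auto simp: FactRing_def A_RCOSETS_def' a_r_coset_def')

lemma A_cases:
  assumes "a \<in> carrier A" obtains f where "f \<in> carrier FA" "a = q n I f"
  using assms by (auto simp: A_carrier)

lemma q_uminus: "f \<in> carrier FA \<Longrightarrow> q n I (\<lambda>w. - f w) = \<ominus>\<^bsub>A\<^esub> q n I f"
  using q_add[of f "\<lambda>w. - f w"] scale_pointwise_closed[of f n "-1"] q_zero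
  by (intro A.minus_equality[symmetric]) (auto simp: A.a_comm)

lemma q_minus: "\<lbrakk>f \<in> carrier FA; g \<in> carrier FA\<rbrakk> \<Longrightarrow> q n I (\<lambda>w. f w - g w) = q n I f \<ominus>\<^bsub>A\<^esub> q n I g"
  using q_add[of f "\<lambda>w. - g w"] scale_pointwise_closed[of g n "-1"]
  by (simp add: q_uminus A.minus_eq)

abbreviation Kq :: "(nat list \<Rightarrow> 'k) set set" where "Kq \<equiv> range (\<lambda>c. q n I (scalar c))"

lemma Kq_central: "\<lbrakk>k \<in> Kq; a \<in> carrier A\<rbrakk> \<Longrightarrow> k \<otimes>\<^bsub>A\<^esub> a = a \<otimes>\<^bsub>A\<^esub> k"
  by (elim A_cases imageE) (simp add: q_mult[symmetric] scalar_mult)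

lemma q_scalar_add: "q n I (scalar c) \<oplus>\<^bsub>A\<^esub> q n I (scalar d) = q n I (scalar (c + d))"
  by (simp add: q_add[symmetric]) (simp add: scalar_def if_distrib cong: if_cong)

lemma q_scalar_mult: "q n I (scalar c) \<otimes>\<^bsub>A\<^esub> q n I (scalar d) = q n I (scalar (c * d))"
  by (simp add: q_mult[symmetric] scalar_mult) (simp add: scalar_def if_distrib mult.commute cong: if_cong)

lemma scalar_1: "scalar 1 = word_vec []" and scalar_0: "scalar 0 = (\<lambda>w. 0)"
  by (auto simp: scalar_def word_vec_def)

lemma q_scalar_minus_1: "q n I (scalar (- 1)) = \<ominus>\<^bsub>A\<^esub> \<one>\<^bsub>A\<^esub>"
  using q_uminus[of "scalar 1"]
  by (simp add: q_one scalar_1) (simp add: scalar_def word_vec_def if_distrib cong: if_cong)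

lemma one_not_in_ideal:
  assumes "I \<noteq> carrier FA" shows "word_vec [] \<notin> I"
  using I.one_imp_carrier assms by (auto simp: free_algebra_simps(3))

lemma one_neq_zero: "I \<noteq> carrier FA \<Longrightarrow> \<one>\<^bsub>A\<^esub> \<noteq> \<zero>\<^bsub>A\<^esub>"
  using one_not_in_ideal q_eq_zero_iff[of "word_vec []"] by (simp add: q_one)

lemma Kq_subfield:
  assumes "I \<noteq> carrier FA"
  shows "subfield Kq A"
proof (rule A.subfieldI)
  have zero: "\<zero>\<^bsub>A\<^esub> = q n I (scalar 0)" and one: "\<one>\<^bsub>A\<^esub> = q n I (scalar 1)"
    by (simp_all add: scalar_1 scalar_0 q_one q_zero)
  show "subcring Kq A"
  proof (rule A.subcringI)
    show "subring Kq A"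
    proof (rule A.subringI)
      show "\<ominus>\<^bsub>A\<^esub> h \<in> Kq" if h: "h \<in> Kq" for h
      proof -
        obtain c where c: "h = q n I (scalar c)" using h by auto
        have "\<ominus>\<^bsub>A\<^esub> h = q n I (scalar (- c))" unfolding c
          by (simp add: q_uminus[symmetric]) (simp add: scalar_def if_distrib cong: if_cong)
        then show ?thesis by blast
      qed
    qed (auto simp: one q_scalar_add q_scalar_mult)
    show "h1 \<otimes>\<^bsub>A\<^esub> h2 = h2 \<otimes>\<^bsub>A\<^esub> h1" if "h1 \<in> Kq" "h2 \<in> Kq" for h1 h2
      using that by (auto simp: q_scalar_mult mult.commute)
  qed
  show "Units (A\<lparr>carrier := Kq\<rparr>) = Kq - {\<zero>\<^bsub>A\<^esub>}"
  proof (intro equalityI subsetI)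
    fix k assume "k \<in> Units (A\<lparr>carrier := Kq\<rparr>)"
    then show "k \<in> Kq - {\<zero>\<^bsub>A\<^esub>}" using one_neq_zero[OF assms] by (auto simp: Units_def)
  next
    fix k assume k: "k \<in> Kq - {\<zero>\<^bsub>A\<^esub>}"
    then obtain c where c: "k = q n I (scalar c)" by auto
    then have "c \<noteq> 0" using k zero by auto
    then have "q n I (scalar (inverse c)) \<otimes>\<^bsub>A\<^esub> k = \<one>\<^bsub>A\<^esub>" "k \<otimes>\<^bsub>A\<^esub> q n I (scalar (inverse c)) = \<one>\<^bsub>A\<^esub>"
      by (simp_all add: c q_scalar_mult one)
    then show "k \<in> Units (A\<lparr>carrier := Kq\<rparr>)" using k by (auto simp: Units_def)
  qed
qed

lemma alg_deg_carrier: "alg_deg n I j \<subseteq> carrier A"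
  by (auto simp: alg_deg_def free_deg_def)

end

section \<open>Dimensions of graded components\<close>

context free_algebra_quotient
begin

abbreviation qw :: "nat list \<Rightarrow> (nat list \<Rightarrow> 'k) set" where "qw w \<equiv> q n I (word_vec w)"

lemma free_deg_closed: "f \<in> free_deg n j \<Longrightarrow> f \<in> carrier FA"
  by (simp add: free_deg_def)

lemma alg_deg_linear:
  assumes "k \<in> Kq" "a \<in> alg_deg n I j" "b \<in> alg_deg n I j"
  shows "k \<otimes>\<^bsub>A\<^esub> a \<oplus>\<^bsub>A\<^esub> b \<in> alg_deg n I j"
proof -
  obtain f g c where f: "f \<in> free_deg n j" "a = q n I f" and g: "g \<in> free_deg n j" "b = q n I g"
    and k: "k = q n I (scalar c)"
    using assms by (auto simp: alg_deg_def)
  note fc = free_deg_closed[OF f(1)] and gc = free_deg_closed[OF g(1)]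
  have "(\<lambda>w. c * f w + g w) \<in> carrier FA"
    using add_pointwise_closed[OF scale_pointwise_closed[OF fc] gc] .
  moreover have "length w = j" if "c * f w + g w \<noteq> 0" for w
  proof -
    have "f w \<noteq> 0 \<or> g w \<noteq> 0" using that by auto
    then show ?thesis using f(1) g(1) by (auto simp: free_deg_def)
  qed
  ultimately have "(\<lambda>w. c * f w + g w) \<in> free_deg n j" by (simp only: free_deg_def mem_Collect_eq) blast
  moreover have "q n I (\<lambda>w. c * f w + g w) = k \<otimes>\<^bsub>A\<^esub> a \<oplus>\<^bsub>A\<^esub> b"
    using fc gc by (simp add: q_add scale_pointwise_closed q_scale f(2) g(2) k)
  ultimately show ?thesis unfolding alg_deg_def by (metis image_eqI)
qed

lemma zero_in_alg_deg: "\<zero>\<^bsub>A\<^esub> \<in> alg_deg n I j"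
proof -
  have "(\<lambda>w. 0) \<in> free_deg n j" by (simp add: free_deg_def free_algebra_carrier)
  then show ?thesis unfolding alg_deg_def using q_zero by (metis image_eqI)
qed

lemma alg_deg_add:
  "\<lbrakk>a \<in> alg_deg n I j; b \<in> alg_deg n I j\<rbrakk> \<Longrightarrow> a \<oplus>\<^bsub>A\<^esub> b \<in> alg_deg n I j"
  using alg_deg_linear[OF rangeI[of "\<lambda>c. q n I (scalar c)" 1], of a j b] alg_deg_carrier[of j]
  by (auto simp: scalar_1 q_one subset_iff)

lemma alg_deg_minus:
  "\<lbrakk>a \<in> alg_deg n I j; b \<in> alg_deg n I j\<rbrakk> \<Longrightarrow> a \<ominus>\<^bsub>A\<^esub> b \<in> alg_deg n I j"
  using alg_deg_linear[OF rangeI[of "\<lambda>c. q n I (scalar c)" "- 1"], of b j a] alg_deg_carrier[of j]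
  by (auto simp: q_scalar_minus_1 A.l_minus A.minus_eq A.a_comm subset_iff)

lemma Span_map_qw_subset:
  assumes "\<And>w. w \<in> set ws \<Longrightarrow> set w \<subseteq> {..<n} \<and> length w = j"
  shows "A.Span Kq (map qw ws) \<subseteq> alg_deg n I j"
  using assms
proof (induction ws)
  case Nil
  then show ?case by (simp add: zero_in_alg_deg)
next
  case (Cons w ws)
  have "word_vec w \<in> free_deg n j" using Cons.prems[of w] by (simp add: free_deg_def) (simp add: word_vec_def)
  then have "qw w \<in> alg_deg n I j" unfolding alg_deg_def by (rule imageI)
  moreover have "A.Span Kq (map qw ws) \<subseteq> alg_deg n I j" using Cons.prems by (intro Cons.IH) simp
  ultimately show ?case by (auto simp: A.line_extension_mem_iff intro!: alg_deg_linear)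
qed

text \<open>It is enough to reduce words, and to zero or to one listed word: the defining relations
  of the dual algebra either kill a word or identify two.\<close>

lemma alg_deg_eq_Span:
  assumes proper: "I \<noteq> carrier FA"
    and ws: "\<And>w. w \<in> set ws \<Longrightarrow> set w \<subseteq> {..<n} \<and> length w = j"
    and cover: "\<And>w. \<lbrakk>set w \<subseteq> {..<n}; length w = j\<rbrakk> \<Longrightarrow> qw w = \<zero>\<^bsub>A\<^esub> \<or> (\<exists>b\<in>set ws. qw w = qw b)"
  shows "alg_deg n I j = A.Span Kq (map qw ws)"
proof (rule antisym[OF _ Span_map_qw_subset[OF ws]], rule subsetI)
  note K = Kq_subfield[OF proper]
  have Us: "set (map qw ws) \<subseteq> carrier A" using ws by auto
  note sp = A.Span_subgroup_props[OF K Us]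
  fix a assume "a \<in> alg_deg n I j"
  then obtain f where f: "f \<in> free_deg n j" "a = q n I f" by (auto simp: alg_deg_def)
  have "finite {w. f w \<noteq> 0}" "{w. f w \<noteq> 0} \<subseteq> {w. set w \<subseteq> {..<n} \<and> length w = j}"
    using f(1) by (auto simp: free_deg_def free_algebra_carrier)
  then have "q n I f \<in> A.Span Kq (map qw ws)"
  proof (induction f rule: finsupp_induct)
    case zero
    then show ?case using sp(2) by (simp only: q_zero)
  next
    case (add f c w)
    have fc: "f \<in> carrier FA" using add(1,2) by (auto simp: free_algebra_carrier)
    have wc: "word_vec w \<in> carrier FA" using add(3) by simp
    have "qw w \<in> A.Span Kq (map qw ws)"
      using cover[of w] add(3) sp(2) A.Span_base_incl[OF K Us] by auto
    then have "q n I (scalar c) \<otimes>\<^bsub>A\<^esub> qw w \<in> A.Span Kq (map qw ws)"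
      by (intro A.Span_smult_closed[OF K Us]) auto
    then have "q n I (\<lambda>v. f v + c * word_vec w v) \<in> A.Span Kq (map qw ws)"
      using add(4) fc wc sp(3) by (simp add: q_add q_scale scale_pointwise_closed)
    then show ?case by (simp only: word_vec_def)
  qed
  then show "a \<in> A.Span Kq (map qw ws)" using f(2) by simp
qed

text \<open>The functionals \<open>lam b\<close> vanish on \<open>I\<close>, so they descend to the
  quotient, where they are dual to the classes of the words. They are kept on the free algebra,
  where they are simply sums of coefficients.\<close>

lemma independent_words:
  assumes proper: "I \<noteq> carrier FA"
    and ws: "\<And>w. w \<in> set ws \<Longrightarrow> set w \<subseteq> {..<n}" and "distinct ws"
    and lin: "\<And>b f g. lam b (\<lambda>w. f w + g w) = lam b f + lam b g" "\<And>b c f. lam b (\<lambda>w. c * f w) = c * lam b f"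
    and van: "\<And>b f. \<lbrakk>b \<in> set ws; f \<in> I\<rbrakk> \<Longrightarrow> lam b f = (0 :: 'k)"
    and dual: "\<And>b c. \<lbrakk>b \<in> set ws; c \<in> set ws\<rbrakk> \<Longrightarrow> lam b (word_vec c) = (if b = c then 1 else 0)"
  shows "A.independent Kq (map qw ws)"
proof -
  have z: "lam b (\<lambda>w. 0) = 0" for b using lin(2)[of b 0 "\<lambda>w. 0"] by simp
  have sp: "\<exists>f\<in>carrier FA. a = q n I f \<and> (\<forall>b\<in>set ws - set vs. lam b f = 0)"
    if "set vs \<subseteq> set ws" "a \<in> A.Span Kq (map qw vs)" for vs a
    using that
  proof (induction vs arbitrary: a)
    case Nil
    have "(\<lambda>w. 0) \<in> carrier FA" by (simp add: free_algebra_carrier)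
    then show ?case using Nil by (intro bexI[of _ "\<lambda>w. 0"]) (auto simp: q_zero z)
  next
    case (Cons v vs)
    obtain c a' where a: "a = q n I (scalar c) \<otimes>\<^bsub>A\<^esub> qw v \<oplus>\<^bsub>A\<^esub> a'" "a' \<in> A.Span Kq (map qw vs)"
      using Cons.prems(2) by (auto simp: A.line_extension_mem_iff)
    obtain f where f: "f \<in> carrier FA" "a' = q n I f" "\<And>b. b \<in> set ws - set vs \<Longrightarrow> lam b f = 0"
      using Cons.IH[OF _ a(2)] Cons.prems(1) by auto
    have v: "word_vec v \<in> carrier FA" using ws Cons.prems(1) by auto
    have "(\<lambda>w. c * word_vec v w + f w) \<in> carrier FA"
      by (intro add_pointwise_closed scale_pointwise_closed v f)
    moreover have "a = q n I (\<lambda>w. c * word_vec v w + f w)"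
      using v f by (simp add: q_add q_scale scale_pointwise_closed a)
    moreover have "lam b (\<lambda>w. c * word_vec v w + f w) = 0" if "b \<in> set ws - set (v # vs)" for b
      using that dual[of b v] Cons.prems(1) f(3)[of b] by (auto simp: lin)
    ultimately show ?case by blast
  qed
  have "A.independent Kq (map qw vs)" if "set vs \<subseteq> set ws" "distinct vs" for vs
    using that
  proof (induction vs)
    case (Cons v vs)
    have v: "word_vec v \<in> carrier FA" using ws Cons.prems(1) by auto
    have "qw v \<notin> A.Span Kq (map qw vs)"
    proof
      assume "qw v \<in> A.Span Kq (map qw vs)"
      then obtain f where f: "f \<in> carrier FA" "qw v = q n I f" "\<And>b. b \<in> set ws - set vs \<Longrightarrow> lam b f = 0"
        using sp[of vs "qw v"] Cons.prems(1) by auto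
      have vws: "v \<in> set ws" "v \<in> set ws - set vs" using Cons.prems by auto
      have "(\<lambda>w. word_vec v w - f w) \<in> I" using f v by (simp add: q_eq_iff[symmetric])
      then have "lam v (\<lambda>w. word_vec v w - f w) = 0" using van vws by blast
      \<comment> \<open>\<open>lam v\<close> takes the value \<open>1\<close> on
        \<open>word_vec v\<close> and \<open>0\<close> on the representative \<open>f\<close>, yet
        vanishes on their difference.\<close>
      moreover have "lam v (\<lambda>w. word_vec v w + (-1) * f w) = lam v (word_vec v) + (-1) * lam v f"
        by (simp only: lin)
      ultimately show False using dual[OF vws(1,1)] f(3)[OF vws(2)] by simp
    qed
    then show ?case using Cons v by (auto intro: A.li_Cons)
  qed simp
  then show ?thesis using \<open>distinct ws\<close> by blast
qed

lemma alg_dim_eq: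
  assumes proper: "I \<noteq> carrier FA" and "alg_deg n I j = A.Span Kq (map qw ws)"
    and "A.independent Kq (map qw ws)"
  shows "alg_dim n I j = length ws"
  using A.dimI[OF Kq_subfield[OF proper] A.dimension_independent[OF assms(3)]] assms(2)
  by (simp add: alg_dim_def over_def)

end

lemma ideal_of_pointwise:
  assumes "S \<subseteq> carrier (free_algebra n)" "(\<lambda>w. 0) \<in> S"
    and "\<And>f g. \<lbrakk>f \<in> S; g \<in> S\<rbrakk> \<Longrightarrow> (\<lambda>w. f w + g w) \<in> S" "\<And>f. f \<in> S \<Longrightarrow> (\<lambda>w. - f w) \<in> S"
    and "\<And>f g. \<lbrakk>f \<in> S; g \<in> carrier (free_algebra n)\<rbrakk> \<Longrightarrow> f \<otimes>\<^bsub>free_algebra n\<^esub> g \<in> S"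
    and "\<And>f g. \<lbrakk>f \<in> S; g \<in> carrier (free_algebra n)\<rbrakk> \<Longrightarrow> g \<otimes>\<^bsub>free_algebra n\<^esub> f \<in> S"
  shows "ideal (S :: (nat list \<Rightarrow> 'k::field) set) (free_algebra n)"
proof -
  interpret F: ring "free_algebra n :: (nat list \<Rightarrow> 'k) ring" by (rule ring_free_algebra)
  show ?thesis
  proof (rule idealI)
    show "subgroup S (add_monoid (free_algebra n))"
    proof (rule F.add.subgroupI)
      fix f assume f: "f \<in> S"
      then have fc: "f \<in> carrier (free_algebra n)" using assms(1) by auto
      show "\<ominus>\<^bsub>free_algebra n\<^esub> f \<in> S" using assms(4)[OF f] fc by (simp add: free_algebra_uminus)
      fix g assume "g \<in> S"
      then show "f \<oplus>\<^bsub>free_algebra n\<^esub> g \<in> S" using assms(3)[OF f] by (simp add: free_algebra_simps(1))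
    qed (use assms(1,2) in auto)
  qed (use assms(5,6) ring_free_algebra in auto)
qed

lemma mult_apply:
  "(f \<otimes>\<^bsub>free_algebra n\<^esub> g) [] = f [] * g []"
  "(f \<otimes>\<^bsub>free_algebra n\<^esub> g) [a] = f [] * g [a] + f [a] * g []"
  "(f \<otimes>\<^bsub>free_algebra n\<^esub> g) [a, b] = f [] * g [a, b] + f [a] * g [b] + f [a, b] * g []"
  "(f \<otimes>\<^bsub>free_algebra n\<^esub> g) [a, b, c] =
     f [] * g [a, b, c] + f [a] * g [b, c] + f [a, b] * g [c] + f [a, b, c] * g []"
  "(f \<otimes>\<^bsub>free_algebra n\<^esub> g) [a, b, c, d] =
     f [] * g [a, b, c, d] + f [a] * g [b, c, d] + f [a, b] * g [c, d] + f [a, b, c] * g [d] + f [a, b, c, d] * g []"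
  by (simp_all add: free_algebra_simps)


section \<open>Normal forms\<close>

text \<open>With \<open>u = x + y\<close> the relations become \<open>ux = xz = 0\<close>, \<open>zu = zx\<close>; they imply \<open>zxx = 0\<close>, and the words
  avoiding \<open>ux, xz, zu, zxx\<close> form a basis of the algebra on which right multiplication by \<open>u\<close>, \<open>x\<close> or \<open>z\<close>
  sends words to words or to \<open>0\<close>. Words are stored reversed: the head is the last letter.\<close>

datatype letter = X | U | Z

fun ok :: "letter \<Rightarrow> letter list \<Rightarrow> bool" where
  "ok X (U # _) = False"
| "ok X (X # Z # _) = False"
| "ok Z (X # _) = False"
| "ok U (Z # _) = False"
| "ok _ _ = True"

fun nrm :: "letter list \<Rightarrow> bool" where
  "nrm [] = True"
| "nrm (c # w) \<longleftrightarrow> ok c w \<and> nrm w"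

fun rx :: "(letter list \<Rightarrow> 'k::field) \<Rightarrow> letter list \<Rightarrow> 'k" where
  "rx p (X # w) = (if ok X w then p w else 0)"
| "rx p _ = 0"

fun rz :: "(letter list \<Rightarrow> 'k::field) \<Rightarrow> letter list \<Rightarrow> 'k" where
  "rz p (Z # w) = (if ok Z w then p w else 0)"
| "rz p _ = 0"

text \<open>Right multiplication by \<open>u\<close> on coefficient functions. The second clause is
  the rewriting of \<open>zu\<close> to \<open>zx\<close>: the coefficient of a word ending in
  \<open>zx\<close> comes from that word without its last letter.\<close>

fun ru :: "(letter list \<Rightarrow> 'k::field) \<Rightarrow> letter list \<Rightarrow> 'k" where
  "ru p (U # w) = (if ok U w then p w else 0)"
| "ru p (X # Z # w) = p (Z # w)"
| "ru p _ = 0"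

lemma ok_X_iff: "ok X w \<longleftrightarrow> (\<forall>v. w \<noteq> U # v \<and> w \<noteq> X # Z # v)"
  by (cases "(X, w)" rule: ok.cases) auto

lemma ok_Z_iff: "ok Z w \<longleftrightarrow> (\<forall>v. w \<noteq> X # v)"
  by (cases "(Z, w)" rule: ok.cases) auto

lemma ok_U_iff: "ok U w \<longleftrightarrow> (\<forall>v. w \<noteq> Z # v)"
  by (cases "(U, w)" rule: ok.cases) auto

text \<open>This and the next two identities are the defining relations for the operators. Here the
  ban on \<open>zxx\<close> matters: words ending in \<open>zx\<close> arise from \<open>u\<close>
  as well, and must not admit a further \<open>x\<close>.\<close>

lemma rx_ru: "rx (ru p) = (\<lambda>v. 0)"
proof
  fix v show "rx (ru p) v = 0"
  proof (cases "(p, v)" rule: rx.cases)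
    case (1 p' w)
    then show ?thesis by (cases "(p', w)" rule: ru.cases) auto
  qed auto
qed

lemma rz_rx: "rz (rx p) = (\<lambda>v. 0)"
proof
  fix v show "rz (rx p) v = 0"
  proof (cases "(p, v)" rule: rz.cases)
    case (1 p' w)
    then show ?thesis by (cases "(p', w)" rule: rx.cases) auto
  qed auto
qed

lemma ru_rz: "ru (rz p) = rx (rz p)"
proof
  fix v show "ru (rz p) v = rx (rz p) v"
  proof (cases "(p, v)" rule: ru.cases)
    case (1 p' w)
    then show ?thesis by (cases "(p', w)" rule: rz.cases) auto
  qed auto
qed

definition NV :: "(letter list \<Rightarrow> 'k::field) set" where
  "NV = {p. finite {w. p w \<noteq> 0} \<and> (\<forall>w. p w \<noteq> 0 \<longrightarrow> nrm w)}"

definition delta :: "letter list \<Rightarrow> letter list \<Rightarrow> 'k::field" where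
  "delta w = (\<lambda>v. if v = w then 1 else 0)"

text \<open>The original generators: \<open>0\<close> is \<open>x\<close>, \<open>2\<close> is
  \<open>z\<close>, and \<open>1\<close> is \<open>y = u - x\<close>.\<close>

definition rho :: "nat \<Rightarrow> (letter list \<Rightarrow> 'k::field) \<Rightarrow> letter list \<Rightarrow> 'k" where
  "rho i p = (if i = 0 then rx p else if i = 1 then (\<lambda>v. ru p v - rx p v) else if i = 2 then rz p else (\<lambda>v. 0))"

lemma r_add:
  "rx (\<lambda>v. p v + p' v) = (\<lambda>v. rx p v + rx p' v)" "rz (\<lambda>v. p v + p' v) = (\<lambda>v. rz p v + rz p' v)"
  "ru (\<lambda>v. p v + p' v) = (\<lambda>v. ru p v + ru p' v)"
proof -
  show "rx (\<lambda>v. p v + p' v) = (\<lambda>v. rx p v + rx p' v)"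
  proof
    fix v show "rx (\<lambda>v. p v + p' v) v = rx p v + rx p' v"
      by (cases "(p, v)" rule: rx.cases) auto
  qed
  show "rz (\<lambda>v. p v + p' v) = (\<lambda>v. rz p v + rz p' v)"
  proof
    fix v show "rz (\<lambda>v. p v + p' v) v = rz p v + rz p' v"
      by (cases "(p, v)" rule: rz.cases) auto
  qed
  show "ru (\<lambda>v. p v + p' v) = (\<lambda>v. ru p v + ru p' v)"
  proof
    fix v show "ru (\<lambda>v. p v + p' v) v = ru p v + ru p' v"
      by (cases "(p, v)" rule: ru.cases) auto
  qed
qed

lemma r_scale:
  "rx (\<lambda>v. c * p v) = (\<lambda>v. c * rx p v)" "rz (\<lambda>v. c * p v) = (\<lambda>v. c * rz p v)"
  "ru (\<lambda>v. c * p v) = (\<lambda>v. c * ru p v)"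
proof -
  show "rx (\<lambda>v. c * p v) = (\<lambda>v. c * rx p v)"
  proof
    fix v show "rx (\<lambda>v. c * p v) v = c * rx p v"
      by (cases "(p, v)" rule: rx.cases) auto
  qed
  show "rz (\<lambda>v. c * p v) = (\<lambda>v. c * rz p v)"
  proof
    fix v show "rz (\<lambda>v. c * p v) v = c * rz p v"
      by (cases "(p, v)" rule: rz.cases) auto
  qed
  show "ru (\<lambda>v. c * p v) = (\<lambda>v. c * ru p v)"
  proof
    fix v show "ru (\<lambda>v. c * p v) v = c * ru p v"
      by (cases "(p, v)" rule: ru.cases) auto
  qed
qed

lemma rho_add: "rho i (\<lambda>v. p v + p' v) = (\<lambda>v. rho i p v + rho i p' v)"
  by (simp add: rho_def r_add algebra_simps)

lemma rho_scale: "rho i (\<lambda>v. c * p v) = (\<lambda>v. c * rho i p v)"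
  by (simp add: rho_def r_scale algebra_simps)

lemma fold_rho_add: "fold rho w (\<lambda>v. p v + p' v) = (\<lambda>v. fold rho w p v + fold rho w p' v)"
  by (induction w arbitrary: p p') (simp_all add: rho_add)

lemma fold_rho_scale: "fold rho w (\<lambda>v. c * p v) = (\<lambda>v. c * fold rho w p v)"
  by (induction w arbitrary: p) (simp_all add: rho_scale)

lemma fold_rho_zero: "fold rho w (\<lambda>v. 0) = (\<lambda>v. 0)"
  using fold_rho_scale[of w 0] by simp

text \<open>The right action of the free algebra. \<open>fold\<close> takes the letters of
  \<open>w\<close> from the left, in the order in which they multiply from the right.\<close>

definition act :: "(letter list \<Rightarrow> 'k::field) \<Rightarrow> (nat list \<Rightarrow> 'k) \<Rightarrow> letter list \<Rightarrow> 'k" where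
  "act p f = (\<lambda>v. \<Sum>w\<in>{w. f w \<noteq> 0}. f w * fold rho w p v)"

lemma act_superset:
  assumes "finite S" "{w. f w \<noteq> 0} \<subseteq> S"
  shows "act p f v = (\<Sum>w\<in>S. f w * fold rho w p v)"
  unfolding act_def using assms by (intro sum.mono_neutral_left) auto

lemma act_add:
  assumes "f \<in> carrier (free_algebra n)" "g \<in> carrier (free_algebra n)"
  shows "act p (\<lambda>w. f w + g w) = (\<lambda>v. act p f v + act p g v)"
proof
  fix v
  define S where "S = {w. f w \<noteq> 0} \<union> {w. g w \<noteq> 0}"
  have "finite S" using assms by (auto simp: S_def free_algebra_carrier)
  then show "act p (\<lambda>w. f w + g w) v = act p f v + act p g v"
    by (subst (1 2 3) act_superset[of S]) (auto simp: S_def sum.distrib algebra_simps)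
qed

lemma act_scale: "act p (\<lambda>w. c * f w) = (\<lambda>v. c * act p f v)"
  by (cases "c = 0") (auto simp: act_def sum_distrib_left algebra_simps)

lemma act_word_vec [simp]: "act p (word_vec w) = fold rho w p"
proof
  fix v
  have "act p (word_vec w) v = (\<Sum>w'\<in>{w}. word_vec w w' * fold rho w' p v)"
    by (intro act_superset) (auto simp: word_vec_def)
  then show "act p (word_vec w) v = fold rho w p v" by (simp add: word_vec_def)
qed

lemma act_zero [simp]: "act p (\<lambda>w. 0) = (\<lambda>v. 0)"
  by (simp add: act_def)

lemma act_add_left: "act (\<lambda>v. p v + p' v) f = (\<lambda>v. act p f v + act p' f v)"
  by (simp add: act_def fold_rho_add sum.distrib algebra_simps)

lemma act_scale_left: "act (\<lambda>v. c * p v) f = (\<lambda>v. c * act p f v)"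
  by (simp add: act_def fold_rho_scale sum_distrib_left algebra_simps)

lemma act_zero_left: "act (\<lambda>v. 0) f = (\<lambda>v. 0)"
  by (simp add: act_def fold_rho_zero)

text \<open>Both sides are bilinear in \<open>f\<close> and \<open>g\<close>, and for two words the
  claim is that folding over a concatenation is folding twice.\<close>

lemma act_mult:
  assumes f: "f \<in> carrier (free_algebra n)" and g: "g \<in> carrier (free_algebra n)"
  shows "act p (f \<otimes>\<^bsub>free_algebra n\<^esub> g) = act (act p f) g"
proof -
  interpret F: ring "free_algebra n :: (nat list \<Rightarrow> 'a) ring" by (rule ring_free_algebra)
  have word_vec: "act p (f \<otimes>\<^bsub>free_algebra n\<^esub> word_vec w) = act (act p f) (word_vec w)"
    if w: "set w \<subseteq> {..<n}" for w using f
  proof (induction f rule: free_algebra_induct)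
    case zero
    then show ?case by (simp add: mult_pointwise fold_rho_zero)
  next
    case (add f c w')
    have 1: "f \<otimes>\<^bsub>free_algebra n\<^esub> word_vec w \<in> carrier (free_algebra n)"
      using add(1) w by simp
    have 2: "(\<lambda>v. c * word_vec (w' @ w) v) \<in> carrier (free_algebra n)"
      using add(2) w by (intro scale_pointwise_closed) auto
    have 3: "(\<lambda>v. c * word_vec w' v) \<in> carrier (free_algebra n)"
      using add(2) by (intro scale_pointwise_closed) auto
    show ?case
      by (simp add: mult_pointwise word_vec_mult act_add[OF 1 2] act_add[OF add(1) 3] act_scale add(3)
          act_add_left act_scale_left fold_rho_add fold_rho_scale)
  qed
  show ?thesis using g
  proof (induction g rule: free_algebra_induct)
    case zero
    then show ?case by (simp add: mult_pointwise)
  next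
    case (add g c w)
    have 1: "f \<otimes>\<^bsub>free_algebra n\<^esub> g \<in> carrier (free_algebra n)"
      using add(1) f by simp
    have 2: "(\<lambda>v. c * (f \<otimes>\<^bsub>free_algebra n\<^esub> word_vec w) v) \<in> carrier (free_algebra n)"
      using add(2) f by (intro scale_pointwise_closed) auto
    have 3: "(\<lambda>v. c * word_vec w v) \<in> carrier (free_algebra n)"
      using add(2) by (intro scale_pointwise_closed) auto
    show ?case
      by (simp add: mult_pointwise act_add[OF 1 2] act_add[OF add(1) 3] act_scale add(3) word_vec[OF add(2)])
  qed
qed

lemma NV_ops:
  "(\<lambda>v. 0) \<in> NV" "\<lbrakk>p \<in> NV; p' \<in> NV\<rbrakk> \<Longrightarrow> (\<lambda>v. p v + p' v) \<in> NV" "p \<in> NV \<Longrightarrow> (\<lambda>v. c * p v) \<in> NV"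
  "nrm w \<Longrightarrow> delta w \<in> NV"
proof -
  assume "p \<in> NV" "p' \<in> NV"
  moreover have "{v. p v + p' v \<noteq> 0} \<subseteq> {v. p v \<noteq> 0} \<union> {v. p' v \<noteq> 0}" by auto
  ultimately show "(\<lambda>v. p v + p' v) \<in> NV" by (auto simp: NV_def elim: finite_subset)
next
  assume "p \<in> NV" then show "(\<lambda>v. c * p v) \<in> NV" by (auto simp: NV_def elim: rev_finite_subset)
qed (auto simp: NV_def delta_def)

lemma r_NV:
  assumes "p \<in> NV" shows "rx p \<in> NV" "rz p \<in> NV" "ru p \<in> NV"
proof -
  let ?S = "{v. p v \<noteq> 0}"
  have fin: "finite ?S" and n: "\<And>v. p v \<noteq> 0 \<Longrightarrow> nrm v" using assms by (auto simp: NV_def)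
  have x: "v \<in> (#) X ` ?S \<and> nrm v" if "rx p v \<noteq> 0" for v
    using that n by (cases "(p, v)" rule: rx.cases) (auto split: if_splits)
  have z: "v \<in> (#) Z ` ?S \<and> nrm v" if "rz p v \<noteq> 0" for v
    using that n by (cases "(p, v)" rule: rz.cases) (auto split: if_splits)
  have u: "v \<in> (#) U ` ?S \<union> (#) X ` ?S \<and> nrm v" if "ru p v \<noteq> 0" for v
    using that n by (cases "(p, v)" rule: ru.cases) (fastforce split: if_splits)+
  show "rx p \<in> NV" using x fin by (auto simp: NV_def intro: finite_subset[of _ "(#) X ` ?S"])
  show "rz p \<in> NV" using z fin by (auto simp: NV_def intro: finite_subset[of _ "(#) Z ` ?S"])
  show "ru p \<in> NV" using u fin by (auto simp: NV_def intro: finite_subset[of _ "(#) U ` ?S \<union> (#) X ` ?S"])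
qed

lemma rho_NV: "p \<in> NV \<Longrightarrow> rho i p \<in> NV"
  using NV_ops(2)[OF r_NV(3) NV_ops(3)[OF r_NV(1), of p "-1"], of p] by (simp add: rho_def r_NV NV_ops)

lemma fold_rho_NV: "p \<in> NV \<Longrightarrow> fold rho w p \<in> NV"
  by (induction w arbitrary: p) (auto intro: rho_NV)

lemma act_NV:
  assumes "f \<in> carrier (free_algebra n)" "p \<in> NV" shows "act p f \<in> NV"
  using assms(1)
proof (induction f rule: free_algebra_induct)
  case (add f c w)
  have "(\<lambda>v. c * word_vec w v) \<in> carrier (free_algebra n)"
    using add(2) by (intro scale_pointwise_closed) auto
  then show ?case using add(1,3) assms(2)
    by (simp add: act_add act_scale NV_ops fold_rho_NV)
qed (simp add: NV_ops)

lemma NV_induct [consumes 1, case_names zero add]: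
  assumes "p \<in> NV" "Q (\<lambda>w. 0)"
    and "\<And>p c w. \<lbrakk>p \<in> NV; nrm w; Q p\<rbrakk> \<Longrightarrow> Q (\<lambda>v. p v + c * delta w v)"
  shows "Q p"
proof -
  have "finite {w. p w \<noteq> 0}" "{w. p w \<noteq> 0} \<subseteq> {w. nrm w}" using assms(1) by (auto simp: NV_def)
  then show ?thesis
  proof (induction p rule: finsupp_induct)
    case (add p c w)
    then show ?case using assms(3)[of p w c] by (auto simp: NV_def delta_def)
  qed (rule assms(2))
qed

lemma r_delta:
  "rx (delta w) = (if ok X w then delta (X # w) else (\<lambda>v. 0))"
  "rz (delta w) = (if ok Z w then delta (Z # w) else (\<lambda>v. 0))"
  "ru (delta w) = (if ok U w then delta (U # w) else delta (X # w))"
proof -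
  show "rx (delta w) = (if ok X w then delta (X # w) else (\<lambda>v. 0))"
  proof
    fix v show "rx (delta w) v = (if ok X w then delta (X # w) else (\<lambda>v. 0)) v"
      by (cases "(delta w, v)" rule: rx.cases) (auto simp: delta_def)
  qed
  show "rz (delta w) = (if ok Z w then delta (Z # w) else (\<lambda>v. 0))"
  proof
    fix v show "rz (delta w) v = (if ok Z w then delta (Z # w) else (\<lambda>v. 0)) v"
      by (cases "(delta w, v)" rule: rz.cases) (auto simp: delta_def)
  qed
  show "ru (delta w) = (if ok U w then delta (U # w) else delta (X # w))"
  proof
    fix v show "ru (delta w) v = (if ok U w then delta (U # w) else delta (X # w)) v"
      by (cases "(delta w, v)" rule: ru.cases) (auto simp: delta_def ok_U_iff)
  qed
qed

section \<open>Normal words in the free algebra\<close>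

definition gu :: "nat list \<Rightarrow> 'k::field" where
  "gu = (\<lambda>w. word_vec [0] w + word_vec [1] w)"

fun glF :: "letter \<Rightarrow> nat list \<Rightarrow> 'k::field" where
  "glF X = word_vec [0]" | "glF U = gu" | "glF Z = word_vec [2]"

fun ev :: "letter list \<Rightarrow> nat list \<Rightarrow> 'k::field" where
  "ev [] = word_vec []"
| "ev (c # w) = ev w \<otimes>\<^bsub>free_algebra 3\<^esub> glF c"

lemma gu_closed [simp]: "gu \<in> carrier (free_algebra 3)"
  unfolding gu_def by (intro add_pointwise_closed) auto

lemma glF_closed [simp]: "glF c \<in> carrier (free_algebra 3)"
  by (cases c) auto

lemma ev_closed [simp]: "(ev w :: nat list \<Rightarrow> 'k::field) \<in> carrier (free_algebra 3)"
proof -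
  interpret F: ring "free_algebra 3 :: (nat list \<Rightarrow> 'k) ring" by (rule ring_free_algebra)
  show ?thesis by (induction w) auto
qed

lemma act_glF: "act p (glF c) = (case c of X \<Rightarrow> rx p | U \<Rightarrow> ru p | Z \<Rightarrow> rz p)"
proof (cases c)
  case U
  have "act p gu = (\<lambda>v. act p (word_vec [0]) v + act p (word_vec [1]) v)"
    unfolding gu_def by (rule act_add[of _ 3]) auto
  then show ?thesis using U by (simp add: rho_def)
qed (simp_all add: rho_def)

definition psi :: "(letter list \<Rightarrow> 'k::field) \<Rightarrow> nat list \<Rightarrow> 'k" where
  "psi p = (\<lambda>v. \<Sum>w\<in>{w. p w \<noteq> 0}. p w * ev w v)"

lemma psi_superset:
  assumes "finite S" "{w. p w \<noteq> 0} \<subseteq> S"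
  shows "psi p v = (\<Sum>w\<in>S. p w * ev w v)"
  unfolding psi_def using assms by (intro sum.mono_neutral_left) auto

lemma psi_add:
  assumes "p \<in> NV" "p' \<in> NV"
  shows "psi (\<lambda>w. p w + p' w) = (\<lambda>v. psi p v + psi p' v)"
proof
  fix v
  define S where "S = {w. p w \<noteq> 0} \<union> {w. p' w \<noteq> 0}"
  have "finite S" using assms by (auto simp: S_def NV_def)
  then show "psi (\<lambda>w. p w + p' w) v = psi p v + psi p' v"
    by (subst (1 2 3) psi_superset[of S]) (auto simp: S_def sum.distrib algebra_simps)
qed

lemma psi_scale: "psi (\<lambda>w. c * p w) = (\<lambda>v. c * psi p v)"
  by (cases "c = 0") (auto simp: psi_def sum_distrib_left algebra_simps)

lemma psi_delta [simp]: "psi (delta w) = ev w"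
proof
  fix v
  have "psi (delta w) v = (\<Sum>w'\<in>{w}. delta w w' * ev w' v)"
    by (intro psi_superset) (auto simp: delta_def)
  then show "psi (delta w) v = ev w v" by (simp add: delta_def)
qed

lemma psi_zero [simp]: "psi (\<lambda>w. 0) = (\<lambda>v. 0)"
  by (simp add: psi_def)

lemma psi_closed: "p \<in> NV \<Longrightarrow> psi p \<in> carrier (free_algebra 3)"
proof (induction p rule: NV_induct)
  case (add p c w)
  then show ?case
    by (simp add: psi_add NV_ops psi_scale add_pointwise_closed scale_pointwise_closed)
qed (simp add: free_algebra_carrier)

text \<open>Acting on the empty word gives the coefficient vector of the normal form of
  \<open>f\<close>.\<close>

definition phi :: "(nat list \<Rightarrow> 'k::field) \<Rightarrow> letter list \<Rightarrow> 'k" where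
  "phi = act (delta [])"

text \<open>Along a normal word every letter is simply appended, and no rewriting takes place. This
  is the independence of the normal words.\<close>

lemma phi_ev: "nrm w \<Longrightarrow> phi (ev w) = delta w"
proof (induction w)
  case (Cons c w)
  then show ?case
    by (simp add: phi_def act_mult[of _ 3] act_glF del: glF.simps) (cases c, auto simp: r_delta)
qed (simp add: phi_def)

lemma phi_psi: "p \<in> NV \<Longrightarrow> phi (psi p) = p"
proof (induction p rule: NV_induct)
  case (add p c w)
  have "phi (psi (\<lambda>v. p v + c * delta w v)) = phi (\<lambda>v. psi p v + c * ev w v)"
    using add by (simp add: psi_add NV_ops psi_scale)
  also have "\<dots> = (\<lambda>v. phi (psi p) v + c * phi (ev w) v)"
    using add by (simp add: phi_def act_add[of _ 3] psi_closed scale_pointwise_closed act_scale)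
  finally show ?case using add by (simp add: phi_ev)
qed (simp add: phi_def)

lemma rho_Nil: "rho i p [] = 0"
  by (simp add: rho_def)

lemma fold_rho_Nil: "fold rho w p [] = (if w = [] then p [] else 0)"
  by (induction w rule: rev_induct) (auto simp: rho_Nil)

text \<open>Every \<open>rho i\<close> produces words with at least one letter, so only the constant
  term of \<open>f\<close> reaches the empty word.\<close>

lemma act_Nil:
  assumes "f \<in> carrier (free_algebra n)"
  shows "act p f [] = f [] * p []"
proof -
  have "act p f [] = (\<Sum>w\<in>insert [] {w. f w \<noteq> 0}. f w * fold rho w p [])"
    using assms by (intro act_superset) (auto simp: free_algebra_carrier)
  also have "\<dots> = (\<Sum>w\<in>insert [] {w. f w \<noteq> 0}. if w = [] then f [] * p [] else 0)"
    by (intro sum.cong) (auto simp: fold_rho_Nil)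
  finally show ?thesis using assms by (simp add: free_algebra_carrier)
qed

text \<open>The annihilator of a right module, hence two-sided. For closure under left factors it is
  essential that \<open>p\<close> ranges over all functions: a left factor first moves
  \<open>p\<close> elsewhere.\<close>

definition kernel_ideal :: "(nat list \<Rightarrow> 'k::field) set" where
  "kernel_ideal = {f \<in> carrier (free_algebra 3). \<forall>p. act p f = (\<lambda>v. 0)}"

lemma kernel_ideal: "ideal kernel_ideal (free_algebra 3 :: (nat list \<Rightarrow> 'k::field) ring)"
proof -
  interpret F: ring "free_algebra 3 :: (nat list \<Rightarrow> 'k) ring" by (rule ring_free_algebra)
  have z: "(\<lambda>w. 0) \<in> carrier (free_algebra 3 :: (nat list \<Rightarrow> 'k) ring)" by (simp add: free_algebra_carrier)
  show ?thesis
  proof (rule idealI)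
    show "subgroup (kernel_ideal :: (nat list \<Rightarrow> 'k) set) (add_monoid (free_algebra 3))"
    proof (rule F.add.subgroupI)
      show "(kernel_ideal :: (nat list \<Rightarrow> 'k) set) \<noteq> {}" using z by (auto simp: kernel_ideal_def)
      fix f :: "nat list \<Rightarrow> 'k" assume f: "f \<in> kernel_ideal"
      then have fc: "f \<in> carrier (free_algebra 3)" by (simp add: kernel_ideal_def)
      show "\<ominus>\<^bsub>free_algebra 3\<^esub> f \<in> kernel_ideal"
        using f fc act_scale[of _ "-1" f] F.a_inv_closed[OF fc]
        by (simp add: free_algebra_uminus kernel_ideal_def)
      fix g :: "nat list \<Rightarrow> 'k" assume "g \<in> kernel_ideal"
      then show "f \<oplus>\<^bsub>free_algebra 3\<^esub> g \<in> kernel_ideal"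
        using f fc F.a_closed[of f g] by (simp add: kernel_ideal_def free_algebra_simps(1) act_add[of _ 3])
    qed (auto simp: kernel_ideal_def)
  qed (auto simp: kernel_ideal_def ring_free_algebra act_mult[of _ 3] act_zero_left)
qed

definition relR :: "(nat list \<Rightarrow> 'k::field) set" where
  "relR = ring.Span (free_algebra 3) (range scalar)
     [gen 0 \<otimes>\<^bsub>free_algebra 3\<^esub> gen 0 \<oplus>\<^bsub>free_algebra 3\<^esub> gen 1 \<otimes>\<^bsub>free_algebra 3\<^esub> gen 0,
      gen 0 \<otimes>\<^bsub>free_algebra 3\<^esub> gen 2, gen 2 \<otimes>\<^bsub>free_algebra 3\<^esub> gen 1]"

lemma relR_iff:
  "f \<in> relR \<longleftrightarrow> (\<exists>a b c. f = (\<lambda>w. a * (word_vec [0,0] w + word_vec [1,0] w) + (b * word_vec [0,2] w + c * word_vec [2,1] w)))"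
  for f :: "nat list \<Rightarrow> 'k::field"
proof -
  interpret F: ring "free_algebra 3 :: (nat list \<Rightarrow> 'k) ring" by (rule ring_free_algebra)
  have step: "f \<in> F.line_extension (range scalar) v S \<longleftrightarrow> (\<exists>a. \<exists>g\<in>S. f = (\<lambda>w. a * v w + g w))"
    for f v :: "nat list \<Rightarrow> 'k" and S
    by (auto simp: F.line_extension_mem_iff scalar_mult free_algebra_simps(1))
  have "f \<in> relR \<longleftrightarrow> f \<in> F.line_extension (range scalar) (\<lambda>w. word_vec [0,0] w + word_vec [1,0] w)
      (F.line_extension (range scalar) (word_vec [0,2]) (F.line_extension (range scalar) (word_vec [2,1]) {\<lambda>w. 0}))"
    by (simp add: relR_def gen_eq_word_vec word_vec_mult free_algebra_simps(1,2))
  also have "\<dots> \<longleftrightarrow> (\<exists>a b c. f = (\<lambda>w. a * (word_vec [0,0] w + word_vec [1,0] w) + (b * word_vec [0,2] w + c * word_vec [2,1] w)))"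
    unfolding step Bex_def singleton_iff by ((simp; fail) | (simp; blast) | (simp; metis))
  finally show ?thesis .
qed

lemma relR_carrier: "relR \<subseteq> carrier (free_algebra 3)"
  unfolding relR_iff subset_iff
  by (auto intro!: add_pointwise_closed scale_pointwise_closed)

lemma relR_gens: "(\<lambda>w. word_vec [0,0] w + word_vec [1,0] w) \<in> relR" "word_vec [0,2] \<in> relR" "word_vec [2,1] \<in> relR"
  unfolding relR_iff
  by (rule exI[of _ 1], rule exI[of _ 0], rule exI[of _ 0], simp)
     (rule exI[of _ 0], rule exI[of _ 1], rule exI[of _ 0], simp,
      rule exI[of _ 0], rule exI[of _ 0], rule exI[of _ 1], simp)

lemma relR_kernel: "relR \<subseteq> kernel_ideal"
proof
  fix f :: "nat list \<Rightarrow> 'a" assume f: "f \<in> relR"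
  have 1: "act p (\<lambda>w. word_vec [0,0] w + word_vec [1,0] w) = (\<lambda>v. 0 :: 'a)" for p
  proof -
    have "act p (\<lambda>w. word_vec [0,0] w + word_vec [1,0] w) = (\<lambda>v. rx (rx p) v + rx (\<lambda>v. ru p v - rx p v) v)"
      by (subst act_add[of _ 3]) (auto simp: rho_def)
    also have "\<dots> = rx (\<lambda>v. rx p v + (ru p v - rx p v))" by (simp only: r_add)
    also have "\<dots> = (\<lambda>v. 0)" by (simp add: rx_ru)
    finally show ?thesis .
  qed
  have 2: "act p (word_vec [0,2]) = (\<lambda>v. 0 :: 'a)" "act p (word_vec [2,1]) = (\<lambda>v. 0 :: 'a)" for p
    by (simp_all add: rho_def rz_rx ru_rz)
  obtain a b c where e: "f = (\<lambda>w. a * (word_vec [0,0] w + word_vec [1,0] w) + (b * word_vec [0,2] w + c * word_vec [2,1] w))"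
    using f unfolding relR_iff by blast
  have c: "(\<lambda>w. a * (word_vec [0,0] w + word_vec [1,0] w)) \<in> carrier (free_algebra 3)"
    "(\<lambda>w. b * word_vec [0,2] w) \<in> carrier (free_algebra 3)" "(\<lambda>w. c * word_vec [2,1] w) \<in> carrier (free_algebra 3)"
    by (auto intro!: scale_pointwise_closed add_pointwise_closed)
  have "act p f = (\<lambda>v. 0)" for p
    unfolding e
    by (subst act_add[OF c(1) add_pointwise_closed[OF c(2,3)]], subst act_add[OF c(2,3)])
      (simp only: act_scale 1 2 mult_zero_right add_0_right)
  then show "f \<in> kernel_ideal" using f relR_carrier by (auto simp: kernel_ideal_def)
qed

lemma ideal_quadratic_ideal:
  "S \<subseteq> carrier (free_algebra n) \<Longrightarrow> ideal (quadratic_ideal n S) (free_algebra n)"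
  unfolding quadratic_ideal_def by (rule ring.genideal_ideal[OF ring_free_algebra])

lemma quadratic_ideal_minimal:
  "\<lbrakk>ideal J (free_algebra n); S \<subseteq> J\<rbrakk> \<Longrightarrow> quadratic_ideal n S \<subseteq> J"
  unfolding quadratic_ideal_def by (rule ring.genideal_minimal[OF ring_free_algebra])

lemma quadratic_ideal_self:
  "S \<subseteq> carrier (free_algebra n) \<Longrightarrow> S \<subseteq> quadratic_ideal n S"
  unfolding quadratic_ideal_def by (rule ring.genideal_self[OF ring_free_algebra])

section \<open>The quotient algebra in normal form coordinates\<close>

locale example_algebra =
  fixes I :: "(nat list \<Rightarrow> 'k::field) set"
  assumes I_eq: "I = quadratic_ideal 3 relR"

sublocale example_algebra \<subseteq> free_algebra_quotient 3 I
  by (rule free_algebra_quotient.intro) (simp add: I_eq ideal_quadratic_ideal[OF relR_carrier])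

context example_algebra
begin

definition xq :: "(nat list \<Rightarrow> 'k) set" where "xq = q 3 I (word_vec [0])"
definition yq :: "(nat list \<Rightarrow> 'k) set" where "yq = q 3 I (word_vec [1])"
definition zq :: "(nat list \<Rightarrow> 'k) set" where "zq = q 3 I (word_vec [2])"
definition uq :: "(nat list \<Rightarrow> 'k) set" where "uq = q 3 I gu"

lemma gens_closed [simp]: "xq \<in> carrier A" "yq \<in> carrier A" "zq \<in> carrier A" "uq \<in> carrier A"
  by (simp_all add: xq_def yq_def zq_def uq_def)

lemma uq_eq: "uq = xq \<oplus>\<^bsub>A\<^esub> yq"
  by (simp add: uq_def xq_def yq_def gu_def q_add)

lemma yq_eq: "yq = uq \<ominus>\<^bsub>A\<^esub> xq"
  by (simp add: uq_eq A.eq_diff_eq A.a_comm)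

lemma q_rel: "f \<in> relR \<Longrightarrow> q 3 I f = \<zero>\<^bsub>A\<^esub>"
  using quadratic_ideal_self[OF relR_carrier] relR_carrier q_eq_zero_iff by (auto simp: I_eq)

lemma relations: "uq \<otimes>\<^bsub>A\<^esub> xq = \<zero>\<^bsub>A\<^esub>" "xq \<otimes>\<^bsub>A\<^esub> zq = \<zero>\<^bsub>A\<^esub>" "zq \<otimes>\<^bsub>A\<^esub> yq = \<zero>\<^bsub>A\<^esub>"
  "zq \<otimes>\<^bsub>A\<^esub> uq = zq \<otimes>\<^bsub>A\<^esub> xq"
proof -
  have "uq \<otimes>\<^bsub>A\<^esub> xq = q 3 I (\<lambda>w. word_vec [0,0] w + word_vec [1,0] w)"
    by (simp add: uq_def xq_def q_mult[symmetric] gu_def mult_pointwise word_vec_mult add_pointwise_closed)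
  then show "uq \<otimes>\<^bsub>A\<^esub> xq = \<zero>\<^bsub>A\<^esub>" by (simp add: q_rel relR_gens[simplified])
  show "xq \<otimes>\<^bsub>A\<^esub> zq = \<zero>\<^bsub>A\<^esub>" "zq \<otimes>\<^bsub>A\<^esub> yq = \<zero>\<^bsub>A\<^esub>"
    by (simp_all add: xq_def yq_def zq_def q_mult[symmetric] word_vec_mult q_rel relR_gens[simplified])
  then show "zq \<otimes>\<^bsub>A\<^esub> uq = zq \<otimes>\<^bsub>A\<^esub> xq"
    by (simp add: uq_eq A.r_distr)
qed

definition Psi :: "(letter list \<Rightarrow> 'k) \<Rightarrow> (nat list \<Rightarrow> 'k) set" where
  "Psi p = q 3 I (psi p)"

lemma Psi_closed [simp]: "p \<in> NV \<Longrightarrow> Psi p \<in> carrier A"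
  by (simp add: Psi_def psi_closed)

lemma Psi_add: "\<lbrakk>p \<in> NV; p' \<in> NV\<rbrakk> \<Longrightarrow> Psi (\<lambda>v. p v + p' v) = Psi p \<oplus>\<^bsub>A\<^esub> Psi p'"
  by (simp add: Psi_def psi_add q_add psi_closed)

lemma Psi_scale: "p \<in> NV \<Longrightarrow> Psi (\<lambda>v. c * p v) = q 3 I (scalar c) \<otimes>\<^bsub>A\<^esub> Psi p"
  by (simp add: Psi_def psi_scale q_scale psi_closed)

lemma Psi_zero [simp]: "Psi (\<lambda>v. 0) = \<zero>\<^bsub>A\<^esub>"
  by (simp add: Psi_def q_zero)

definition gl :: "letter \<Rightarrow> (nat list \<Rightarrow> 'k) set" where "gl c = q 3 I (glF c)"

lemma gl_simps: "gl X = xq" "gl U = uq" "gl Z = zq"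
  by (simp_all add: gl_def xq_def uq_def zq_def)

definition E :: "letter list \<Rightarrow> (nat list \<Rightarrow> 'k) set" where "E w = q 3 I (ev w)"

lemma E_closed [simp]: "E w \<in> carrier A" by (simp add: E_def)

lemma E_Cons: "E (c # w) = E w \<otimes>\<^bsub>A\<^esub> gl c"
  by (simp add: E_def gl_def q_mult)

lemma E_mult:
  "\<not> ok X w \<Longrightarrow> E w \<otimes>\<^bsub>A\<^esub> xq = \<zero>\<^bsub>A\<^esub>" "\<not> ok Z w \<Longrightarrow> E w \<otimes>\<^bsub>A\<^esub> zq = \<zero>\<^bsub>A\<^esub>"
  "\<not> ok U w \<Longrightarrow> E w \<otimes>\<^bsub>A\<^esub> uq = E w \<otimes>\<^bsub>A\<^esub> xq"
proof -
  assume "\<not> ok X w"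
  then obtain v where "w = U # v \<or> w = X # Z # v" by (auto simp: ok_X_iff)
  then show "E w \<otimes>\<^bsub>A\<^esub> xq = \<zero>\<^bsub>A\<^esub>"
  proof
    assume "w = U # v"
    then show ?thesis by (simp add: E_Cons gl_simps A.m_assoc relations)
  next
    assume w: "w = X # Z # v"
    \<comment> \<open>Replacing \<open>zx\<close> by \<open>zu\<close> exposes \<open>ux\<close>:
      this is the origin of the forbidden word \<open>zxx\<close>.\<close>
    have "E w \<otimes>\<^bsub>A\<^esub> xq = E v \<otimes>\<^bsub>A\<^esub> (zq \<otimes>\<^bsub>A\<^esub> xq) \<otimes>\<^bsub>A\<^esub> xq" by (simp add: w E_Cons gl_simps A.m_assoc)
    also have "\<dots> = E v \<otimes>\<^bsub>A\<^esub> (zq \<otimes>\<^bsub>A\<^esub> uq) \<otimes>\<^bsub>A\<^esub> xq" by (simp add: relations(4))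
    also have "\<dots> = \<zero>\<^bsub>A\<^esub>" by (simp add: A.m_assoc relations(1))
    finally show ?thesis .
  qed
next
  assume "\<not> ok Z w"
  then obtain v where "w = X # v" by (auto simp: ok_Z_iff)
  then show "E w \<otimes>\<^bsub>A\<^esub> zq = \<zero>\<^bsub>A\<^esub>" by (simp add: E_Cons gl_simps A.m_assoc relations)
next
  assume "\<not> ok U w"
  then obtain v where "w = Z # v" by (auto simp: ok_U_iff)
  then show "E w \<otimes>\<^bsub>A\<^esub> uq = E w \<otimes>\<^bsub>A\<^esub> xq" by (simp add: E_Cons gl_simps A.m_assoc relations)
qed

lemma Psi_delta [simp]: "Psi (delta w) = E w"
  by (simp add: Psi_def E_def)

text \<open>On a normal word, multiplication by a generator either appends a letter or is governed
  by \<open>E_mult\<close>, and \<open>r_delta\<close> describes the operators in the same way;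
  linearity does the rest.\<close>

lemma Psi_mult:
  assumes "p \<in> NV"
  shows "Psi p \<otimes>\<^bsub>A\<^esub> xq = Psi (rx p) \<and> Psi p \<otimes>\<^bsub>A\<^esub> zq = Psi (rz p) \<and> Psi p \<otimes>\<^bsub>A\<^esub> uq = Psi (ru p)"
  using assms
proof (induction p rule: NV_induct)
  case zero
  have "rx (\<lambda>v. 0) = (\<lambda>v. 0 :: 'k)" "rz (\<lambda>v. 0) = (\<lambda>v. 0 :: 'k)" "ru (\<lambda>v. 0) = (\<lambda>v. 0 :: 'k)"
    using r_scale[of 0] by simp_all
  then show ?case by simp
next
  case (add p c w)
  have r: "rx (delta w) \<in> (NV :: (_ \<Rightarrow> 'k) set)" "rz (delta w) \<in> (NV :: (_ \<Rightarrow> 'k) set)" "ru (delta w) \<in> (NV :: (_ \<Rightarrow> 'k) set)"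
    using add by (auto intro!: r_NV NV_ops)
  have d: "E w \<otimes>\<^bsub>A\<^esub> xq = Psi (rx (delta w))" "E w \<otimes>\<^bsub>A\<^esub> zq = Psi (rz (delta w))" "E w \<otimes>\<^bsub>A\<^esub> uq = Psi (ru (delta w))"
    by (auto simp: r_delta E_Cons gl_simps E_mult)
  note [simp] = add(1) NV_ops(4)[OF add(2)] r r_NV[OF add(1)]
  have "Psi (\<lambda>v. p v + c * delta w v) = Psi p \<oplus>\<^bsub>A\<^esub> q 3 I (scalar c) \<otimes>\<^bsub>A\<^esub> E w"
    by (simp add: Psi_add Psi_scale NV_ops)
  then show ?case
    using add(3) by (simp add: r_add r_scale Psi_add Psi_scale NV_ops A.l_distr A.m_assoc d)
qed

text \<open>The normal words span the quotient. Since \<open>Psi\<close> is compatible with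
  multiplication by the generators, the claim for words is an induction on the last letter.\<close>

lemma q_eq_Psi:
  assumes "f \<in> carrier FA" shows "q 3 I f = Psi (phi f)"
proof -
  have w: "q 3 I (word_vec w) = Psi (fold rho w (delta []))" if "set w \<subseteq> {..<3}" for w
    using that
  proof (induction w rule: rev_induct)
    case Nil
    then show ?case by (simp add: E_def)
  next
    case (snoc i w)
    define P :: "letter list \<Rightarrow> 'k" where "P = fold rho w (delta [])"
    have P: "P \<in> NV" unfolding P_def by (intro fold_rho_NV NV_ops) simp
    have "q 3 I (word_vec (w @ [i])) = q 3 I (word_vec w) \<otimes>\<^bsub>A\<^esub> q 3 I (word_vec [i])"
      using snoc(2) q_mult[of "word_vec w" "word_vec [i]"] by (simp add: word_vec_mult)
    also have "\<dots> = Psi P \<otimes>\<^bsub>A\<^esub> q 3 I (word_vec [i])" using snoc by (simp add: P_def)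
    also have "\<dots> = Psi (rho i P)"
    proof -
      consider "i = 0" | "i = 1" | "i = 2" using snoc by force
      then show ?thesis
      proof cases
        case 1
        then show ?thesis using Psi_mult[OF P] by (simp add: rho_def xq_def[symmetric])
      next
        case 2
        have "Psi (rho 1 P) = Psi (\<lambda>v. ru P v + (-1) * rx P v)" by (simp add: rho_def)
        also have "\<dots> = Psi (ru P) \<oplus>\<^bsub>A\<^esub> q 3 I (scalar (-1)) \<otimes>\<^bsub>A\<^esub> Psi (rx P)"
          by (subst Psi_scale[symmetric], rule r_NV[OF P], rule Psi_add) (intro r_NV NV_ops P)+
        also have "\<dots> = Psi P \<otimes>\<^bsub>A\<^esub> yq"
        proof -
          show ?thesis using Psi_mult[OF P] r_NV[OF P] P q_scalar_minus_1
            by (simp add: yq_eq A.minus_eq A.r_distr A.r_minus A.l_minus)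
        qed
        finally show ?thesis using 2 by (simp add: yq_def)
      next
        case 3
        then show ?thesis using Psi_mult[OF P] by (simp add: rho_def zq_def[symmetric])
      qed
    qed
    finally show ?case by (simp add: P_def)
  qed
  show ?thesis using assms
  proof (induction f rule: free_algebra_induct)
    case zero
    then show ?case by (simp add: phi_def q_zero)
  next
    case (add f c v)
    have P: "fold rho v (delta []) \<in> (NV :: (_ \<Rightarrow> 'k) set)" by (intro fold_rho_NV NV_ops) simp
    have "phi (\<lambda>w. f w + c * word_vec v w) = (\<lambda>w. phi f w + c * fold rho v (delta []) w)"
      using add by (simp add: phi_def act_add[of _ 3] scale_pointwise_closed act_scale)
    moreover have "phi f \<in> NV" unfolding phi_def by (intro act_NV[OF add(1)] NV_ops) simp
    ultimately show ?case using add P w[OF add(2)]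
      by (simp add: q_add scale_pointwise_closed q_scale Psi_add Psi_scale NV_ops)
  qed
qed

lemma phi_ideal: "f \<in> I \<Longrightarrow> phi f = (\<lambda>v. 0)"
  using quadratic_ideal_minimal[OF kernel_ideal relR_kernel] by (auto simp: I_eq kernel_ideal_def phi_def)

text \<open>The inverse of \<open>Psi\<close>. The choice of a representative does not matter
  because \<open>phi\<close> vanishes on \<open>I\<close>.\<close>

definition Phi :: "(nat list \<Rightarrow> 'k) set \<Rightarrow> letter list \<Rightarrow> 'k" where
  "Phi a = phi (SOME f. f \<in> carrier FA \<and> q 3 I f = a)"

lemma Phi_q: assumes "f \<in> carrier FA" shows "Phi (q 3 I f) = phi f"
proof -
  define g where "g = (SOME g. g \<in> carrier FA \<and> q 3 I g = q 3 I f)"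
  have "g \<in> carrier FA \<and> q 3 I g = q 3 I f" unfolding g_def by (rule someI[of _ f]) (use assms in simp)
  then have g: "g \<in> carrier FA" and "(\<lambda>w. g w - f w) \<in> I" using q_eq_iff assms by auto
  then have "phi (\<lambda>w. g w - f w) = (\<lambda>v. 0)" by (intro phi_ideal)
  moreover have "phi (\<lambda>w. g w - f w) = (\<lambda>v. phi g v - phi f v)"
    unfolding phi_def using act_add[OF g scale_pointwise_closed[OF assms, of "-1"]] act_scale[of _ "-1" f] by simp
  ultimately have "phi g = phi f" by (simp add: fun_eq_iff)
  then show ?thesis by (simp add: Phi_def g_def)
qed

lemma Phi_NV: "a \<in> carrier A \<Longrightarrow> Phi a \<in> NV"
  by (erule A_cases) (simp add: Phi_q phi_def act_NV[of _ 3] NV_ops)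

lemma Psi_Phi:
  assumes "a \<in> carrier A" shows "Psi (Phi a) = a"
proof -
  obtain f where f: "f \<in> carrier FA" "a = q 3 I f" using assms by (rule A_cases)
  have "Psi (Phi (q 3 I f)) = Psi (phi f)" by (simp only: Phi_q[OF f(1)])
  also have "\<dots> = q 3 I f" by (rule q_eq_Psi[OF f(1), symmetric])
  finally show ?thesis using f(2) by simp
qed

lemma Phi_Psi: "p \<in> NV \<Longrightarrow> Phi (Psi p) = p"
  by (simp add: Psi_def Phi_q psi_closed phi_psi)

lemma Phi_eqI: "\<lbrakk>a \<in> carrier A; b \<in> carrier A; Phi a = Phi b\<rbrakk> \<Longrightarrow> a = b"
  using Psi_Phi by metis

lemma Phi_add: "\<lbrakk>a \<in> carrier A; b \<in> carrier A\<rbrakk> \<Longrightarrow> Phi (a \<oplus>\<^bsub>A\<^esub> b) = (\<lambda>v. Phi a v + Phi b v)"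
  using Phi_Psi[of "\<lambda>v. Phi a v + Phi b v"] Psi_add[of "Phi a" "Phi b"] by (simp add: Psi_Phi NV_ops Phi_NV)

lemma Phi_scale: "a \<in> carrier A \<Longrightarrow> Phi (q 3 I (scalar c) \<otimes>\<^bsub>A\<^esub> a) = (\<lambda>v. c * Phi a v)"
  using Phi_Psi[of "\<lambda>v. c * Phi a v"] Psi_scale[of "Phi a" c] by (simp add: Psi_Phi NV_ops Phi_NV)

lemma Phi_zero: "Phi \<zero>\<^bsub>A\<^esub> = (\<lambda>v. 0)"
  using Phi_Psi[of "\<lambda>v. 0"] by (simp add: NV_ops)

lemma Phi_one: "Phi \<one>\<^bsub>A\<^esub> = delta []"
  using Phi_q[of "word_vec []"] by (simp add: q_one phi_def)

lemma Phi_minus: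
  assumes "a \<in> carrier A" "b \<in> carrier A" shows "Phi (a \<ominus>\<^bsub>A\<^esub> b) = (\<lambda>v. Phi a v - Phi b v)"
proof -
  have "Phi (a \<ominus>\<^bsub>A\<^esub> b \<oplus>\<^bsub>A\<^esub> b) = (\<lambda>v. Phi (a \<ominus>\<^bsub>A\<^esub> b) v + Phi b v)" using assms by (intro Phi_add) auto
  moreover have "a \<ominus>\<^bsub>A\<^esub> b \<oplus>\<^bsub>A\<^esub> b = a" using assms by (simp add: A.minus_eq A.a_assoc A.l_neg)
  ultimately show ?thesis by (simp add: fun_eq_iff)
qed

lemma Phi_mult:
  assumes "a \<in> carrier A"
  shows "Phi (a \<otimes>\<^bsub>A\<^esub> xq) = rx (Phi a)" "Phi (a \<otimes>\<^bsub>A\<^esub> zq) = rz (Phi a)" "Phi (a \<otimes>\<^bsub>A\<^esub> uq) = ru (Phi a)"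
  using Psi_mult[OF Phi_NV[OF assms]] Phi_Psi r_NV[OF Phi_NV[OF assms]] by (simp_all add: Psi_Phi[OF assms])

end

section \<open>Leading terms and syzygies of normal form vectors\<close>

definition bounded :: "nat \<Rightarrow> (letter list \<Rightarrow> 'k::field) \<Rightarrow> bool" where
  "bounded n p \<longleftrightarrow> (\<forall>w. p w \<noteq> 0 \<longrightarrow> length w < n)"

definition strip :: "letter \<Rightarrow> (letter list \<Rightarrow> 'k::field) \<Rightarrow> letter list \<Rightarrow> 'k" where
  "strip c p = (\<lambda>w. p (c # w))"

text \<open>A candidate for a preimage under \<open>ru\<close>. A word ending in \<open>z\<close>
  has no normal extension by \<open>u\<close>; its image under \<open>ru\<close> is found at the
  extension by \<open>x\<close> instead.\<close>

definition strip_u :: "(letter list \<Rightarrow> 'k::field) \<Rightarrow> letter list \<Rightarrow> 'k" where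
  "strip_u p = (\<lambda>w. if ok U w then p (U # w) else p (X # w))"

lemma NV_nrm: "\<lbrakk>p \<in> NV; \<not> nrm w\<rbrakk> \<Longrightarrow> p w = 0"
  by (auto simp: NV_def)

lemma strip_NV:
  assumes "p \<in> NV" shows "strip c p \<in> NV" "strip_u p \<in> NV"
proof -
  have fin: "finite (tl ` {w. p w \<noteq> 0})" using assms by (simp add: NV_def)
  have "{w. strip c p w \<noteq> 0} \<subseteq> tl ` {w. p w \<noteq> 0}" for c by (force simp: strip_def)
  then have "finite {w. strip c p w \<noteq> 0}" for c using fin by (rule finite_subset)
  then show "strip c p \<in> NV" using assms by (auto simp: NV_def strip_def dest!: spec)
  have "{w. strip_u p w \<noteq> 0} \<subseteq> tl ` {w. p w \<noteq> 0}" by (force simp: strip_u_def split: if_splits)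
  then have "finite {w. strip_u p w \<noteq> 0}" using fin by (rule finite_subset)
  moreover have "nrm w" if "strip_u p w \<noteq> 0" for w
  proof -
    have "nrm (U # w) \<or> nrm (X # w)" using that assms by (auto simp: NV_def strip_u_def split: if_splits)
    then show ?thesis by auto
  qed
  ultimately show "strip_u p \<in> NV" by (simp add: NV_def)
qed

lemma strip_bounded:
  assumes "bounded (Suc n) p" shows "bounded n (strip c p)" "bounded n (strip_u p)"
  using assms by (fastforce simp: bounded_def strip_def strip_u_def split: if_splits)+

lemma r_apply:
  "ru p (U # w) = (if ok U w then p w else 0)" "ok U w \<Longrightarrow> ru p (X # w) = 0" "\<not> ok U w \<Longrightarrow> ru p (X # w) = p w"
  "ru p (Z # w) = 0" "rx p (U # w) = 0" "rx p (Z # w) = 0" "rz p (U # w) = 0" "rz p (X # w) = 0"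
  "ru p [] = 0" "rx p [] = 0" "rz p [] = 0"
  by (auto simp: ok_U_iff) (cases "(p, X # w)" rule: ru.cases; auto)

text \<open>The words ending in \<open>u\<close> or in \<open>zx\<close> are those reached by right
  multiplication by \<open>u\<close>; the composite is the projection onto them.\<close>

lemma ru_strip_u:
  assumes p: "p \<in> NV"
  shows "ru (strip_u p) v = (case v of [] \<Rightarrow> 0 | c # w \<Rightarrow> if c = U \<or> c = X \<and> \<not> ok U w then p v else 0)"
proof (cases v)
  case (Cons c w)
  show ?thesis
  proof (cases c)
    case X
    then show ?thesis using Cons by (cases "ok U w") (auto simp: r_apply strip_u_def)
  next
    case U
    then show ?thesis using Cons NV_nrm[OF p, of "U # w"] by (auto simp: r_apply strip_u_def)
  qed (use Cons in \<open>simp add: r_apply\<close>)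
qed (simp add: r_apply)

text \<open>Appending \<open>x\<close> is injective on the words that admit it, and those that do
  not admit it end in \<open>u\<close> or in \<open>zx\<close>, which is the range of right
  multiplication by \<open>u\<close>.\<close>

lemma ker_rx:
  assumes p: "p \<in> NV" and "rx p = (\<lambda>v. 0)"
  shows "p = ru (strip_u p)"
proof
  fix v
  have *: "p v = 0" if "ok X v" using fun_cong[OF assms(2), of "X # v"] that by simp
  show "p v = ru (strip_u p) v"
  proof (cases "ok X v")
    case True
    then have "\<not> (\<exists>w. v = U # w) \<and> \<not> (\<exists>w. v = X # w \<and> \<not> ok U w)" by (auto simp: ok_X_iff ok_U_iff)
    then show ?thesis using *[OF True] by (auto simp: ru_strip_u[OF p] split: list.split)
  next
    case False
    then show ?thesis by (auto simp: ru_strip_u[OF p] ok_X_iff ok_U_iff)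
  qed
qed

text \<open>The words that do not admit \<open>z\<close> are those ending in \<open>x\<close>. By
  normality of \<open>p\<close>, removing this \<open>x\<close> and appending it again recovers the
  coefficient.\<close>

lemma ker_rz:
  assumes p: "p \<in> NV" and "rz p = (\<lambda>v. 0)"
  shows "p = rx (strip X p)"
proof
  fix v
  have *: "p v = 0" if "ok Z v" using fun_cong[OF assms(2), of "Z # v"] that by simp
  show "p v = rx (strip X p) v"
  proof (cases "ok Z v")
    case True
    then have "\<not> (\<exists>w. v = X # w)" by (auto simp: ok_Z_iff)
    then have "rx (strip X p) v = 0" by (cases "(strip X p, v)" rule: rx.cases) auto
    then show ?thesis using *[OF True] by simp
  next
    case False
    then obtain w where v: "v = X # w" by (auto simp: ok_Z_iff)
    then show ?thesis using NV_nrm[OF p, of v] by (auto simp: strip_def)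
  qed
qed

lemma bounded_ru:
  assumes "bounded (Suc n) (ru p)" shows "bounded n p"
  unfolding bounded_def
proof (intro allI impI)
  fix w assume "p w \<noteq> 0"
  then have "ru p (U # w) \<noteq> 0 \<or> ru p (X # w) \<noteq> 0" by (cases "ok U w") (auto simp: r_apply)
  then have "length (U # w) < Suc n \<or> length (X # w) < Suc n" using assms unfolding bounded_def by blast
  then show "length w < n" by simp
qed

lemma bounded_of_Suc:
  assumes "bounded (Suc n) p" "\<And>w. length w = n \<Longrightarrow> p w = 0" shows "bounded n p"
  using assms unfolding bounded_def by (metis less_Suc_eq)

lemma bounded_diff: "\<lbrakk>bounded n p; bounded n p'\<rbrakk> \<Longrightarrow> bounded n (\<lambda>v. p v - p' v)"
  unfolding bounded_def by (metis diff_zero)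

lemma bounded_r:
  assumes "bounded n p" shows "bounded (Suc n) (rx p)" "bounded (Suc n) (rz p)" "bounded (Suc n) (ru p)"
proof -
  show "bounded (Suc n) (rx p)" unfolding bounded_def
  proof (intro allI impI)
    fix w assume "rx p w \<noteq> 0"
    then show "length w < Suc n" using assms by (cases "(p, w)" rule: rx.cases) (auto simp: bounded_def split: if_splits)
  qed
  show "bounded (Suc n) (rz p)" unfolding bounded_def
  proof (intro allI impI)
    fix w assume "rz p w \<noteq> 0"
    then show "length w < Suc n" using assms by (cases "(p, w)" rule: rz.cases) (auto simp: bounded_def split: if_splits)
  qed
  show "bounded (Suc n) (ru p)" unfolding bounded_def
  proof (intro allI impI)
    fix w assume "ru p w \<noteq> 0"
    then show "length w < Suc n" using assms by (cases "(p, w)" rule: ru.cases) (fastforce simp: bounded_def split: if_splits)+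
  qed
qed

text \<open>Compare the coefficients of \<open>w\<close> extended by \<open>u\<close>,
  \<open>x\<close> and \<open>z\<close>. If \<open>w\<close> does not end in \<open>z\<close>, then
  \<open>a w = 0\<close>, and also \<open>b w = 0\<close> unless \<open>w\<close> ends in
  \<open>u\<close> or \<open>zx\<close>. If \<open>w\<close> ends in \<open>z\<close>, its products
  with \<open>u\<close> and \<open>x\<close> coincide and only \<open>a w + b w = 0\<close> follows.
  If \<open>w\<close> does not end in \<open>x\<close>, then \<open>c w = 0\<close>. The claim
  concerns a single word, so that it serves both leading terms and exact syzygies.\<close>

lemma syzygy_pointwise:
  assumes a: "a \<in> NV" and b: "b \<in> NV" and c: "c \<in> NV"
    and sum: "\<And>l. ru a (l # w) + rx b (l # w) + rz c (l # w) = 0"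
  shows "a w - rz (strip Z a) w = 0" "b w - (ru (strip_u b) w - rz (strip Z a) w) = 0"
    "c w - rx (strip X c) w = 0"
proof -
  have aU: "a w = 0" if "ok U w" using sum[of U] that by (simp add: r_apply)
  have bX: "b w = 0" if "ok X w" "ok U w" using sum[of X] that by (simp add: r_apply)
  have ab: "a w + b w = 0" if "\<not> ok U w"
  proof -
    have "ok X w" using that by (auto simp: ok_U_iff ok_X_iff)
    then show ?thesis using sum[of X] that by (simp add: r_apply)
  qed
  have cZ: "c w = 0" if "ok Z w" using sum[of Z] that by (simp add: r_apply)
  show a': "a w - rz (strip Z a) w = 0"
  proof (cases "ok U w")
    case True
    then have "rz (strip Z a) w = 0" by (cases "(strip Z a, w)" rule: rz.cases) (auto simp: ok_U_iff)
    then show ?thesis using aU[OF True] by simp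
  next
    case False
    then obtain v where "w = Z # v" by (auto simp: ok_U_iff)
    then show ?thesis using NV_nrm[OF a, of w] by (auto simp: strip_def)
  qed
  show "b w - (ru (strip_u b) w - rz (strip Z a) w) = 0"
  proof (cases "ok U w")
    case False
    then have "ru (strip_u b) w = 0" by (auto simp: ok_U_iff r_apply)
    then show ?thesis using ab[OF False] a' by (simp add: algebra_simps)
  next
    case True
    then have "rz (strip Z a) w = 0" by (cases "(strip Z a, w)" rule: rz.cases) (auto simp: ok_U_iff)
    moreover have "b w = ru (strip_u b) w"
    proof (cases "ok X w")
      case True
      then have "\<not> (\<exists>v. w = U # v) \<and> \<not> (\<exists>v. w = X # v \<and> \<not> ok U v)" by (auto simp: ok_X_iff ok_U_iff)
      then show ?thesis using bX[OF True \<open>ok U w\<close>] by (auto simp: ru_strip_u[OF b] split: list.split)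
    next
      case False
      then show ?thesis by (auto simp: ru_strip_u[OF b] ok_X_iff ok_U_iff)
    qed
    ultimately show ?thesis by simp
  qed
  show "c w - rx (strip X c) w = 0"
  proof (cases "ok Z w")
    case True
    then have "rx (strip X c) w = 0" by (cases "(strip X c, w)" rule: rx.cases) (auto simp: ok_Z_iff)
    then show ?thesis using cZ[OF True] by simp
  next
    case False
    then obtain v where "w = X # v" by (auto simp: ok_Z_iff)
    then show ?thesis using NV_nrm[OF c, of w] by (auto simp: strip_def)
  qed
qed

lemma syzygy_NV:
  assumes a: "a \<in> NV" "bounded (Suc n) a" and b: "b \<in> NV" "bounded (Suc n) b" and c: "c \<in> NV" "bounded (Suc n) c"
    and s: "bounded (Suc n) (\<lambda>v. ru a v + rx b v + rz c v)"
  shows "bounded n (\<lambda>v. a v - rz (strip Z a) v)"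
    "bounded n (\<lambda>v. b v - (ru (strip_u b) v - rz (strip Z a) v))"
    "bounded n (\<lambda>v. c v - rx (strip X c) v)"
proof -
  \<comment> \<open>The word \<open>l # w\<close> has length \<open>n + 1\<close>, just outside the
    bound.\<close>
  have sum: "ru a (l # w) + rx b (l # w) + rz c (l # w) = 0" if "length w = n" for l w
    using s that unfolding bounded_def by (metis length_Cons less_irrefl)
  note bd = bounded_diff bounded_r strip_bounded a(2) b(2) c(2)
  note sp = syzygy_pointwise[OF a(1) b(1) c(1) sum]
  show "bounded n (\<lambda>v. a v - rz (strip Z a) v)"
    by (rule bounded_of_Suc, (intro bd)[1]) (rule sp(1))
  show "bounded n (\<lambda>v. b v - (ru (strip_u b) v - rz (strip Z a) v))"
    by (rule bounded_of_Suc, (intro bd)[1]) (rule sp(2))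
  show "bounded n (\<lambda>v. c v - rx (strip X c) v)"
    by (rule bounded_of_Suc, (intro bd)[1]) (rule sp(3))
qed

text \<open>A nonempty normal word is a shorter one with its last letter appended. Since no normal
  word ends in \<open>zu\<close>, the rewriting clause of \<open>ru\<close> contributes
  nothing.\<close>

lemma expand_NV:
  assumes p: "p \<in> NV"
  shows "p v = p [] * delta [] v + ru (strip U p) v + rx (strip X p) v + rz (strip Z p) v"
proof (cases v)
  case (Cons c w)
  show ?thesis
  proof (cases c)
    case [simp]: X
    have "ru (strip U p) (X # w) = 0"
      by (cases "ok U w") (use NV_nrm[OF p, of "U # w"] in \<open>auto simp: r_apply strip_def\<close>)
    then show ?thesis using Cons NV_nrm[OF p, of v] by (auto simp: delta_def strip_def r_apply)
  qed (use Cons NV_nrm[OF p, of v] in \<open>auto simp: delta_def strip_def r_apply\<close>)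
qed (simp add: delta_def r_apply)

section \<open>Verification of the axioms for the quotient\<close>

context example_algebra
begin

definition filt :: "nat \<Rightarrow> (nat list \<Rightarrow> 'k) set set" where
  "filt n = {a \<in> carrier A. bounded n (Phi a)}"

lemma proper: "I \<noteq> carrier FA"
proof
  assume "I = carrier FA"
  then have "word_vec [] \<in> I" by simp
  then have "phi (word_vec []) [] = (0::'k)" by (simp add: phi_ideal)
  then show False by (simp add: phi_def delta_def)
qed

lemma Phi_exists: "p \<in> NV \<Longrightarrow> \<exists>a\<in>carrier A. Phi a = p"
  using Phi_Psi Psi_closed by blast

lemma kernel_xq:
  assumes a: "a \<in> carrier A" and e: "a \<otimes>\<^bsub>A\<^esub> xq = \<zero>\<^bsub>A\<^esub>"
  shows "\<exists>b\<in>carrier A. a = b \<otimes>\<^bsub>A\<^esub> uq"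
proof -
  have "rx (Phi a) = (\<lambda>v. 0)" using Phi_mult(1)[OF a] by (simp add: e Phi_zero)
  then have "Phi a = ru (strip_u (Phi a))" by (rule ker_rx[OF Phi_NV[OF a]])
  moreover obtain b where b: "b \<in> carrier A" "Phi b = strip_u (Phi a)"
    using Phi_exists[OF strip_NV(2)[OF Phi_NV[OF a]]] by blast
  ultimately have "Phi a = Phi (b \<otimes>\<^bsub>A\<^esub> uq)" using Phi_mult(3)[OF b(1)] by simp
  then show ?thesis using a b by (intro bexI[of _ b] Phi_eqI) auto
qed

lemma kernel_zq:
  assumes a: "a \<in> carrier A" and e: "a \<otimes>\<^bsub>A\<^esub> zq = \<zero>\<^bsub>A\<^esub>"
  shows "\<exists>b\<in>carrier A. a = b \<otimes>\<^bsub>A\<^esub> xq"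
proof -
  have "rz (Phi a) = (\<lambda>v. 0)" using Phi_mult(2)[OF a] by (simp add: e Phi_zero)
  then have "Phi a = rx (strip X (Phi a))" by (rule ker_rz[OF Phi_NV[OF a]])
  moreover obtain b where b: "b \<in> carrier A" "Phi b = strip X (Phi a)"
    using Phi_exists[OF strip_NV(1)[OF Phi_NV[OF a]]] by blast
  ultimately have "Phi a = Phi (b \<otimes>\<^bsub>A\<^esub> xq)" using Phi_mult(1)[OF b(1)] by simp
  then show ?thesis using a b by (intro bexI[of _ b] Phi_eqI) auto
qed

sublocale uxz: uxz_algebra A Kq uq xq zq filt
proof (rule uxz_algebra.intro, rule A.ring_axioms, rule uxz_algebra_axioms.intro)
  show "subfield Kq A" by (rule Kq_subfield[OF proper])
  show "k \<otimes>\<^bsub>A\<^esub> a = a \<otimes>\<^bsub>A\<^esub> k" if "k \<in> Kq" "a \<in> carrier A" for k a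
    using that by (rule Kq_central)
  show "uq \<in> carrier A" "xq \<in> carrier A" "zq \<in> carrier A" by simp_all
  show "uq \<otimes>\<^bsub>A\<^esub> xq = \<zero>\<^bsub>A\<^esub>" "xq \<otimes>\<^bsub>A\<^esub> zq = \<zero>\<^bsub>A\<^esub>" "zq \<otimes>\<^bsub>A\<^esub> uq = zq \<otimes>\<^bsub>A\<^esub> xq"
    by (rule relations)+
  show "filt n \<subseteq> carrier A" for n by (auto simp: filt_def)
  show "filt 0 = {\<zero>\<^bsub>A\<^esub>}"
  proof -
    have "a = \<zero>\<^bsub>A\<^esub>" if "a \<in> carrier A" "bounded 0 (Phi a)" for a
      using that Phi_zero by (intro Phi_eqI) (auto simp: bounded_def)
    then show ?thesis by (auto simp: filt_def Phi_zero bounded_def)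
  qed
  show "filt n \<subseteq> filt (Suc n)" for n by (auto simp: filt_def bounded_def less_Suc_eq)
  show "\<exists>n. a \<in> filt n" if a: "a \<in> carrier A" for a
  proof -
    have fin: "finite {w. Phi a w \<noteq> 0}" using Phi_NV[OF a] by (simp add: NV_def)
    have "bounded (Suc (Max (length ` {w. Phi a w \<noteq> 0}))) (Phi a)"
      unfolding bounded_def less_Suc_eq_le using fin by (auto intro!: Max_ge)
    then show ?thesis using a by (auto simp: filt_def)
  qed
  show "a \<oplus>\<^bsub>A\<^esub> b \<in> filt n" if "a \<in> filt n" "b \<in> filt n" for a b n
    using that unfolding filt_def by (auto simp: Phi_add bounded_def) (metis add.right_neutral)
  show "k \<otimes>\<^bsub>A\<^esub> a \<in> filt n" if "k \<in> Kq" "a \<in> filt n" for k a n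
    using that by (auto simp: filt_def Phi_scale bounded_def)
  show "a \<in> filt n" if "a \<in> carrier A" "a \<otimes>\<^bsub>A\<^esub> uq \<in> filt (Suc n)" for a n
    using that bounded_ru by (auto simp: filt_def Phi_mult)
  show "\<exists>b\<in>carrier A. a = b \<otimes>\<^bsub>A\<^esub> uq" if "a \<in> carrier A" "a \<otimes>\<^bsub>A\<^esub> xq = \<zero>\<^bsub>A\<^esub>" for a
    using that by (rule kernel_xq)
  show "\<exists>b\<in>carrier A. a = b \<otimes>\<^bsub>A\<^esub> xq" if "a \<in> carrier A" "a \<otimes>\<^bsub>A\<^esub> zq = \<zero>\<^bsub>A\<^esub>" for a
    using that by (rule kernel_zq)
  show "\<exists>\<alpha>\<in>filt n. \<exists>\<beta>\<in>filt n. \<exists>\<gamma>\<in>filt n. a \<ominus>\<^bsub>A\<^esub> \<gamma> \<otimes>\<^bsub>A\<^esub> zq \<in> filt n \<and>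
      b \<ominus>\<^bsub>A\<^esub> (\<alpha> \<otimes>\<^bsub>A\<^esub> uq \<ominus>\<^bsub>A\<^esub> \<gamma> \<otimes>\<^bsub>A\<^esub> zq) \<in> filt n \<and> c \<ominus>\<^bsub>A\<^esub> \<beta> \<otimes>\<^bsub>A\<^esub> xq \<in> filt n"
    if f: "a \<in> filt (Suc n)" "b \<in> filt (Suc n)" "c \<in> filt (Suc n)"
      "a \<otimes>\<^bsub>A\<^esub> uq \<oplus>\<^bsub>A\<^esub> b \<otimes>\<^bsub>A\<^esub> xq \<oplus>\<^bsub>A\<^esub> c \<otimes>\<^bsub>A\<^esub> zq \<in> filt (Suc n)" for a b c n
  proof -
    have [simp]: "a \<in> carrier A" "b \<in> carrier A" "c \<in> carrier A" using f by (auto simp: filt_def)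
    have bd: "bounded (Suc n) (Phi a)" "bounded (Suc n) (Phi b)" "bounded (Suc n) (Phi c)"
      "bounded (Suc n) (\<lambda>v. ru (Phi a) v + rx (Phi b) v + rz (Phi c) v)"
      using f by (simp_all add: filt_def Phi_add Phi_mult)
    \<comment> \<open>The witnesses of \<open>syzygy_pointwise\<close>: \<open>b\<close> divided by
      \<open>u\<close>, \<open>c\<close> by \<open>x\<close> and \<open>a\<close> by
      \<open>z\<close>, always from the right.\<close>
    obtain \<alpha> where \<alpha>: "\<alpha> \<in> carrier A" "Phi \<alpha> = strip_u (Phi b)"
      using Phi_exists[OF strip_NV(2)[OF Phi_NV[of b]]] by auto
    obtain \<beta> where \<beta>: "\<beta> \<in> carrier A" "Phi \<beta> = strip X (Phi c)"
      using Phi_exists[OF strip_NV(1)[OF Phi_NV[of c], of X]] by auto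
    obtain \<gamma> where \<gamma>: "\<gamma> \<in> carrier A" "Phi \<gamma> = strip Z (Phi a)"
      using Phi_exists[OF strip_NV(1)[OF Phi_NV[of a], of Z]] by auto
    note s = syzygy_NV[OF Phi_NV bd(1) Phi_NV bd(2) Phi_NV bd(3,4), simplified]
    show ?thesis
      using \<alpha> \<beta> \<gamma> s strip_bounded[OF bd(1)] strip_bounded[OF bd(2)] strip_bounded[OF bd(3)]
      by (intro bexI[of _ \<alpha>] bexI[of _ \<beta>] bexI[of _ \<gamma>]) (auto simp: filt_def Phi_minus Phi_mult)
  qed
  show "\<exists>k\<in>Kq. \<exists>a1\<in>filt n. \<exists>a2\<in>filt n. \<exists>a3\<in>filt n.
      a = k \<oplus>\<^bsub>A\<^esub> a1 \<otimes>\<^bsub>A\<^esub> uq \<oplus>\<^bsub>A\<^esub> a2 \<otimes>\<^bsub>A\<^esub> xq \<oplus>\<^bsub>A\<^esub> a3 \<otimes>\<^bsub>A\<^esub> zq" if f: "a \<in> filt (Suc n)" for a n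
  proof -
    have a [simp]: "a \<in> carrier A" and bd: "bounded (Suc n) (Phi a)" using f by (auto simp: filt_def)
    have ex: "\<exists>b\<in>carrier A. Phi b = strip c (Phi a)" for c
      using Phi_exists[OF strip_NV(1)[OF Phi_NV[OF a]]] by blast
    obtain a1 where a1: "a1 \<in> carrier A" "Phi a1 = strip U (Phi a)" using ex by blast
    obtain a2 where a2: "a2 \<in> carrier A" "Phi a2 = strip X (Phi a)" using ex by blast
    obtain a3 where a3: "a3 \<in> carrier A" "Phi a3 = strip Z (Phi a)" using ex by blast
    let ?k = "q 3 I (scalar (Phi a []))"
    \<comment> \<open>\<open>Phi_scale\<close> expects a scalar multiple, so the constant is read as
      a multiple of the unit.\<close>
    have k: "?k = ?k \<otimes>\<^bsub>A\<^esub> \<one>\<^bsub>A\<^esub>" by simp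
    have "Phi (?k \<oplus>\<^bsub>A\<^esub> a1 \<otimes>\<^bsub>A\<^esub> uq \<oplus>\<^bsub>A\<^esub> a2 \<otimes>\<^bsub>A\<^esub> xq \<oplus>\<^bsub>A\<^esub> a3 \<otimes>\<^bsub>A\<^esub> zq) = Phi a"
      using a1 a2 a3
      by (subst k) (simp add: Phi_add Phi_scale Phi_one Phi_mult expand_NV[OF Phi_NV[OF a], symmetric] del: A.r_one)
    then have "a = ?k \<oplus>\<^bsub>A\<^esub> a1 \<otimes>\<^bsub>A\<^esub> uq \<oplus>\<^bsub>A\<^esub> a2 \<otimes>\<^bsub>A\<^esub> xq \<oplus>\<^bsub>A\<^esub> a3 \<otimes>\<^bsub>A\<^esub> zq"
      using a1 a2 a3 by (intro Phi_eqI) auto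
    then show ?thesis
      using a1 a2 a3 strip_bounded(1)[OF bd] by (intro bexI[of _ ?k] bexI[of _ a1] bexI[of _ a2] bexI[of _ a3]) (auto simp: filt_def)
  qed
qed

lemma ideal_Nil: "f \<in> I \<Longrightarrow> f [] = 0"
  using phi_ideal[of f] act_Nil[of f 3 "delta []"] additive_subgroup.a_subset[OF I.is_additive_subgroup]
  by (auto simp: phi_def delta_def)

text \<open>The constant term of \<open>gu\<close> is zero, hence so is that of any product with it;
  elements of \<open>I\<close> have constant term zero as well, but the unit does not.\<close>

lemma uq_not_unit:
  assumes "a \<in> carrier A" shows "uq \<otimes>\<^bsub>A\<^esub> a \<noteq> \<one>\<^bsub>A\<^esub>"
proof
  assume e: "uq \<otimes>\<^bsub>A\<^esub> a = \<one>\<^bsub>A\<^esub>"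
  obtain f where f: "f \<in> carrier FA" "a = q 3 I f" using assms by (rule A_cases)
  have "q 3 I (gu \<otimes>\<^bsub>FA\<^esub> f) = q 3 I (word_vec [])"
    using e f by (simp add: uq_def q_mult q_one)
  then have "(\<lambda>w. (gu \<otimes>\<^bsub>FA\<^esub> f) w - word_vec [] w) \<in> I"
    using f by (subst (asm) q_eq_iff) auto
  from ideal_Nil[OF this] show False
    by (simp add: free_algebra_simps gu_def word_vec_def)
qed

end

context example_algebra
begin

subsection \<open>Global dimension\<close>

lemma Phi_q_Nil: "f \<in> carrier FA \<Longrightarrow> Phi (q 3 I f) [] = f []"
  by (simp add: Phi_q phi_def act_Nil delta_def)

lemma Phi_mult_Nil:
  assumes "a \<in> carrier A" "b \<in> carrier A" shows "Phi (a \<otimes>\<^bsub>A\<^esub> b) [] = Phi a [] * Phi b []"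
proof -
  obtain f where f: "f \<in> carrier FA" "a = q 3 I f" using assms(1) by (rule A_cases)
  obtain g where g: "g \<in> carrier FA" "b = q 3 I g" using assms(2) by (rule A_cases)
  from f g show ?thesis by (simp add: q_mult[symmetric] Phi_q_Nil) (simp add: free_algebra_simps)
qed

lemma scalar_Nil [simp]: "scalar c [] = c"
  by (simp add: scalar_def)

lemma q_scalar_inj: "q 3 I (scalar c) = q 3 I (scalar d) \<longleftrightarrow> c = d"
proof
  assume "q 3 I (scalar c) = q 3 I (scalar d)"
  then have "Phi (q 3 I (scalar c)) [] = Phi (q 3 I (scalar d)) []" by (rule arg_cong)
  then show "c = d" by (simp add: Phi_q_Nil)
qed simp

lemma projective_dimension_le_4:
  assumes M: "left_module A M"
  shows "projective_dimension A M \<le> 4"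
proof -
  interpret M: left_module A M by fact
  obtain B where B: "M.basis_over Kq B" using M.basis_over_exists[OF uxz.K_subfield] by blast
  interpret U: uxz_module A Kq uq xq zq filt M B
    by (intro uxz_module.intro uxz.uxz_algebra_axioms M uxz_module_axioms.intro B)
  have "has_projective_resolution A M 4" by (rule U.has_resolution_4[OF one_neq_zero[OF proper]])
  then have "enat 4 \<in> {enat n | n. has_projective_resolution A M n}" by blast
  then have "projective_dimension A M \<le> enat 4" unfolding projective_dimension_def by (rule Inf_lower)
  then show ?thesis by (simp add: numeral_eq_enat)
qed

text \<open>The elements of the trivial module are encoded as singletons of scalar cosets.\<close>

definition \<tau> :: "'k \<Rightarrow> (nat list \<Rightarrow> 'k) set set + 'u" where
  "\<tau> c = Inl {q 3 I (scalar c)}"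

definition triv :: "((nat list \<Rightarrow> 'k) set, (nat list \<Rightarrow> 'k) set set + 'u) module" where
  "triv = \<lparr>carrier = range \<tau>, mult = undefined, one = undefined, zero = \<tau> 0,
     add = (\<lambda>m n. \<tau> (inv_into UNIV \<tau> m + inv_into UNIV \<tau> n)),
     smult = (\<lambda>a m. \<tau> (Phi a [] * inv_into UNIV \<tau> m))\<rparr>"

lemma inv_\<tau> [simp]: "inv_into UNIV (\<tau> :: 'k \<Rightarrow> (nat list \<Rightarrow> 'k) set set + 'u) (\<tau> c) = c"
  by (rule inv_into_f_f) (auto simp: inj_on_def \<tau>_def q_scalar_inj)

lemma \<tau>_eq_iff: "(\<tau> c :: (nat list \<Rightarrow> 'k) set set + 'u) = \<tau> d \<longleftrightarrow> c = d"
  by (auto simp: \<tau>_def q_scalar_inj)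

lemma left_module_triv: "left_module A (triv :: (_, (nat list \<Rightarrow> 'k) set set + 'u) module)"
proof -
  have "abelian_group (triv :: (_, (nat list \<Rightarrow> 'k) set set + 'u) module)"
  proof (rule abelian_groupI)
    show "\<exists>y\<in>carrier (triv :: (_, (nat list \<Rightarrow> 'k) set set + 'u) module). y \<oplus>\<^bsub>triv\<^esub> x = \<zero>\<^bsub>triv\<^esub>" if x: "x \<in> carrier triv" for x :: "(nat list \<Rightarrow> 'k) set set + 'u"
    proof -
      obtain c where "x = \<tau> c" using x by (auto simp: triv_def)
      then show ?thesis by (intro bexI[of _ "\<tau> (- c)"]) (auto simp: triv_def)
    qed
  qed (auto simp: triv_def ac_simps)
  then interpret abelian_group "triv :: (_, (nat list \<Rightarrow> 'k) set set + 'u) module" .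
  show ?thesis
    by unfold_locales (auto simp: triv_def Phi_add Phi_mult_Nil Phi_one delta_def algebra_simps)
qed

lemma projective_dimension_triv: "projective_dimension A (triv :: (_, (nat list \<Rightarrow> 'k) set set + 'u) module) \<ge> 4"
proof -
  interpret M: left_module A "triv :: (_, (nat list \<Rightarrow> 'k) set set + 'u) module" by (rule left_module_triv)
  obtain B where B: "M.basis_over Kq B" using M.basis_over_exists[OF uxz.K_subfield] by blast
  interpret U: uxz_module A Kq uq xq zq filt "triv :: (_, (nat list \<Rightarrow> 'k) set set + 'u) module" B
    by (intro uxz_module.intro uxz.uxz_algebra_axioms left_module_triv uxz_module_axioms.intro B)
  have nz: "carrier (triv :: (_, (nat list \<Rightarrow> 'k) set set + 'u) module) \<noteq> {\<zero>\<^bsub>triv\<^esub>}"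
  proof
    assume "carrier (triv :: (_, (nat list \<Rightarrow> 'k) set set + 'u) module) = {\<zero>\<^bsub>triv\<^esub>}"
    then have "(\<tau> 1 :: (nat list \<Rightarrow> 'k) set set + 'u) = \<tau> 0" by (auto simp: triv_def)
    then show False by (simp add: \<tau>_eq_iff)
  qed
  \<comment> \<open>\<open>y\<close> has no constant term and therefore acts as zero on the trivial
    module, as \<open>no_resolution_3\<close> demands.\<close>
  have "word_vec [1] [] = (0 :: 'k)" "set [1] \<subseteq> {..<3::nat}" by (simp_all add: word_vec_def)
  then have "Phi uxz.y [] = 0"
    using Phi_q_Nil[OF word_vec_closed[of "[1]" 3]] by (simp add: uxz.y_def yq_eq[symmetric] yq_def)
  then have act: "uxz.y \<odot>\<^bsub>triv\<^esub> m = \<zero>\<^bsub>triv\<^esub>" for m :: "(nat list \<Rightarrow> 'k) set set + 'u" by (simp add: triv_def)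
  have "4 \<le> n" if "has_projective_resolution A (triv :: (_, (nat list \<Rightarrow> 'k) set set + 'u) module) n" for n
    using U.no_resolution_3[OF one_neq_zero[OF proper] nz act uq_not_unit, of n] that by (cases "n \<le> 3") auto
  then have "enat 4 \<le> projective_dimension A (triv :: (_, (nat list \<Rightarrow> 'k) set set + 'u) module)"
    unfolding projective_dimension_def by (intro Inf_greatest) auto
  then show ?thesis by (simp add: numeral_eq_enat)
qed

theorem global_dimension_A: "global_dimension TYPE('u) A = 4"
  unfolding global_dimension_def
proof (rule antisym)
  show "(SUP M\<in>{M :: (_, (nat list \<Rightarrow> 'k) set set + 'u) module. left_module A M}. projective_dimension A M) \<le> 4"
    by (intro SUP_least) (simp add: projective_dimension_le_4)
  have "4 \<le> projective_dimension A (triv :: (_, (nat list \<Rightarrow> 'k) set set + 'u) module)" by (rule projective_dimension_triv)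
  also have "\<dots> \<le> (SUP M\<in>{M :: (_, (nat list \<Rightarrow> 'k) set set + 'u) module. left_module A M}. projective_dimension A M)"
    by (intro SUP_upper) (simp add: left_module_triv)
  finally show "4 \<le> (SUP M\<in>{M :: (_, (nat list \<Rightarrow> 'k) set set + 'u) module. left_module A M}. projective_dimension A M)" .
qed

end

context example_algebra
begin

subsection \<open>The Koszul resolution\<close>

lemma I_iff: "f \<in> I \<longleftrightarrow> f \<in> carrier FA \<and> phi f = (\<lambda>v. 0)"
proof
  assume "f \<in> I"
  then show "f \<in> carrier FA \<and> phi f = (\<lambda>v. 0)"
    using phi_ideal additive_subgroup.a_subset[OF I.is_additive_subgroup] by auto
next
  assume f: "f \<in> carrier FA \<and> phi f = (\<lambda>v. 0)"
  then have "q 3 I f = \<zero>\<^bsub>A\<^esub>" by (simp add: q_eq_Psi)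
  then show "f \<in> I" using f q_eq_zero_iff by auto
qed

text \<open>The rewriting rules are homogeneous, so \<open>rx\<close>, \<open>rz\<close> and
  \<open>ru\<close> all raise the length by exactly one.\<close>

lemma rho_length:
  assumes "\<And>v. p v \<noteq> (0::'k) \<Longrightarrow> length v = n" "rho i p v \<noteq> 0" shows "length v = Suc n"
proof -
  have x: "length v = Suc n" if "rx p v \<noteq> 0"
    using that assms(1) by (cases "(p, v)" rule: rx.cases) (auto split: if_splits)
  have z: "length v = Suc n" if "rz p v \<noteq> 0"
    using that assms(1) by (cases "(p, v)" rule: rz.cases) (auto split: if_splits)
  have u: "length v = Suc n" if "ru p v \<noteq> 0"
    using that assms(1) by (cases "(p, v)" rule: ru.cases) (fastforce split: if_splits)+
  show ?thesis using assms(2) x z u by (auto simp: rho_def split: if_splits) fastforce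
qed

lemma fold_rho_length: "fold rho w (delta []) v \<noteq> (0::'k) \<Longrightarrow> length v = length w"
proof (induction w arbitrary: v rule: rev_induct)
  case (snoc i w)
  then show ?case using rho_length[of "fold rho w (delta [])" "length w" i v] by simp
qed (auto simp: delta_def split: if_splits)

lemma hom_component_closed: "f \<in> carrier (free_algebra n) \<Longrightarrow> hom_component j f \<in> carrier (free_algebra n)"
  by (auto simp: free_algebra_carrier hom_component_def elim: rev_finite_subset)

lemma phi_hom_component:
  assumes "f \<in> carrier FA"
  shows "phi (hom_component j f) = (\<lambda>v. if length v = j then phi f v else 0)"
proof
  fix v
  have "phi (hom_component j f) v = (\<Sum>w\<in>{w. f w \<noteq> 0}. hom_component j f w * fold rho w (delta []) v)"
    unfolding phi_def using assms by (intro act_superset) (auto simp: free_algebra_carrier hom_component_def)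
  also have "\<dots> = (if length v = j then phi f v else 0)"
  proof -
    have z: "fold rho w (delta []) v = (0::'k)" if "length w \<noteq> length v" for w
      using fold_rho_length[of w v] that by auto
    show ?thesis
    proof (cases "length v = j")
      case True
      then show ?thesis unfolding phi_def act_def
        by (simp, intro sum.cong refl) (simp add: hom_component_def z)
    next
      case False
      then show ?thesis by (simp, intro sum.neutral ballI) (auto simp: hom_component_def z)
    qed
  qed
  finally show "phi (hom_component j f) v = (if length v = j then phi f v else 0)" .
qed

text \<open>\<open>I\<close> is the kernel of \<open>phi\<close>, and \<open>phi\<close> respects
  the length of words, so the kernel contains the homogeneous components of its elements.\<close>

lemma proper_graded: "proper_graded_ideal 3 I"
  unfolding proper_graded_ideal_def
proof (intro conjI ballI allI ideal proper)
  fix f j assume "f \<in> I"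
  then have f: "f \<in> carrier FA" "phi f = (\<lambda>v. 0)" by (simp_all add: I_iff)
  show "hom_component j f \<in> I" unfolding I_iff by (simp add: hom_component_closed phi_hom_component f fun_eq_iff)
qed

lemma augmentation_eq:
  assumes "a \<in> carrier A" shows "augmentation a = Phi a []"
proof -
  obtain f where f: "f \<in> carrier FA" "a = q 3 I f" using assms by (rule A_cases)
  have Nil: "g [] = f []" if "g \<in> q 3 I f" for g
  proof -
    have "g \<in> (\<Union>h\<in>I. {h \<oplus>\<^bsub>FA\<^esub> f})" using that by (simp only: a_r_coset_def')
    then obtain h where "h \<in> I" "g = h \<oplus>\<^bsub>FA\<^esub> f" by (elim UN_E singletonE)
    then show ?thesis using ideal_Nil[of h] by (simp add: free_algebra_simps(1))
  qed
  have "augmentation (q 3 I f) = f []"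
    unfolding augmentation_def
  proof (rule the_equality)
    show "\<exists>g\<in>q 3 I f. g [] = f []" using I.a_rcos_self[OF f(1)] by (rule bexI[rotated]) (rule refl)
    show "c = f []" if "\<exists>g\<in>q 3 I f. g [] = c" for c using that Nil by (elim bexE) simp
  qed
  then show ?thesis using f by (simp add: Phi_q_Nil)
qed

lemma free_deg_mult:
  assumes "f \<in> free_deg 3 i" "g \<in> free_deg 3 j"
  shows "f \<otimes>\<^bsub>FA\<^esub> g \<in> free_deg 3 (i + j)"
proof -
  have c: "f \<otimes>\<^bsub>FA\<^esub> g \<in> carrier FA" using assms by (intro free_algebra_mult_closed) (auto simp: free_deg_def)
  have "length w = i + j" if w: "(f \<otimes>\<^bsub>FA\<^esub> g) w \<noteq> 0" for w
  proof -
    obtain k where k: "k \<le> length w" "f (take k w) \<noteq> 0" "g (drop k w) \<noteq> 0"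
      using sum.not_neutral_contains_not_neutral[OF w[unfolded free_algebra_simps]] by auto
    then have "length (take k w) = i" "length (drop k w) = j" using assms by (auto simp: free_deg_def)
    then show ?thesis using k(1) by simp
  qed
  with c show ?thesis by (simp add: free_deg_def)
qed

lemma gens_deg: "glF c \<in> free_deg 3 1"
proof -
  have "\<forall>w. glF c w \<noteq> 0 \<longrightarrow> length w = 1" by (cases c) (auto simp: gu_def word_vec_def split: if_splits)
  then show ?thesis using glF_closed[of c] by (simp only: free_deg_def mem_Collect_eq)
qed

lemma alg_deg_gens:
  assumes "a \<in> alg_deg 3 I j" shows "a \<otimes>\<^bsub>A\<^esub> uq \<in> alg_deg 3 I (Suc j)" "a \<otimes>\<^bsub>A\<^esub> xq \<in> alg_deg 3 I (Suc j)"
    "a \<otimes>\<^bsub>A\<^esub> zq \<in> alg_deg 3 I (Suc j)"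
proof -
  obtain f where f: "f \<in> free_deg 3 j" "a = q 3 I f" using assms by (auto simp: alg_deg_def)
  have "a \<otimes>\<^bsub>A\<^esub> gl c \<in> alg_deg 3 I (Suc j)" for c
  proof -
    have "a \<otimes>\<^bsub>A\<^esub> gl c = q 3 I (f \<otimes>\<^bsub>FA\<^esub> glF c)" using f by (simp add: gl_def q_mult free_deg_def)
    then show ?thesis using free_deg_mult[OF f(1) gens_deg, of c] by (auto simp: alg_deg_def)
  qed
  from this[of U] this[of X] this[of Z] show "a \<otimes>\<^bsub>A\<^esub> uq \<in> alg_deg 3 I (Suc j)"
    "a \<otimes>\<^bsub>A\<^esub> xq \<in> alg_deg 3 I (Suc j)" "a \<otimes>\<^bsub>A\<^esub> zq \<in> alg_deg 3 I (Suc j)"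
    by (simp_all add: gl_simps)
qed

text \<open>The sizes \<open>3, 3, 2, 1\<close> are the coefficients of the dual Hilbert series in
  positive degree; degree zero of the resolution is the regular module.\<close>

definition Bk :: "nat \<Rightarrow> nat set" where
  "Bk k = {..<(if k = 1 then 3 else if k = 2 then 3 else if k = 3 then 2 else if k = 4 then 1 else 0)}"

abbreviation Mk :: "nat \<Rightarrow> ((nat list \<Rightarrow> 'k) set, nat \<Rightarrow> (nat list \<Rightarrow> 'k) set) module" where
  "Mk k \<equiv> free_module A (Bk k)"

definition kd1 :: "(nat \<Rightarrow> (nat list \<Rightarrow> 'k) set) \<Rightarrow> (nat list \<Rightarrow> 'k) set" where
  "kd1 f = f 0 \<otimes>\<^bsub>A\<^esub> uq \<oplus>\<^bsub>A\<^esub> f 1 \<otimes>\<^bsub>A\<^esub> xq \<oplus>\<^bsub>A\<^esub> f 2 \<otimes>\<^bsub>A\<^esub> zq"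

text \<open>The bimodule differentials for \<open>M = K\<close>: the generators act as zero there,
  so all terms with \<open>Lm\<close> disappear and only right multiplications remain.\<close>

definition kd :: "nat \<Rightarrow> (nat \<Rightarrow> (nat list \<Rightarrow> 'k) set) \<Rightarrow> nat \<Rightarrow> (nat list \<Rightarrow> 'k) set" where
  "kd k f = (\<lambda>i.
     if k = 2 \<and> i = 0 then f 2 \<otimes>\<^bsub>A\<^esub> zq else
     if k = 2 \<and> i = 1 then f 0 \<otimes>\<^bsub>A\<^esub> uq \<ominus>\<^bsub>A\<^esub> f 2 \<otimes>\<^bsub>A\<^esub> zq else
     if k = 2 \<and> i = 2 then f 1 \<otimes>\<^bsub>A\<^esub> xq else
     if k = 3 \<and> i = 1 then f 0 \<otimes>\<^bsub>A\<^esub> uq else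
     if k = 3 \<and> i = 2 then f 1 \<otimes>\<^bsub>A\<^esub> xq else
     if k = 4 \<and> i = 1 then f 0 \<otimes>\<^bsub>A\<^esub> uq else \<zero>\<^bsub>A\<^esub>)"

lemma Mk_closed: "f \<in> carrier (Mk k) \<Longrightarrow> f i \<in> carrier A"
  by (rule A.free_module_app)

lemma Mk_iff: "f \<in> carrier (Mk k) \<longleftrightarrow> (\<forall>i\<in>Bk k. f i \<in> carrier A) \<and> (\<forall>i. i \<notin> Bk k \<longrightarrow> f i = \<zero>\<^bsub>A\<^esub>)"
proof -
  have "finite {i. f i \<noteq> \<zero>\<^bsub>A\<^esub>}" if "\<forall>i. i \<notin> Bk k \<longrightarrow> f i = \<zero>\<^bsub>A\<^esub>"
    by (rule finite_subset[of _ "Bk k"]) (use that in \<open>auto simp: Bk_def\<close>)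
  then show ?thesis by (auto simp: free_module_simps)
qed

lemma Mk_out: "\<lbrakk>f \<in> carrier (Mk k); i \<notin> Bk k\<rbrakk> \<Longrightarrow> f i = \<zero>\<^bsub>A\<^esub>"
  by (simp add: Mk_iff)

lemma kd1_hom: "kd1 \<in> lmod_hom A (Mk 1) (regular_module A)"
proof (rule lmod_homI)
  fix f assume f: "f \<in> carrier (Mk 1)"
  note [simp] = Mk_closed[OF f]
  show "kd1 f \<in> carrier (regular_module A)" by (simp add: kd1_def regular_module_def)
next
  fix f g assume f: "f \<in> carrier (Mk 1)" and g: "g \<in> carrier (Mk 1)"
  note [simp] = Mk_closed[OF f] Mk_closed[OF g]
  show "kd1 (f \<oplus>\<^bsub>Mk 1\<^esub> g) = kd1 f \<oplus>\<^bsub>regular_module A\<^esub> kd1 g"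
    by (simp add: kd1_def regular_module_def free_module_simps(3) A.l_distr A.a_ac)
next
  fix f a assume f: "f \<in> carrier (Mk 1)" and a: "a \<in> carrier A"
  note [simp] = Mk_closed[OF f] a
  show "kd1 (a \<odot>\<^bsub>Mk 1\<^esub> f) = a \<odot>\<^bsub>regular_module A\<^esub> kd1 f"
    by (simp add: kd1_def regular_module_def free_module_simps(4) A.r_distr A.m_assoc)
qed

lemma kd_hom: "kd k \<in> lmod_hom A (Mk k) (Mk (k - 1))"
proof (rule lmod_homI)
  fix f assume f: "f \<in> carrier (Mk k)"
  note [simp] = Mk_closed[OF f]
  show "kd k f \<in> carrier (Mk (k - 1))" unfolding Mk_iff by (auto simp: kd_def Bk_def)
next
  fix f g assume f: "f \<in> carrier (Mk k)" and g: "g \<in> carrier (Mk k)"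
  note [simp] = Mk_closed[OF f] Mk_closed[OF g]
  show "kd k (f \<oplus>\<^bsub>Mk k\<^esub> g) = kd k f \<oplus>\<^bsub>Mk (k - 1)\<^esub> kd k g"
    by (rule ext) (simp add: kd_def free_module_simps(3) A.l_distr A.diff_simps)
next
  fix f a assume f: "f \<in> carrier (Mk k)" and a: "a \<in> carrier A"
  note [simp] = Mk_closed[OF f] a
  show "kd k (a \<odot>\<^bsub>Mk k\<^esub> f) = a \<odot>\<^bsub>Mk (k - 1)\<^esub> kd k f"
    by (rule ext) (simp add: kd_def free_module_simps(4) A.r_distr A.m_assoc A.minus_eq A.r_minus)
qed

lemma free_module_deg_iff:
  "f \<in> free_module_deg 3 I k (Bk k) j \<longleftrightarrow> f \<in> carrier (Mk k) \<and>
     (\<forall>i. f i \<in> (if k \<le> j then alg_deg 3 I (j - k) else {\<zero>\<^bsub>A\<^esub>}))"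
  using zero_in_alg_deg by (auto simp: free_module_deg_def Mk_iff)

lemma kd1_deg: "kd1 ` free_module_deg 3 I 1 (Bk 1) j \<subseteq> alg_deg 3 I j"
proof
  fix a assume "a \<in> kd1 ` free_module_deg 3 I 1 (Bk 1) j"
  then obtain f where f': "f \<in> free_module_deg 3 I 1 (Bk 1) j" and a: "a = kd1 f" by (elim imageE)
  then have f: "f i \<in> (if 1 \<le> j then alg_deg 3 I (j - 1) else {\<zero>\<^bsub>A\<^esub>})" for i
    unfolding free_module_deg_iff by blast
  show "a \<in> alg_deg 3 I j"
  proof (cases j)
    case 0
    then have "f i = \<zero>\<^bsub>A\<^esub>" for i using f[of i] by simp
    then show ?thesis using a by (simp add: kd1_def zero_in_alg_deg)
  next
    case (Suc j')
    then have "f i \<in> alg_deg 3 I j'" for i using f[of i] by simp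
    then show ?thesis using a Suc by (auto simp: kd1_def intro!: alg_deg_add alg_deg_gens)
  qed
qed

lemma kd_deg:
  assumes "k \<ge> 2"
  shows "kd k ` free_module_deg 3 I k (Bk k) j \<subseteq> free_module_deg 3 I (k - 1) (Bk (k - 1)) j"
proof
  fix g assume "g \<in> kd k ` free_module_deg 3 I k (Bk k) j"
  then obtain f where f': "f \<in> free_module_deg 3 I k (Bk k) j" and g: "g = kd k f" by (elim imageE)
  then have fc: "f \<in> carrier (Mk k)" and f: "f i \<in> (if k \<le> j then alg_deg 3 I (j - k) else {\<zero>\<^bsub>A\<^esub>})" for i
    unfolding free_module_deg_iff by blast+
  have "kd k f i \<in> (if k - 1 \<le> j then alg_deg 3 I (j - (k - 1)) else {\<zero>\<^bsub>A\<^esub>})" for i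
  proof (cases "k \<le> j")
    case True
    then have "f i \<in> alg_deg 3 I (j - k)" for i using f[of i] by simp
    moreover have "j - (k - 1) = Suc (j - k)" using True assms by simp
    ultimately show ?thesis using True by (auto simp: kd_def zero_in_alg_deg intro!: alg_deg_minus alg_deg_gens)
  next
    case False
    then have "f i = \<zero>\<^bsub>A\<^esub>" for i using f[of i] by simp
    then have "kd k f i = \<zero>\<^bsub>A\<^esub>" by (simp add: kd_def A.minus_eq)
    then show ?thesis by (simp add: zero_in_alg_deg)
  qed
  then show "g \<in> free_module_deg 3 I (k - 1) (Bk (k - 1)) j"
    unfolding free_module_deg_iff g using lmod_hom_closed[OF kd_hom fc] by blast
qed

lemma Phi_r_Nil: "a \<in> carrier A \<Longrightarrow> Phi (a \<otimes>\<^bsub>A\<^esub> uq) [] = 0" "a \<in> carrier A \<Longrightarrow> Phi (a \<otimes>\<^bsub>A\<^esub> xq) [] = 0"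
  "a \<in> carrier A \<Longrightarrow> Phi (a \<otimes>\<^bsub>A\<^esub> zq) [] = 0"
  by (simp_all add: Phi_mult)

lemma kd1_image: "kd1 ` carrier (Mk 1) = a_kernel (regular_module A) trivial_module augmentation"
proof (intro equalityI subsetI)
  fix a assume "a \<in> kd1 ` carrier (Mk 1)"
  then obtain f where f: "f \<in> carrier (Mk 1)" "a = kd1 f" by auto
  note [simp] = Mk_closed[OF f(1)]
  have "augmentation a = 0" unfolding f(2) kd1_def
    by (subst augmentation_eq) (simp_all add: Phi_add Phi_r_Nil)
  then show "a \<in> a_kernel (regular_module A) trivial_module augmentation"
    unfolding f(2) by (simp add: a_kernel_def' regular_module_def trivial_module_def kd1_def)
next
  fix a assume "a \<in> a_kernel (regular_module A) trivial_module augmentation"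
  then have a: "a \<in> carrier A" "Phi a [] = 0"
    by (auto simp: a_kernel_def' regular_module_def trivial_module_def augmentation_eq)
  obtain n where "a \<in> filt n" using uxz.filt_exhaust[OF a(1)] by blast
  \<comment> \<open>\<open>filt_expand\<close> speaks of successor indices only.\<close>
  then have "a \<in> filt (Suc n)" using uxz.filt_mono by blast
  then obtain c a1 a2 a3 where a123: "a1 \<in> filt n" "a2 \<in> filt n" "a3 \<in> filt n"
    and e: "a = q 3 I (scalar c) \<oplus>\<^bsub>A\<^esub> a1 \<otimes>\<^bsub>A\<^esub> uq \<oplus>\<^bsub>A\<^esub> a2 \<otimes>\<^bsub>A\<^esub> xq \<oplus>\<^bsub>A\<^esub> a3 \<otimes>\<^bsub>A\<^esub> zq"
    using uxz.filt_expand[of a n] by blast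
  have [simp]: "a1 \<in> carrier A" "a2 \<in> carrier A" "a3 \<in> carrier A" using a123 uxz.filt_closed by auto
  \<comment> \<open>The products with generators have no constant term, so \<open>c\<close> is the
    augmentation of \<open>a\<close>, which is zero.\<close>
  have "Phi a [] = c" unfolding e by (simp add: Phi_add Phi_r_Nil Phi_q_Nil)
  then have "q 3 I (scalar c) = \<zero>\<^bsub>A\<^esub>" using a(2) by (simp add: scalar_0 q_zero)
  then have "a = kd1 (\<lambda>i. if i = 0 then a1 else if i = 1 then a2 else if i = 2 then a3 else \<zero>\<^bsub>A\<^esub>)"
    unfolding kd1_def e by simp
  moreover have "(\<lambda>i. if i = 0 then a1 else if i = 1 then a2 else if i = 2 then a3 else \<zero>\<^bsub>A\<^esub>) \<in> carrier (Mk 1)"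
    unfolding Mk_iff by (auto simp: Bk_def)
  ultimately show "a \<in> kd1 ` carrier (Mk 1)" by (rule image_eqI)
qed

text \<open>A genuine syzygy satisfies the hypothesis of \<open>syzygy_pointwise\<close> at every
  word, so the same witnesses solve the equations exactly and not only in top degree.\<close>

lemma syzygy_A:
  assumes [simp]: "a \<in> carrier A" "b \<in> carrier A" "c \<in> carrier A"
    and e: "a \<otimes>\<^bsub>A\<^esub> uq \<oplus>\<^bsub>A\<^esub> b \<otimes>\<^bsub>A\<^esub> xq \<oplus>\<^bsub>A\<^esub> c \<otimes>\<^bsub>A\<^esub> zq = \<zero>\<^bsub>A\<^esub>"
  shows "\<exists>\<alpha>\<in>carrier A. \<exists>\<beta>\<in>carrier A. \<exists>\<gamma>\<in>carrier A.
    a = \<gamma> \<otimes>\<^bsub>A\<^esub> zq \<and> b = \<alpha> \<otimes>\<^bsub>A\<^esub> uq \<ominus>\<^bsub>A\<^esub> \<gamma> \<otimes>\<^bsub>A\<^esub> zq \<and> c = \<beta> \<otimes>\<^bsub>A\<^esub> xq"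
proof -
  have "Phi (a \<otimes>\<^bsub>A\<^esub> uq \<oplus>\<^bsub>A\<^esub> b \<otimes>\<^bsub>A\<^esub> xq \<oplus>\<^bsub>A\<^esub> c \<otimes>\<^bsub>A\<^esub> zq) v = 0" for v by (simp add: e Phi_zero)
  then have sum: "ru (Phi a) v + rx (Phi b) v + rz (Phi c) v = 0" for v by (simp add: Phi_add Phi_mult)
  note s = syzygy_pointwise[OF Phi_NV[OF assms(1)] Phi_NV[OF assms(2)] Phi_NV[OF assms(3)] sum]
  obtain \<alpha> where \<alpha>: "\<alpha> \<in> carrier A" "Phi \<alpha> = strip_u (Phi b)"
    using Phi_exists[OF strip_NV(2)[OF Phi_NV[of b]]] by auto
  obtain \<beta> where \<beta>: "\<beta> \<in> carrier A" "Phi \<beta> = strip X (Phi c)"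
    using Phi_exists[OF strip_NV(1)[OF Phi_NV[of c], of X]] by auto
  obtain \<gamma> where \<gamma>: "\<gamma> \<in> carrier A" "Phi \<gamma> = strip Z (Phi a)"
    using Phi_exists[OF strip_NV(1)[OF Phi_NV[of a], of Z]] by auto
  have "Phi a = Phi (\<gamma> \<otimes>\<^bsub>A\<^esub> zq)" "Phi b = Phi (\<alpha> \<otimes>\<^bsub>A\<^esub> uq \<ominus>\<^bsub>A\<^esub> \<gamma> \<otimes>\<^bsub>A\<^esub> zq)" "Phi c = Phi (\<beta> \<otimes>\<^bsub>A\<^esub> xq)"
    using \<alpha> \<beta> \<gamma> s by (simp_all add: Phi_minus Phi_mult) (intro ext, simp)+
  moreover note Phi_eqI[of a "\<gamma> \<otimes>\<^bsub>A\<^esub> zq"] Phi_eqI[of b "\<alpha> \<otimes>\<^bsub>A\<^esub> uq \<ominus>\<^bsub>A\<^esub> \<gamma> \<otimes>\<^bsub>A\<^esub> zq"]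
    Phi_eqI[of c "\<beta> \<otimes>\<^bsub>A\<^esub> xq"]
  ultimately show ?thesis using \<alpha>(1) \<beta>(1) \<gamma>(1)
    by (intro bexI[of _ \<alpha>] bexI[of _ \<beta>] bexI[of _ \<gamma>]) simp_all
qed

lemma kd_2_image: "kd 2 ` carrier (Mk 2) = a_kernel (Mk 1) (regular_module A) kd1"
proof (intro equalityI subsetI)
  fix g assume "g \<in> kd 2 ` carrier (Mk 2)"
  then obtain f where f: "f \<in> carrier (Mk 2)" "g = kd 2 f" by auto
  note [simp] = Mk_closed[OF f(1)]
  have "kd1 g = \<zero>\<^bsub>A\<^esub>" unfolding f(2) kd1_def kd_def
    by (simp add: A.m_assoc A.minus_eq A.l_distr A.l_minus relations A.r_neg)
  then show "g \<in> a_kernel (Mk 1) (regular_module A) kd1"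
    using lmod_hom_closed[OF kd_hom f(1)] f(2) by (simp add: a_kernel_def' regular_module_def)
next
  fix g assume "g \<in> a_kernel (Mk 1) (regular_module A) kd1"
  then have g: "g \<in> carrier (Mk 1)" "kd1 g = \<zero>\<^bsub>A\<^esub>" by (auto simp: a_kernel_def' regular_module_def)
  obtain \<alpha> \<beta> \<gamma> where c: "\<alpha> \<in> carrier A" "\<beta> \<in> carrier A" "\<gamma> \<in> carrier A"
    and e: "g 0 = \<gamma> \<otimes>\<^bsub>A\<^esub> zq" "g 1 = \<alpha> \<otimes>\<^bsub>A\<^esub> uq \<ominus>\<^bsub>A\<^esub> \<gamma> \<otimes>\<^bsub>A\<^esub> zq" "g 2 = \<beta> \<otimes>\<^bsub>A\<^esub> xq"
    using syzygy_A[OF Mk_closed[OF g(1)] Mk_closed[OF g(1)] Mk_closed[OF g(1)] g(2)[unfolded kd1_def]] by blast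
  let ?f = "\<lambda>i::nat. if i = 0 then \<alpha> else if i = 1 then \<beta> else if i = 2 then \<gamma> else \<zero>\<^bsub>A\<^esub>"
  have "g i = kd 2 ?f i" for i
  proof -
    consider "i = 0" | "i = 1" | "i = 2" | "i \<ge> 3" by linarith
    then show ?thesis using e by cases (simp_all add: kd_def Mk_out[OF g(1)] Bk_def)
  qed
  then have "g = kd 2 ?f" by (rule ext)
  moreover have "?f \<in> carrier (Mk 2)" unfolding Mk_iff using c by (auto simp: Bk_def)
  ultimately show "g \<in> kd 2 ` carrier (Mk 2)" by (rule image_eqI)
qed

lemma kd_3_image: "kd 3 ` carrier (Mk 3) = a_kernel (Mk 2) (Mk 1) (kd 2)"
proof (intro equalityI subsetI)
  fix g assume "g \<in> kd 3 ` carrier (Mk 3)"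
  then obtain f where f: "f \<in> carrier (Mk 3)" "g = kd 3 f" by auto
  note [simp] = Mk_closed[OF f(1)]
  have "kd 2 g = (\<lambda>i. \<zero>\<^bsub>A\<^esub>)" unfolding f(2) kd_def
    by (rule ext) (simp add: A.m_assoc A.minus_eq relations)
  then show "g \<in> a_kernel (Mk 2) (Mk 1) (kd 2)"
    using lmod_hom_closed[OF kd_hom f(1)] f(2) by (simp add: a_kernel_def' free_module_simps(2))
next
  fix g assume "g \<in> a_kernel (Mk 2) (Mk 1) (kd 2)"
  then have g: "g \<in> carrier (Mk 2)" "kd 2 g = (\<lambda>i. \<zero>\<^bsub>A\<^esub>)" by (auto simp: a_kernel_def' free_module_simps(2))
  note [simp] = Mk_closed[OF g(1)]
  have z: "g 2 \<otimes>\<^bsub>A\<^esub> zq = \<zero>\<^bsub>A\<^esub>" using fun_cong[OF g(2), of 0] by (simp add: kd_def)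
  have "g 0 \<otimes>\<^bsub>A\<^esub> uq = \<zero>\<^bsub>A\<^esub>" using fun_cong[OF g(2), of 1] z by (simp add: kd_def A.minus_zero_right)
  then have g0: "g 0 = \<zero>\<^bsub>A\<^esub>" by - (rule uxz.mult_u_inj, auto)
  have "g 1 \<otimes>\<^bsub>A\<^esub> xq = \<zero>\<^bsub>A\<^esub>" using fun_cong[OF g(2), of 2] by (simp add: kd_def)
  then obtain b where b: "b \<in> carrier A" "g 1 = b \<otimes>\<^bsub>A\<^esub> uq" using kernel_xq[of "g 1"] by auto
  obtain c where c: "c \<in> carrier A" "g 2 = c \<otimes>\<^bsub>A\<^esub> xq" using kernel_zq[OF _ z] by auto
  let ?f = "\<lambda>i::nat. if i = 0 then b else if i = 1 then c else \<zero>\<^bsub>A\<^esub>"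
  have "g i = kd 3 ?f i" for i
  proof -
    consider "i = 0" | "i = 1" | "i = 2" | "i \<ge> 3" by linarith
    then show ?thesis using b c g0 by cases (simp_all add: kd_def Mk_out[OF g(1)] Bk_def)
  qed
  then have "g = kd 3 ?f" by (rule ext)
  moreover have "?f \<in> carrier (Mk 3)" unfolding Mk_iff using b c by (auto simp: Bk_def)
  ultimately show "g \<in> kd 3 ` carrier (Mk 3)" by (rule image_eqI)
qed

lemma kd_4_image: "kd 4 ` carrier (Mk 4) = a_kernel (Mk 3) (Mk 2) (kd 3)"
proof (intro equalityI subsetI)
  fix g assume "g \<in> kd 4 ` carrier (Mk 4)"
  then obtain f where f: "f \<in> carrier (Mk 4)" "g = kd 4 f" by auto
  note [simp] = Mk_closed[OF f(1)]
  have "kd 3 g = (\<lambda>i. \<zero>\<^bsub>A\<^esub>)" unfolding f(2) kd_def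
    by (rule ext) (simp add: A.m_assoc relations)
  then show "g \<in> a_kernel (Mk 3) (Mk 2) (kd 3)"
    using lmod_hom_closed[OF kd_hom f(1)] f(2) by (simp add: a_kernel_def' free_module_simps(2))
next
  fix g assume "g \<in> a_kernel (Mk 3) (Mk 2) (kd 3)"
  then have g: "g \<in> carrier (Mk 3)" "kd 3 g = (\<lambda>i. \<zero>\<^bsub>A\<^esub>)" by (auto simp: a_kernel_def' free_module_simps(2))
  note [simp] = Mk_closed[OF g(1)]
  have "g 0 \<otimes>\<^bsub>A\<^esub> uq = \<zero>\<^bsub>A\<^esub>" using fun_cong[OF g(2), of 1] by (simp add: kd_def)
  then have g0: "g 0 = \<zero>\<^bsub>A\<^esub>" by - (rule uxz.mult_u_inj, auto)
  have "g 1 \<otimes>\<^bsub>A\<^esub> xq = \<zero>\<^bsub>A\<^esub>" using fun_cong[OF g(2), of 2] by (simp add: kd_def)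
  then obtain b where b: "b \<in> carrier A" "g 1 = b \<otimes>\<^bsub>A\<^esub> uq" using kernel_xq[of "g 1"] by auto
  let ?f = "\<lambda>i::nat. if i = 0 then b else \<zero>\<^bsub>A\<^esub>"
  have "g i = kd 4 ?f i" for i
  proof -
    consider "i = 0" | "i = 1" | "i \<ge> 2" by linarith
    then show ?thesis using b g0 by cases (simp_all add: kd_def Mk_out[OF g(1)] Bk_def)
  qed
  then have "g = kd 4 ?f" by (rule ext)
  moreover have "?f \<in> carrier (Mk 4)" unfolding Mk_iff using b by (auto simp: Bk_def)
  ultimately show "g \<in> kd 4 ` carrier (Mk 4)" by (rule image_eqI)
qed

lemma Mk_ge_5:
  assumes "k \<ge> 5" shows "carrier (Mk k) = {\<lambda>i. \<zero>\<^bsub>A\<^esub>}"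
proof -
  have B: "i \<notin> Bk k" for i using assms by (simp add: Bk_def)
  have "f \<in> carrier (Mk k) \<longleftrightarrow> f = (\<lambda>i. \<zero>\<^bsub>A\<^esub>)" for f by (auto simp: Mk_iff B fun_eq_iff)
  then show ?thesis by blast
qed

text \<open>At \<open>k = 4\<close> this is the injectivity of right multiplication by
  \<open>u\<close>; beyond that all modules are zero.\<close>

lemma kd_ge_5_image:
  assumes "k \<ge> 4" shows "kd (k + 1) ` carrier (Mk (k + 1)) = a_kernel (Mk k) (Mk (k - 1)) (kd k)"
proof -
  have "kd (k + 1) ` carrier (Mk (k + 1)) = {\<lambda>i. \<zero>\<^bsub>A\<^esub>}"
    using assms Mk_ge_5[of "k + 1"] by (auto simp: kd_def)
  moreover have "g = (\<lambda>i. \<zero>\<^bsub>A\<^esub>)" if g: "g \<in> carrier (Mk k)" "kd k g = (\<lambda>i. \<zero>\<^bsub>A\<^esub>)" for g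
  proof (cases "k = 4")
    case True
    have "g 0 \<otimes>\<^bsub>A\<^esub> uq = \<zero>\<^bsub>A\<^esub>" using fun_cong[OF g(2), of 1] True by (simp add: kd_def)
    then have "g 0 = \<zero>\<^bsub>A\<^esub>" using Mk_closed[OF g(1)] by - (rule uxz.mult_u_inj, auto)
    then have "g i = \<zero>\<^bsub>A\<^esub>" for i
      using Mk_out[OF g(1), of i] True by (cases "i = 0") (simp_all add: Bk_def)
    then show ?thesis by (rule ext)
  qed (use g assms Mk_ge_5[of k] in auto)
  moreover have "(\<lambda>i. \<zero>\<^bsub>A\<^esub>) \<in> carrier (Mk k)" by (simp add: Mk_iff)
  moreover have "kd k (\<lambda>i. \<zero>\<^bsub>A\<^esub>) = (\<lambda>i. \<zero>\<^bsub>A\<^esub>)"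
    by (rule ext) (simp add: kd_def A.minus_zero_right)
  ultimately show ?thesis by (auto simp: a_kernel_def' free_module_simps(2))
qed

theorem koszul_I: "koszul 3 I"
proof -
  have "augmentation ` carrier (regular_module A) = carrier (trivial_module :: (_, 'k) module)"
  proof -
    have "\<exists>a\<in>carrier A. c = augmentation a" for c
      by (intro bexI[of _ "q 3 I (scalar c)"]) (simp_all add: augmentation_eq Phi_q_Nil)
    then show ?thesis by (auto simp: regular_module_def trivial_module_def image_iff)
  qed
  moreover have "kd (k + 1) ` carrier (Mk (k + 1)) = a_kernel (Mk k) (Mk (k - 1)) (kd k)" if k: "k \<ge> 2" for k
  proof -
    consider "k = 2" | "k = 3" | "k \<ge> 4" using k by linarith
    then show ?thesis using kd_3_image kd_4_image kd_ge_5_image by cases auto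
  qed
  ultimately show ?thesis
    unfolding koszul_def Let_def using proper_graded kd1_hom kd1_deg kd1_image kd_hom kd_deg kd_2_image
    by (intro conjI exI[of _ Bk] exI[of _ kd1] exI[of _ kd]) auto
qed

end

section \<open>The component of degree one\<close>

context example_algebra
begin

text \<open>The relations have degree two, and the elements without constant and linear terms form
  an ideal.\<close>

lemma vanish_deg_1: assumes "f \<in> I" "i < 3" shows "f [i] = 0"
proof -
  define S :: "(nat list \<Rightarrow> 'k) set" where
    "S = {f \<in> carrier (free_algebra 3). f [] = 0 \<and> (\<forall>i<3. f [i] = 0)}"
  have "ideal S (free_algebra 3)"
    by (rule ideal_of_pointwise)
      (auto simp: S_def mult_apply add_pointwise_closed scale_pointwise_closed[of _ _ "-1", simplified]
        free_algebra_mult_closed free_algebra_carrier[of "\<lambda>w. 0"])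
  moreover have "relR \<subseteq> S"
  proof
    fix f :: "nat list \<Rightarrow> 'k" assume f: "f \<in> relR"
    then have "f \<in> carrier (free_algebra 3)" using relR_carrier by blast
    moreover have "f [] = 0 \<and> (\<forall>i<3. f [i] = 0)" using f unfolding relR_iff by (auto simp: word_vec_def)
    ultimately show "f \<in> S" by (simp add: S_def)
  qed
  ultimately have "I \<subseteq> S" unfolding I_eq by (rule quadratic_ideal_minimal)
  then show ?thesis using assms by (auto simp: S_def)
qed

lemma alg_dim_1: "alg_dim 3 I 1 = 3"
proof -
  have ws: "w \<in> set [[0], [1], [2]] \<Longrightarrow> set w \<subseteq> {..<3} \<and> length w = 1" for w :: "nat list" by auto
  have "qw w = \<zero>\<^bsub>A\<^esub> \<or> (\<exists>b\<in>set [[0], [1], [2]]. qw w = qw b)" if w: "set w \<subseteq> {..<3}" "length w = 1" for w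
  proof -
    obtain i where i: "w = [i]" "i < 3" using w by (cases w) auto
    then have "i = 0 \<or> i = 1 \<or> i = 2" by linarith
    then show ?thesis using i(1) by auto
  qed
  from alg_deg_eq_Span[OF proper ws this]
  have "alg_deg 3 I 1 = A.Span Kq (map qw [[0], [1], [2]])" by blast
  moreover have "A.independent Kq (map qw [[0], [1], [2]])"
    by (rule independent_words[OF proper, where lam = "\<lambda>b f. f b"])
      (use ws vanish_deg_1 in \<open>auto simp: word_vec_def\<close>)
  ultimately have "alg_dim 3 I 1 = length [[0], [1], [2::nat]]" by (rule alg_dim_eq[OF proper])
  then show ?thesis by simp
qed

end

section \<open>The Koszul dual\<close>

lemma pairing_superset:
  "\<lbrakk>finite S; {w. f w \<noteq> 0} \<subseteq> S\<rbrakk> \<Longrightarrow> pairing f g = (\<Sum>w\<in>S. f w * g w)"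
  unfolding pairing_def by (intro sum.mono_neutral_left) auto

lemma pairing_word_vec:
  "finite {w. f w \<noteq> 0} \<Longrightarrow> pairing f (word_vec v) = f v"
  by (subst pairing_superset[of "insert v {w. f w \<noteq> 0}"]) (auto simp: word_vec_def if_distrib cong: if_cong)

lemma pairing_diff: "pairing f (\<lambda>w. g w - h w) = pairing f g - pairing f h"
  by (simp add: pairing_def algebra_simps sum_subtractf)

lemma word_vec_pairing: "pairing (word_vec v) g = g v"
  by (subst pairing_superset[of "{v}"]) (auto simp: word_vec_def)

lemma word_vec_add_pairing: "v \<noteq> v' \<Longrightarrow> pairing (\<lambda>w. word_vec v w + word_vec v' w) g = g v + g v'"
  by (subst pairing_superset[of "{v, v'}"]) (auto simp: word_vec_def)

text \<open>The annihilator of the spaces \<open>\<Inter>\<^sub>i V\<^sup>i R V\<^sup>k\<^sup>-\<^sup>2\<^sup>-\<^sup>i\<close>, which for \<open>k = 0, \<dots>, 4\<close> have the bases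
  \<open>1\<close>; \<open>x, y, z\<close>; \<open>ux, xz, zy\<close>; \<open>uxz, xzy\<close>; \<open>uxzy\<close>.\<close>

definition dual_vanishing :: "(nat list \<Rightarrow> 'k::field) set" where
  "dual_vanishing = {f \<in> carrier (free_algebra 3). f [] = 0 \<and> f [0] = 0 \<and> f [1] = 0 \<and> f [2] = 0 \<and>
     f [0,0] + f [1,0] = 0 \<and> f [0,2] = 0 \<and> f [2,1] = 0 \<and> f [0,0,2] + f [1,0,2] = 0 \<and> f [0,2,1] = 0 \<and>
     f [0,0,2,1] + f [1,0,2,1] = 0}"

text \<open>The annihilated spaces form a coalgebra under cutting words in two: \<open>uxzy\<close>,
  for instance, is cut into \<open>u\<close> and \<open>xzy\<close> or into \<open>ux\<close> and
  \<open>zy\<close>. A coefficient of a product along one of them is a sum of products in which one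
  factor is a coefficient of \<open>f\<close> along another, and these vanish.\<close>

lemma ideal_dual_vanishing: "ideal (dual_vanishing :: (nat list \<Rightarrow> 'k::field) set) (free_algebra 3)"
proof (rule ideal_of_pointwise)
  fix f g :: "nat list \<Rightarrow> 'k" assume f: "f \<in> dual_vanishing" and g: "g \<in> carrier (free_algebra 3)"
  have fc: "f \<in> carrier (free_algebra 3)" and z: "f [] = 0" "f [0] = 0" "f [1] = 0" "f [2] = 0"
     "f [1,0] = - f [0,0]" "f [0,2] = 0" "f [2,1] = 0" "f [1,0,2] = - f [0,0,2]" "f [0,2,1] = 0"
     "f [1,0,2,1] = - f [0,0,2,1]"
    using f by (simp_all add: dual_vanishing_def eq_neg_iff_add_eq_0 add.commute)
  show "f \<otimes>\<^bsub>free_algebra 3\<^esub> g \<in> dual_vanishing" "g \<otimes>\<^bsub>free_algebra 3\<^esub> f \<in> dual_vanishing"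
    unfolding dual_vanishing_def using free_algebra_mult_closed[OF fc g] free_algebra_mult_closed[OF g fc]
    by (simp_all add: mult_apply z[simplified])
next
  fix f g :: "nat list \<Rightarrow> 'k" assume f: "f \<in> dual_vanishing" and g: "g \<in> dual_vanishing"
  have fc: "f \<in> carrier (free_algebra 3)" and gc: "g \<in> carrier (free_algebra 3)"
    using f g by (simp_all add: dual_vanishing_def)
  have e: "f v + g v + (f w + g w) = (f v + f w) + (g v + g w)" for v w by simp
  show "(\<lambda>w. f w + g w) \<in> dual_vanishing"
    using f g add_pointwise_closed[OF fc gc] by (simp add: dual_vanishing_def e)
next
  fix f :: "nat list \<Rightarrow> 'k" assume f: "f \<in> dual_vanishing"
  then have fc: "f \<in> carrier (free_algebra 3)" by (simp add: dual_vanishing_def)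
  have e: "- f v - f w = - (f v + f w)" for v w by simp
  show "(\<lambda>w. - f w) \<in> dual_vanishing"
    using f scale_pointwise_closed[OF fc, of "-1"] by (simp add: dual_vanishing_def e del: minus_add_distrib)
qed (auto simp: dual_vanishing_def free_algebra_carrier[of "\<lambda>w. 0"])

lemma orth_relR_dual_vanishing: "orth 3 relR \<subseteq> (dual_vanishing :: (nat list \<Rightarrow> 'k::field) set)"
proof
  fix f :: "nat list \<Rightarrow> 'k" assume f: "f \<in> orth 3 relR"
  then have fd: "f \<in> free_deg 3 2" and p: "\<And>r. r \<in> relR \<Longrightarrow> pairing r f = 0" by (auto simp: orth_def)
  have l: "f w = 0" if "length w \<noteq> 2" for w using fd that by (auto simp: free_deg_def)
  have "f [0,0] + f [1,0] = 0" "f [0,2] = 0" "f [2,1] = 0"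
    using p[OF relR_gens(1)] p[OF relR_gens(2)] p[OF relR_gens(3)]
    by (simp_all add: word_vec_pairing word_vec_add_pairing)
  then show "f \<in> dual_vanishing" using fd l by (simp add: dual_vanishing_def free_deg_def)
qed

lemma relR_coeffs:
  assumes "f \<in> relR"
  shows "f [0,1] = 0" "f [1,1] = 0" "f [1,2] = 0" "f [2,0] = 0" "f [2,2] = 0" "f [0,0] = f [1,0]"
  using assms by (auto simp: relR_iff word_vec_def)

text \<open>The orthogonal complement has dimension \<open>9 - 3\<close>; these six elements span it
  and supply the rewriting rules of the dual algebra.\<close>

lemma orth_relR_words:
  "v \<in> {[0,1], [1,1], [1,2], [2,0], [2,2]} \<Longrightarrow> word_vec v \<in> (orth 3 relR :: (nat list \<Rightarrow> 'k::field) set)"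
  "(\<lambda>w. word_vec [0,0] w - word_vec [1,0] w) \<in> (orth 3 relR :: (nat list \<Rightarrow> 'k::field) set)"
proof -
  have fin: "finite {w. f w \<noteq> 0}" if "f \<in> (relR :: (nat list \<Rightarrow> 'k) set)" for f
    using that relR_carrier by (auto simp: free_algebra_carrier)
  assume v: "v \<in> {[0,1], [1,1], [1,2], [2,0], [2,2]}"
  then have "set v \<subseteq> {..<3}" "length v = 2" by auto
  then have "word_vec v \<in> free_deg 3 2" by (simp add: free_deg_def) (simp add: word_vec_def)
  then show "word_vec v \<in> (orth 3 relR :: (nat list \<Rightarrow> 'k) set)"
    using v relR_coeffs by (auto simp: orth_def pairing_word_vec fin)
next
  have fin: "finite {w. f w \<noteq> 0}" if "f \<in> (relR :: (nat list \<Rightarrow> 'k) set)" for f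
    using that relR_carrier by (auto simp: free_algebra_carrier)
  have c: "word_vec [0,0] \<in> carrier (free_algebra 3 :: (nat list \<Rightarrow> 'k) ring)"
    "word_vec [1,0] \<in> carrier (free_algebra 3 :: (nat list \<Rightarrow> 'k) ring)" by simp_all
  have "(\<lambda>w. word_vec [0,0] w - word_vec [1,0] w) \<in> carrier (free_algebra 3 :: (nat list \<Rightarrow> 'k) ring)"
    using add_pointwise_closed[OF c(1) scale_pointwise_closed[OF c(2), of "-1"]] by simp
  moreover have "length w = 2" if "word_vec [0,0] w - word_vec [1,0] w \<noteq> (0::'k)" for w
    using that by (auto simp: word_vec_def split: if_splits)
  ultimately have "(\<lambda>w. word_vec [0,0] w - word_vec [1,0] w) \<in> (free_deg 3 2 :: (nat list \<Rightarrow> 'k) set)"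
    by (simp only: free_deg_def mem_Collect_eq) blast
  then show "(\<lambda>w. word_vec [0,0] w - word_vec [1,0] w) \<in> (orth 3 relR :: (nat list \<Rightarrow> 'k) set)"
    using relR_coeffs(6) by (auto simp: orth_def pairing_diff pairing_word_vec fin)
qed

locale dual_algebra =
  fixes I :: "(nat list \<Rightarrow> 'k::field) set"
  assumes I_eq: "I = quadratic_ideal 3 (orth 3 relR)"

lemma orth_carrier: "orth n S \<subseteq> carrier (free_algebra n)"
  by (auto simp: orth_def free_deg_def)

sublocale dual_algebra \<subseteq> free_algebra_quotient 3 I
  by (rule free_algebra_quotient.intro) (simp add: I_eq ideal_quadratic_ideal[OF orth_carrier])

context dual_algebra
begin

lemma I_dual_vanishing: "I \<subseteq> dual_vanishing"
  unfolding I_eq by (rule quadratic_ideal_minimal[OF ideal_dual_vanishing orth_relR_dual_vanishing])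

lemma proper: "I \<noteq> carrier FA"
proof
  assume "I = carrier FA"
  then have "word_vec [] \<in> I" by simp
  then have "word_vec [] [] = (0 :: 'k)" using I_dual_vanishing by (auto simp: dual_vanishing_def)
  then show False by (simp add: word_vec_def)
qed

lemma qw_append: "\<lbrakk>set v \<subseteq> {..<3}; set w \<subseteq> {..<3}\<rbrakk> \<Longrightarrow> qw (v @ w) = qw v \<otimes>\<^bsub>A\<^esub> qw w"
  using q_mult[of "word_vec v" "word_vec w"] by (simp add: word_vec_mult)

lemma qw_zero: "v \<in> {[0,1], [1,1], [1,2], [2,0], [2,2]} \<Longrightarrow> qw v = \<zero>\<^bsub>A\<^esub>"
  using quadratic_ideal_self[OF orth_carrier] orth_relR_words(1)
  by (subst q_eq_zero_iff) (auto simp: I_eq)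

lemma qw_00: "qw [0,0] = qw [1,0]"
  using quadratic_ideal_self[OF orth_carrier] orth_relR_words(2)
  by (subst q_eq_iff) (auto simp: I_eq)

lemma qw_infix_zero:
  assumes "qw v = \<zero>\<^bsub>A\<^esub>" "set (l @ v @ r) \<subseteq> {..<3}" shows "qw (l @ v @ r) = \<zero>\<^bsub>A\<^esub>"
  using assms by (simp add: qw_append)

text \<open>In the dual algebra \<open>xx = yx\<close>, and \<open>xx\<close> is kept as the normal
  form. The words correspond to the chains counted by \<open>rk\<close>, a first letter
  \<open>u\<close> of a relation being represented by \<open>x\<close>.\<close>

definition basis_words :: "nat \<Rightarrow> nat list list" where
  "basis_words j = (if j = 0 then [[]] else if j = 1 then [[0], [1], [2]] else if j = 2 then [[0,0], [0,2], [2,1]]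
     else if j = 3 then [[0,0,2], [0,2,1]] else if j = 4 then [[0,0,2,1]] else [])"

lemma basis_words_snoc:
  assumes "b \<in> set (basis_words j)" "i < 3"
  shows "qw (b @ [i]) = \<zero>\<^bsub>A\<^esub> \<or> (\<exists>b'\<in>set (basis_words (Suc j)). qw (b @ [i]) = qw b')"
proof -
  have i: "i = 0 \<or> i = 1 \<or> i = 2" using assms(2) by linarith
  have z2: "qw [0,1] = \<zero>\<^bsub>A\<^esub>" "qw [1,1] = \<zero>\<^bsub>A\<^esub>" "qw [1,2] = \<zero>\<^bsub>A\<^esub>" "qw [2,0] = \<zero>\<^bsub>A\<^esub>" "qw [2,2] = \<zero>\<^bsub>A\<^esub>"
    by (simp_all add: qw_zero)
  have e: "qw [0,0] = qw [0] \<otimes>\<^bsub>A\<^esub> qw [0]" "qw [1,0] = qw [1] \<otimes>\<^bsub>A\<^esub> qw [0]" "qw [1,1] = qw [1] \<otimes>\<^bsub>A\<^esub> qw [1]"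
    "qw [2,0] = qw [2] \<otimes>\<^bsub>A\<^esub> qw [0]"
    using qw_append[of "[0]" "[0]"] qw_append[of "[1]" "[0]"] qw_append[of "[1]" "[1]"] qw_append[of "[2]" "[0]"]
    by simp_all
  have c: "qw [0] \<in> carrier A" "qw [1] \<in> carrier A" "qw [2] \<in> carrier A" by simp_all
  have s: "qw [0] \<otimes>\<^bsub>A\<^esub> qw [0] = qw [1] \<otimes>\<^bsub>A\<^esub> qw [0]" using qw_00 e by simp
  have z11: "qw [1] \<otimes>\<^bsub>A\<^esub> qw [1] = \<zero>\<^bsub>A\<^esub>" by (rule trans[OF e(3)[symmetric] z2(2)])
  have z20: "qw [2] \<otimes>\<^bsub>A\<^esub> qw [0] = \<zero>\<^bsub>A\<^esub>" by (rule trans[OF e(4)[symmetric] z2(4)])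
  \<comment> \<open>Two consequences of degree three that are not visible as a vanishing pair of
    letters: \<open>xxx = yxx = yyx = 0\<close> by \<open>xx = yx\<close> and \<open>yy = 0\<close>,
    and \<open>zyx = zxx = 0\<close> by \<open>zx = 0\<close>.\<close>
  have z3: "qw [0,0,0] = \<zero>\<^bsub>A\<^esub>" "qw [2,1,0] = \<zero>\<^bsub>A\<^esub>"
  proof -
    have "qw [0,0,0] = qw [0] \<otimes>\<^bsub>A\<^esub> qw [0] \<otimes>\<^bsub>A\<^esub> qw [0]"
      using qw_append[of "[0,0]" "[0]"] e by simp
    also have "\<dots> = qw [1] \<otimes>\<^bsub>A\<^esub> (qw [0] \<otimes>\<^bsub>A\<^esub> qw [0])" using c by (simp only: s A.m_assoc)
    also have "\<dots> = (qw [1] \<otimes>\<^bsub>A\<^esub> qw [1]) \<otimes>\<^bsub>A\<^esub> qw [0]" using c by (simp only: s A.m_assoc)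
    also have "\<dots> = \<zero>\<^bsub>A\<^esub>" using c by (simp only: z11 A.l_null)
    finally show "qw [0,0,0] = \<zero>\<^bsub>A\<^esub>" .
    have "qw [2,1,0] = qw [2] \<otimes>\<^bsub>A\<^esub> (qw [1] \<otimes>\<^bsub>A\<^esub> qw [0])"
      using qw_append[of "[2]" "[1,0]"] e by simp
    also have "\<dots> = (qw [2] \<otimes>\<^bsub>A\<^esub> qw [0]) \<otimes>\<^bsub>A\<^esub> qw [0]" using c by (simp only: s[symmetric] A.m_assoc)
    also have "\<dots> = \<zero>\<^bsub>A\<^esub>" using c by (simp only: z20 A.l_null)
    finally show "qw [2,1,0] = \<zero>\<^bsub>A\<^esub>" .
  qed
  note inf = qw_infix_zero[where r = "[]", simplified]
  have z: "qw [0,0,1] = \<zero>\<^bsub>A\<^esub>" "qw [0,2,0] = \<zero>\<^bsub>A\<^esub>" "qw [0,2,2] = \<zero>\<^bsub>A\<^esub>" "qw [2,1,1] = \<zero>\<^bsub>A\<^esub>" "qw [2,1,2] = \<zero>\<^bsub>A\<^esub>"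
    "qw [0,0,2,0] = \<zero>\<^bsub>A\<^esub>" "qw [0,0,2,2] = \<zero>\<^bsub>A\<^esub>" "qw [0,2,1,0] = \<zero>\<^bsub>A\<^esub>" "qw [0,2,1,1] = \<zero>\<^bsub>A\<^esub>" "qw [0,2,1,2] = \<zero>\<^bsub>A\<^esub>"
    "qw [0,0,2,1,0] = \<zero>\<^bsub>A\<^esub>" "qw [0,0,2,1,1] = \<zero>\<^bsub>A\<^esub>" "qw [0,0,2,1,2] = \<zero>\<^bsub>A\<^esub>"
    using inf[OF z2(1), of "[0]"] inf[OF z2(4), of "[0]"] inf[OF z2(5), of "[0]"] inf[OF z2(2), of "[2]"]
      inf[OF z2(3), of "[2]"] inf[OF z2(4), of "[0,0]"] inf[OF z2(5), of "[0,0]"] inf[OF z3(2), of "[0]"]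
      inf[OF z2(2), of "[0,2]"] inf[OF z2(3), of "[0,2]"] inf[OF z3(2), of "[0,0]"] inf[OF z2(2), of "[0,0,2]"]
      inf[OF z2(3), of "[0,0,2]"]
    by simp_all
  consider "j = 0" | "j = 1" | "j = 2" | "j = 3" | "j = 4" | "j \<ge> 5" by linarith
  then show ?thesis
    using assms(1) i by cases (auto simp: basis_words_def qw_00[simplified] z[simplified] z2[simplified] z3[simplified])
qed

lemma basis_words_cover:
  "\<lbrakk>set w \<subseteq> {..<3}; length w = j\<rbrakk> \<Longrightarrow> qw w = \<zero>\<^bsub>A\<^esub> \<or> (\<exists>b\<in>set (basis_words j). qw w = qw b)"
proof (induction w arbitrary: j rule: rev_induct)
  case Nil
  then show ?case by (simp add: basis_words_def)
next
  case (snoc i w)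
  then obtain j' where j: "j = Suc j'" "length w = j'" by auto
  have i: "i < 3" and w: "set w \<subseteq> {..<3}" using snoc.prems(1) by auto
  have e: "qw (w @ [i]) = qw w \<otimes>\<^bsub>A\<^esub> qw [i]" using i w by (intro qw_append) auto
  from snoc.IH[OF w j(2)] show ?case
  proof
    assume "qw w = \<zero>\<^bsub>A\<^esub>"
    then show ?case using e i by simp
  next
    assume "\<exists>b\<in>set (basis_words j'). qw w = qw b"
    then obtain b where b: "b \<in> set (basis_words j')" "qw w = qw b" by blast
    have "set b \<subseteq> {..<3}" using b(1) by (auto simp: basis_words_def split: if_splits)
    then have "qw (w @ [i]) = qw (b @ [i])" using e b(2) i qw_append[of b "[i]"] by simp
    then show ?case using basis_words_snoc[OF b(1) i] j(1) by simp
  qed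
qed

text \<open>The functionals are the pairings with the chains: where a basis word begins with
  \<open>xx\<close>, its first letter stands for \<open>u = x + y\<close>, hence the second summand.
  They vanish on the ideal by \<open>I_dual_vanishing\<close>.\<close>

lemma basis_words_independent: "A.independent Kq (map qw (basis_words j))"
proof (rule independent_words[OF proper, where lam = "\<lambda>b f. f b + (if take 2 b = [0,0] then f (1 # tl b) else 0)"])
  show "set w \<subseteq> {..<3}" if "w \<in> set (basis_words j)" for w
    using that by (auto simp: basis_words_def split: if_splits)
  show "distinct (basis_words j)" by (auto simp: basis_words_def)
  show "f b + (if take 2 b = [0,0] then f (1 # tl b) else 0) = 0"
    if "b \<in> set (basis_words j)" "f \<in> I" for b and f :: "nat list \<Rightarrow> 'k"
  proof -
    have "f \<in> dual_vanishing" using that(2) I_dual_vanishing by blast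
    then show ?thesis using that(1) by (auto simp: basis_words_def dual_vanishing_def split: if_splits)
  qed
  show "word_vec c b + (if take 2 b = [0,0] then word_vec c (1 # tl b) else 0) = (if b = c then 1 else (0::'k))"
    if "b \<in> set (basis_words j)" "c \<in> set (basis_words j)" for b c
    using that by (auto simp: basis_words_def word_vec_def split: if_splits)
qed (auto simp: algebra_simps)

lemma alg_dim_dual: "alg_dim 3 I j = length (basis_words j)"
proof (rule alg_dim_eq[OF proper _ basis_words_independent])
  have "w \<in> set (basis_words j) \<Longrightarrow> set w \<subseteq> {..<3} \<and> length w = j" for w
    by (auto simp: basis_words_def split: if_splits)
  then show "alg_deg 3 I j = A.Span Kq (map qw (basis_words j))"
    using basis_words_cover by (intro alg_deg_eq_Span[OF proper]) auto
qed

lemma hilbert_series_dual: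
  "hilbert_series 3 I = 1 + 3 * fps_X + 3 * fps_X ^ 2 + 2 * fps_X ^ 3 + fps_X ^ 4"
proof (rule fps_ext)
  fix j
  have "fps_nth (hilbert_series 3 I) j = int (length (basis_words j))"
    by (simp add: hilbert_series_def alg_dim_dual)
  also have "\<dots> = fps_nth (1 + 3 * fps_X + 3 * fps_X ^ 2 + 2 * fps_X ^ 3 + fps_X ^ 4) j"
    by (simp add: basis_words_def fps_X_power_nth fps_X_nth numeral_fps_const)
  finally show "fps_nth (hilbert_series 3 I) j = fps_nth (1 + 3 * fps_X + 3 * fps_X ^ 2 + 2 * fps_X ^ 3 + fps_X ^ 4) j" .
qed

end

section \<open>The main theorem\<close>

theorem mainTheorem3:
  fixes F :: "(nat list \<Rightarrow> 'k::field) ring" (structure)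
    and x y z :: "nat list \<Rightarrow> 'k"
    and R I :: "(nat list \<Rightarrow> 'k) set"
  assumes "F = free_algebra 3"
    and "x = gen 0" and "y = gen 1" and "z = gen 2"
    and "R = ring.Span F (range scalar) [x \<otimes> x \<oplus> y \<otimes> x, x \<otimes> z, z \<otimes> y]"
    and "I = quadratic_ideal 3 R"
  shows "koszul 3 I \<and>
    hilbert_series 3 (quadratic_ideal 3 (orth 3 R)) =
      1 + 3 * fps_X + 3 * fps_X ^ 2 + 2 * fps_X ^ 3 + fps_X ^ 4 \<and>
    global_dimension TYPE('u) (quot_alg 3 I) = 4 \<and>
    alg_dim 3 I 1 = 3 \<and>
    \<not> (\<forall>n (J :: (nat list \<Rightarrow> 'k) set) d.
         koszul n J \<and> global_dimension TYPE('u) (quot_alg n J) = enat d \<longrightarrow> d \<le> alg_dim n J 1)"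
proof -
  have R: "R = relR" using assms by (simp add: relR_def)
  interpret E: example_algebra I by unfold_locales (simp add: assms(6) R)
  interpret D: dual_algebra "quadratic_ideal 3 (orth 3 R)" by unfold_locales (simp add: R)
  have gl: "global_dimension TYPE('u) (quot_alg 3 I) = 4" by (rule E.global_dimension_A)
  have "\<not> (\<forall>n (J :: (nat list \<Rightarrow> 'k) set) d.
      koszul n J \<and> global_dimension TYPE('u) (quot_alg n J) = enat d \<longrightarrow> d \<le> alg_dim n J 1)"
  proof
    assume "\<forall>n (J :: (nat list \<Rightarrow> 'k) set) d.
      koszul n J \<and> global_dimension TYPE('u) (quot_alg n J) = enat d \<longrightarrow> d \<le> alg_dim n J 1"
    \<comment> \<open>The algebra itself is the counterexample, with \<open>d = 4\<close> against
      three generators.\<close>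
    then have "4 \<le> alg_dim 3 I 1" using E.koszul_I gl by (simp add: numeral_eq_enat)
    then show False by (simp add: E.alg_dim_1[simplified])
  qed
  then show ?thesis using E.koszul_I gl E.alg_dim_1 D.hilbert_series_dual by blast
qed

end
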